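(* For $n\ge1$ let $\mu_n=\frac Tn\sum_{i=0}^{n-1}\delta_{iT/n}$ and $f_n(t,x)=\mathbb{E}\big[\exp\big(\int_t^T\sum_{i=1}^3u_i(s)p_i(X_s)\mu_n(ds)+v(T)q(X_T)\big)\mid X_t=x\big]$. Suppose $f_n(t,\cdot)$ does not vanish on $\mathbb{R}$ for every $t\in[0,T]$, and let $\log f_n$ be a function with $\exp(\log f_n)=f_n$ which is continuous on each region $(\frac{jT}{n},\frac{(j+1)T}{n}]\times\mathbb{R}$, $j=0,\dots,n-1$, satisfies $\lim_{s\to t^+}\log f_n(s,x)=\log f_n(t,x)-\frac Tn\sum_{i=1}^3u_i(t)p_i(x)$ for $t\in\mathrm{supp}(\mu_n)=\{0,\frac Tn,\dots,\frac{(n-1)T}{n}\}$, and $\log f_n(T,x)=v(T)q(x)$. Then \[ \phi_{n,k}(t)=\frac1{k!}\partial_x^k\log f_n(T-t,x)\Big|_{x=0},\quad t\ge0, \] solves \[ \phi_{n,k}'(t)=bk\phi_{n,k}(t)+a(k+1)\phi_{n,k+1}(t)+\tfrac{c^2(k+2)(k+1)}{2}\phi_{n,k+2}(t)+\tfrac{c^2}{2}(\widetilde\phi_n(t)*\widetilde\phi_n(t))_k,\quad \widetilde\phi_{n,k}=(k+1)\phi_{n,k+1}, \] for $t\in\{T-u:u\notin\mathrm{supp}(\mu_n)\cup\{T\}\}$, \[ \phi_{n,k}(t)=\lim_{s\to t^-}\phi_{n,k}(s)+\tfrac Tn\sum_{i=1}^3u_i(T-t)(p_i)_k,\quad t\in\{T-u:u\in\mathrm{supp}(\mu_n)\},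 \] and $\phi_{n,k}(0)=v(T)q_k$.
   Context: Let $W$ be a Brownian motion; $a,b\in\mathbb{R}$, $c\ne0$, $T>0$; $dX_t=(a+bX_t)dt+c\,dW_t$. $(r)_k$ or $r_k$ is the coefficient of $x^k$ in a power series $r$; $(\alpha*\beta)_k=\sum_{l=0}^k\alpha_l\beta_{k-l}$. Negligible to double factorial: $\limsup_k(|p_k|(k-1)!!)^{1/k}=0$, $(-1)!!=0!!=1$. Standing assumptions: $u_1,u_2,u_3,v:[0,T]\to\mathbb{C}$ continuous with $\Re(u_1)\le0$, $\Re(u_2)=\Re(u_3)=\Re(v)=0$; $p_1=p^2$ for a real-coefficient power series $p$ negligible to double factorial; $p_2,p_3,q$ real-coefficient power series negligible to double factorial. *)

theory Defs
  imports "HOL-Probability.Probability"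
begin

definition brownian_motion :: "'a measure \<Rightarrow> (real \<Rightarrow> 'a \<Rightarrow> real) \<Rightarrow> bool" where
  "brownian_motion M W \<longleftrightarrow>
     prob_space M \<and>
     (\<forall>t. W t \<in> borel_measurable M) \<and>
     (\<forall>\<omega>\<in>space M. W 0 \<omega> = 0) \<and>
     (\<forall>\<omega>\<in>space M. continuous_on {0..} (\<lambda>t. W t \<omega>)) \<and>
     (\<forall>s t. 0 \<le> s \<longrightarrow> s < t \<longrightarrow>
        distributed M lborel (\<lambda>\<omega>. W t \<omega> - W s \<omega>) (normal_density 0 (sqrt (t - s)))) \<and>
     (\<forall>(ts :: nat \<Rightarrow> real) m. 0 \<le> ts 0 \<longrightarrow> (\<forall>i<m. ts i < ts (Suc i)) \<longrightarrow>
        prob_space.indep_vars M (\<lambda>_. borel) (\<lambda>i \<omega>. W (ts (Suc i)) \<omega> - W (ts i) \<omega>) {..<m})"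

text \<open>Double factorial, with (-1)!! = 0!! = 1 (for nat, k - 1 = 0 when k = 0).\<close>
fun dfact :: "nat \<Rightarrow> nat" where
  "dfact 0 = 1"
| "dfact (Suc 0) = 1"
| "dfact (Suc (Suc n)) = Suc (Suc n) * dfact n"

definition negligible_dfact :: "(nat \<Rightarrow> real) \<Rightarrow> bool" where
  "negligible_dfact p \<longleftrightarrow>
     limsup (\<lambda>k. ereal (root k (\<bar>p k\<bar> * real (dfact (k - 1))))) = 0"

definition ps :: "(nat \<Rightarrow> real) \<Rightarrow> real \<Rightarrow> real" where
  "ps p x = (\<Sum>k. p k * x ^ k)"

definition conv :: "(nat \<Rightarrow> 'b::comm_semiring_1) \<Rightarrow> (nat \<Rightarrow> 'b) \<Rightarrow> nat \<Rightarrow> 'b" where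
  "conv \<alpha> \<beta> k = (\<Sum>l\<le>k. \<alpha> l * \<beta> (k - l))"

definition xderiv :: "nat \<Rightarrow> (real \<Rightarrow> complex) \<Rightarrow> real \<Rightarrow> complex" where
  "xderiv k g = ((\<lambda>h y. vector_derivative h (at y)) ^^ k) g"

end

theory Submission
  imports Defs "HOL-Complex_Analysis.Complex_Analysis"
begin

text \<open>
  Between two neighbouring atoms of \<open>\<mu>\<^sub>n\<close> the Markov property expresses \<open>f\<^sub>n(t, \<cdot>)\<close> as the
  Ornstein--Uhlenbeck transition semigroup applied to the bounded function \<open>f\<^sub>n\<close> at the right
  endpoint. The Gaussian kernel makes this entire in the space variable and smooth in time up to (and
  beyond) the left endpoint, and it solves the Kolmogorov backward equation; by Cauchy's formula the
  Taylor coefficients at \<open>0\<close> inherit the corresponding linear system. Near \<open>x = 0\<close> the function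
  \<open>log f\<^sub>n\<close> is a constant plus the principal logarithm of a quotient of values of the semigroup, so
  formal power series calculus turns the linear system into the Riccati system. The jumps come from
  continuity of the semigroup at the left endpoint together with the jump condition on \<open>log f\<^sub>n\<close>;
  the behaviour at the right endpoint, where no smoothing is available, is never needed.

  No stochastic integral is used: along every path the Riemann sums of \<open>\<integral> exp (b (s - r)) dW\<^sub>r\<close>
  converge, they are exactly Gaussian and independent over disjoint time intervals, and dominated
  convergence passes this to the limit.
\<close>

section \<open>Differentiation of Gaussian integrals\<close>

text \<open>The logarithm is only assumed continuous, so \<open>L\<close> cannot be differentiated
  before it is identified with a constant plus \<open>Ln\<close> of the semigroup. Two obstacles
  shape this: joint continuity in (t, x) is available only off the left endpoint, where just a limit
  for each fixed x is known; and continuity fixes a logarithm only up to multiples of 2 pi i. A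
  connected rectangle inside the open strip and the discreteness of the fibres of \<open>exp\<close>
  settle both. Completing the square leaves a Gaussian integral with two parameters, a precision and
  a linear coefficient. One joint derivative in this pair yields holomorphy in z, differentiability
  in time and the backward equation. The nonlinear step is done coefficient by coefficient, so that
  no radius of convergence uniform in time enters. Measurability of the solutions comes from their
  pathwise limit formula, and boundedness of f_n from the signs of the real parts.\<close>

lemma has_derivative_lebesgue_integral:
  fixes f :: "'a::real_normed_vector \<Rightarrow> 'm \<Rightarrow> 'b::{banach,second_countable_topology}"
  assumes int: "\<And>x. integrable N (f x)"
    and f': "\<And>h. (\<lambda>y. f' y h) \<in> borel_measurable N"
    and der: "\<And>y. y \<in> space N \<Longrightarrow> ((\<lambda>x. f x y) has_derivative f' y) (at x0)"
    and w: "integrable N w"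
    and f'_le: "\<And>y h. y \<in> space N \<Longrightarrow> norm (f' y h) \<le> w y * norm h"
    and d: "d > 0"
    and lip: "\<And>x y. norm (x - x0) < d \<Longrightarrow> y \<in> space N \<Longrightarrow> norm (f x y - f x0 y) \<le> w y * norm (x - x0)"
  shows "((\<lambda>x. \<integral>y. f x y \<partial>N) has_derivative (\<lambda>h. \<integral>y. f' y h \<partial>N)) (at x0)"
proof -
  have bl: "bounded_linear (f' y)" if "y \<in> space N" for y
    using der[OF that] has_derivative_bounded_linear by blast
  have int': "integrable N (\<lambda>y. f' y h)" for h
  proof (rule Bochner_Integration.integrable_bound[of _ "\<lambda>y. w y * norm h"])
    show "AE x in N. norm (f' x h) \<le> norm (w x * norm h)"
      using f'_le[of _ h] by (intro AE_I2) force
  qed (use w f' in auto)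
  have lin: "bounded_linear (\<lambda>h. \<integral>y. f' y h \<partial>N)"
  proof (rule bounded_linear_intro[where K = "\<integral>y. w y \<partial>N"])
    show "(\<integral>y. f' y (x + z) \<partial>N) = (\<integral>y. f' y x \<partial>N) + (\<integral>y. f' y z \<partial>N)" for x z
      by (subst Bochner_Integration.integral_add[OF int' int', symmetric],
          intro Bochner_Integration.integral_cong) (auto simp: linear_simps[OF bl])
    show "(\<integral>y. f' y (r *\<^sub>R x) \<partial>N) = r *\<^sub>R (\<integral>y. f' y x \<partial>N)" for r x
      by (subst integral_scaleR_right[symmetric],
          intro Bochner_Integration.integral_cong) (auto simp: linear_simps[OF bl])
    show "norm (\<integral>y. f' y x \<partial>N) \<le> norm x * (\<integral>y. w y \<partial>N)" for x
    proof -
      have "norm (\<integral>y. f' y x \<partial>N) \<le> (\<integral>y. w y * norm x \<partial>N)"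
        by (rule order_trans[OF integral_norm_bound integral_mono])
           (use int' w f'_le in \<open>auto intro!: integrable_norm\<close>)
      then show ?thesis by (simp add: mult.commute)
    qed
  qed
  \<comment> \<open>\<open>?q\<close> is the normalised first-order remainder. It tends to 0 for
    each y by \<open>der\<close> and is bounded by \<open>2 * w\<close>, one share from
    \<open>lip\<close> and one from \<open>f'_le\<close>; dominated convergence is applied along an
    arbitrary sequence, whose first \<open>i0\<close> terms may leave the ball of \<open>lip\<close>
    and are dropped.\<close>
  let ?q = "\<lambda>x y. (1 / norm (x - x0)) *\<^sub>R (f x y - f x0 y - f' y (x - x0))"
  have lim: "((\<lambda>x. \<integral>y. ?q x y \<partial>N) \<longlongrightarrow> (\<integral>y. 0 \<partial>N)) (at x0)"
    unfolding tendsto_at_iff_sequentially comp_def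
  proof (intro allI impI)
    fix X :: "nat \<Rightarrow> 'a" assume X: "\<forall>i. X i \<in> UNIV - {x0}" "X \<longlonglongrightarrow> x0"
    obtain i0 where i0: "\<And>i. i \<ge> i0 \<Longrightarrow> norm (X i - x0) < d"
      using X(2) d unfolding LIMSEQ_def dist_norm by blast
    have "(\<lambda>i. \<integral>y. ?q (X (i + i0)) y \<partial>N) \<longlonglongrightarrow> (\<integral>y. 0 \<partial>N)"
    proof (rule integral_dominated_convergence[where w = "\<lambda>y. 2 * w y"])
      show "(\<lambda>y. ?q (X (i + i0)) y) \<in> borel_measurable N" for i
        using borel_measurable_integrable[OF int] f' by measurable
      show "AE y in N. (\<lambda>i. ?q (X (i + i0)) y) \<longlonglongrightarrow> 0"
      proof (intro AE_I2)
        fix y assume y: "y \<in> space N"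
        have "((\<lambda>x. ?q x y) \<longlongrightarrow> 0) (at x0)"
          using der[OF y] unfolding has_derivative_at_within by (simp add: divide_inverse_commute)
        then have "(\<lambda>i. ?q (X i) y) \<longlonglongrightarrow> 0"
          using X unfolding tendsto_at_iff_sequentially comp_def by auto
        then show "(\<lambda>i. ?q (X (i + i0)) y) \<longlonglongrightarrow> 0" by (rule LIMSEQ_ignore_initial_segment)
      qed
      show "AE y in N. norm (?q (X (i + i0)) y) \<le> 2 * w y" for i
      proof (intro AE_I2)
        fix y assume y: "y \<in> space N"
        have nz: "norm (X (i + i0) - x0) > 0" using X(1) by auto
        have "norm (f (X (i + i0)) y - f x0 y - f' y (X (i + i0) - x0)) \<le> 2 * w y * norm (X (i + i0) - x0)"
          using norm_triangle_ineq4[of "f (X (i + i0)) y - f x0 y" "f' y (X (i + i0) - x0)"]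
            lip[OF i0 y, of "i + i0"] f'_le[OF y, of "X (i + i0) - x0"] by simp
        then show "norm (?q (X (i + i0)) y) \<le> 2 * w y" using nz by (simp add: divide_le_eq)
      qed
    qed (use w in auto)
    then show "(\<lambda>i. \<integral>y. ?q (X i) y \<partial>N) \<longlonglongrightarrow> (\<integral>y. 0 \<partial>N)" by (rule LIMSEQ_offset)
  qed
  have "(\<integral>y. ?q x y \<partial>N) = ((\<integral>y. f x y \<partial>N) - (\<integral>y. f x0 y \<partial>N) - (\<integral>y. f' y (x - x0) \<partial>N)) /\<^sub>R norm (x - x0)" for x
    using int int' by (simp add: divide_inverse_commute)
  with lim lin show ?thesis
    unfolding has_derivative_at_within by simp
qed

text \<open>By completing the square, B|y| is at most B^2/(2 eta) plus half of eta y^2, so a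
  constant multiple of the normal density of variance 1/eta dominates.\<close>

lemma integrable_gaussian_dominator:
  fixes \<eta> B :: real
  assumes "\<eta> > 0"
  shows "integrable lborel (\<lambda>y::real. exp (- \<eta> * y\<^sup>2 + B * \<bar>y\<bar>))"
proof -
  define \<sigma> where "\<sigma> = 1 / sqrt \<eta>"
  have \<sigma>: "\<sigma> > 0" "\<sigma>\<^sup>2 = 1 / \<eta>" using assms by (auto simp: \<sigma>_def power_divide)
  have le: "- \<eta> * y\<^sup>2 + B * \<bar>y\<bar> \<le> B\<^sup>2 / (2 * \<eta>) + (- \<eta> * y\<^sup>2 / 2)" for y
  proof -
    have "0 \<le> (\<eta> * \<bar>y\<bar> - B)\<^sup>2 / (2 * \<eta>)" using assms by simp
    also have "\<dots> = \<eta> * y\<^sup>2 / 2 - B * \<bar>y\<bar> + B\<^sup>2 / (2 * \<eta>)"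
      using assms by (simp add: power2_eq_square field_simps)
    finally show ?thesis by simp
  qed
  have "integrable lborel (\<lambda>y. (exp (B\<^sup>2 / (2 * \<eta>)) * sqrt (2 * pi * \<sigma>\<^sup>2)) * normal_density 0 \<sigma> y)"
    using \<sigma> by (intro integrable_mult_right integrable_normal_density) auto
  then show ?thesis
  proof (rule Bochner_Integration.integrable_bound)
    have "exp (- \<eta> * y\<^sup>2 + B * \<bar>y\<bar>) \<le> (exp (B\<^sup>2 / (2 * \<eta>)) * sqrt (2 * pi * \<sigma>\<^sup>2)) * normal_density 0 \<sigma> y" for y
    proof -
      have "exp (- \<eta> * y\<^sup>2 + B * \<bar>y\<bar>) \<le> exp (B\<^sup>2 / (2 * \<eta>)) * exp (- \<eta> * y\<^sup>2 / 2)"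
        using le[of y] unfolding exp_add[symmetric] by (simp only: exp_le_cancel_iff)
      also have "\<dots> = (exp (B\<^sup>2 / (2 * \<eta>)) * sqrt (2 * pi * \<sigma>\<^sup>2)) * normal_density 0 \<sigma> y"
        using \<sigma> assms by (simp add: normal_density_def)
      finally show ?thesis .
    qed
    then show "AE y in lborel. norm (exp (- \<eta> * y\<^sup>2 + B * \<bar>y\<bar>)) \<le>
       norm ((exp (B\<^sup>2 / (2 * \<eta>)) * sqrt (2 * pi * \<sigma>\<^sup>2)) * normal_density 0 \<sigma> y)"
      by (intro AE_I2) (use abs_ge_self order_trans in fastforce)
  qed auto
qed

text \<open>Mean value inequality on the half-plane Re z <= R: it is convex, and there the
  derivative of \<open>exp\<close> has norm at most exp R.\<close>

lemma norm_exp_diff_le: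
  fixes w z :: complex
  assumes "Re w \<le> R" "Re z \<le> R"
  shows "norm (exp w - exp z) \<le> exp R * norm (w - z)"
proof (rule field_differentiable_bound[of "{z. Re z \<le> R}" exp exp])
  show "convex {z. Re z \<le> R}" by (rule convex_halfspace_Re_le)
qed (use assms in \<open>auto intro!: derivative_eq_intros\<close>)

text \<open>The normal density without its normalisation and without the constant term of the
  square: S is half the inverse variance, and beta is 2 S times the mean. In this form beta may be
  complex, a beta-derivative raises m by 1, and an S-derivative raises m by 2 and changes the
  sign.\<close>

definition gauss_moment :: "(real \<Rightarrow> complex) \<Rightarrow> nat \<Rightarrow> real \<Rightarrow> complex \<Rightarrow> complex" where
  "gauss_moment g m S \<beta> =
     (\<integral>y. g y * of_real y ^ m * exp (of_real y * \<beta> - of_real (y\<^sup>2 * S)) \<partial>lborel)"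

text \<open>Compare with one term of the exponential series. Powers of y are thereby absorbed into
  \<open>exp \<bar>y\<bar>\<close>, which is where \<open>B + 1\<close> comes from in the bounds
  below.\<close>

lemma abs_power_le_exp: "\<bar>y::real\<bar> ^ m \<le> fact m * exp \<bar>y\<bar>"
proof -
  have "\<bar>y\<bar> ^ m /\<^sub>R fact m \<le> (\<Sum>k. \<bar>y\<bar> ^ k /\<^sub>R fact k)"
    using sum_le_suminf[OF summable_exp_generic[of "\<bar>y\<bar>"], of "{m}"] by simp
  then show ?thesis by (simp add: exp_def field_simps)
qed

lemma norm_fst_snd_le: "norm (fst p) \<le> norm p" "norm (snd p) \<le> norm p"
  using norm_fst_le[of "fst p" "snd p"] norm_snd_le[of "snd p" "fst p"] by simp_all

text \<open>The bound depends on S and beta only through eta and B; a single integrable function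
  thus serves a whole neighbourhood of parameters.\<close>

lemma gauss_moment_integrand_le:
  fixes g :: "real \<Rightarrow> complex"
  assumes g1: "\<And>y. norm (g y) \<le> (1::real)"
    and "S \<ge> \<eta>" "norm \<beta> \<le> B"
  shows "norm (g y * of_real y ^ m * exp (of_real y * \<beta> - of_real (y\<^sup>2 * S)))
     \<le> fact m * exp (- \<eta> * y\<^sup>2 + (B + 1) * \<bar>y\<bar>)"
proof -
  have "norm (exp (of_real y * \<beta> - of_real (y\<^sup>2 * S))) = exp (y * Re \<beta> - y\<^sup>2 * S)" by simp
  also have "\<dots> \<le> exp (- \<eta> * y\<^sup>2 + B * \<bar>y\<bar>)"
  proof -
    have "y * Re \<beta> \<le> \<bar>y\<bar> * \<bar>Re \<beta>\<bar>" by (metis abs_ge_self abs_mult)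
    also have "\<dots> \<le> \<bar>y\<bar> * B" using abs_Re_le_cmod[of \<beta>] assms(3) by (intro mult_left_mono) auto
    finally have "y * Re \<beta> \<le> B * \<bar>y\<bar>" by (simp add: mult.commute)
    moreover have "y\<^sup>2 * \<eta> \<le> y\<^sup>2 * S" using assms(2) by (intro mult_left_mono) auto
    ultimately show ?thesis by (simp add: mult.commute)
  qed
  finally have e: "norm (exp (of_real y * \<beta> - of_real (y\<^sup>2 * S))) \<le> exp (- \<eta> * y\<^sup>2 + B * \<bar>y\<bar>)" .
  have "norm (g y * of_real y ^ m * exp (of_real y * \<beta> - of_real (y\<^sup>2 * S)))
    \<le> 1 * (fact m * exp \<bar>y\<bar>) * exp (- \<eta> * y\<^sup>2 + B * \<bar>y\<bar>)"
    unfolding norm_mult norm_power norm_of_real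
    using g1[of y] abs_power_le_exp[of y m] e by (intro mult_mono) auto
  also have "\<dots> = fact m * exp (- \<eta> * y\<^sup>2 + (B + 1) * \<bar>y\<bar>)"
    by (simp add: exp_add[symmetric] algebra_simps)
  finally show ?thesis .
qed

lemma integrable_gauss_moment:
  fixes g :: "real \<Rightarrow> complex"
  assumes g: "g \<in> borel_measurable borel" "\<And>y. norm (g y) \<le> (1::real)" and "S > 0"
  shows "integrable lborel (\<lambda>y. g y * of_real y ^ m * exp (of_real y * \<beta> - of_real (y\<^sup>2 * S)))"
proof (rule Bochner_Integration.integrable_bound)
  show "integrable lborel (\<lambda>y. fact m * exp (- S * y\<^sup>2 + (norm \<beta> + 1) * \<bar>y\<bar>))"
    by (intro integrable_mult_right integrable_gaussian_dominator assms)
  show "AE y in lborel. norm (g y * of_real y ^ m * exp (of_real y * \<beta> - of_real (y\<^sup>2 * S)))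
      \<le> norm (fact m * exp (- S * y\<^sup>2 + (norm \<beta> + 1) * \<bar>y\<bar>))"
    using gauss_moment_integrand_le[OF g(2), of S S \<beta> "norm \<beta>"]
    by (intro AE_I2) (use abs_ge_self order_trans in fastforce)
qed (use g in measurable)

text \<open>The parameter space is real times complex, so the derivative is real-linear in the pair;
  holomorphy in beta and the chain rule along a curve in time are both read off from it.\<close>

lemma has_derivative_gauss_moment:
  fixes g :: "real \<Rightarrow> complex"
  assumes g: "g \<in> borel_measurable borel" "\<And>y. norm (g y) \<le> (1::real)" and S0: "S0 > 0"
  shows "((\<lambda>p. gauss_moment g m (fst p) (snd p)) has_derivative
     (\<lambda>h. snd h * gauss_moment g (Suc m) S0 \<beta>0 - of_real (fst h) * gauss_moment g (m + 2) S0 \<beta>0))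
     (at (S0, \<beta>0))"
proof -
  define I where "I = (\<lambda>m p y. g y * of_real y ^ m * exp (of_real y * snd p - of_real (y\<^sup>2 * fst p)))"
  \<comment> \<open>In the ball of radius S0/2 the precision stays above S0/2 and the norm of beta
    below \<open>B\<close>, so the exponential bounds are uniform there.\<close>
  define \<eta> where "\<eta> = S0 / 2"
  define B where "B = norm \<beta>0 + S0"
  have [simp]: "\<eta> > 0" using S0 by (simp add: \<eta>_def)
  text \<open>The integrand is cut off outside a small ball, because
    \<open>has_derivative_lebesgue_integral\<close> asks for integrability at every parameter.\<close>
  define f where "f = (\<lambda>p y. if norm (p - (S0, \<beta>0)) < \<eta> then I m p y else 0)"
  define f' where "f' = (\<lambda>y (h::real \<times> complex). snd h * I (Suc m) (S0, \<beta>0) y - of_real (fst h) * I (m + 2) (S0, \<beta>0) y)"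
  define w where "w = (\<lambda>y. (fact (m + 2) + fact (Suc m)) * exp (- \<eta> * y\<^sup>2 + (B + 1) * \<bar>y\<bar>))"
  have near: "fst p \<ge> \<eta>" "norm (snd p) \<le> B" if "norm (p - (S0, \<beta>0)) < \<eta>" for p :: "real \<times> complex"
  proof -
    have "norm (fst p - S0) < \<eta>" using that norm_fst_snd_le(1)[of "p - (S0, \<beta>0)"] by simp
    then show "fst p \<ge> \<eta>" unfolding real_norm_def abs_less_iff \<eta>_def by linarith
    have "norm (snd p - \<beta>0) < \<eta>" using that norm_fst_snd_le(2)[of "p - (S0, \<beta>0)"] by simp
    then show "norm (snd p) \<le> B" using S0 norm_triangle_ineq2[of "snd p" \<beta>0] unfolding B_def \<eta>_def by linarith
  qed
  have Ile: "norm (I k (S0, \<beta>0) y) \<le> fact k * exp (- \<eta> * y\<^sup>2 + (B + 1) * \<bar>y\<bar>)" for k y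
    unfolding I_def using S0 by (intro gauss_moment_integrand_le g) (auto simp: \<eta>_def B_def)
  have Im: "I k p \<in> borel_measurable borel" for k p
    unfolding I_def using g by measurable
  have "((\<lambda>p. \<integral>y. f p y \<partial>lborel) has_derivative (\<lambda>h. \<integral>y. f' y h \<partial>lborel)) (at (S0, \<beta>0))"
  proof (rule has_derivative_lebesgue_integral[where w = w and d = \<eta>])
    show "integrable lborel (f p)" for p
    proof (cases "norm (p - (S0, \<beta>0)) < \<eta>")
      case True
      then have "fst p > 0" using near(1)[of p] \<open>\<eta> > 0\<close> by linarith
      then show ?thesis using True integrable_gauss_moment[OF g, of "fst p" m "snd p"]
        unfolding f_def I_def by simp
    qed (simp add: f_def)
    show "(\<lambda>y. f' y h) \<in> borel_measurable lborel" for h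
      unfolding f'_def using Im by measurable
    show "integrable lborel w"
      unfolding w_def by (intro integrable_mult_right integrable_gaussian_dominator) simp
    show "((\<lambda>p. f p y) has_derivative f' y) (at (S0, \<beta>0))" for y
    proof (rule has_derivative_transform_within_open[of "\<lambda>p. I m p y" _ _ _ "ball (S0, \<beta>0) \<eta>"])
      show "((\<lambda>p. I m p y) has_derivative f' y) (at (S0, \<beta>0))"
      proof -
        have q: "((\<lambda>p. of_real y * snd p - of_real (y\<^sup>2 * fst p)) has_derivative
            (\<lambda>h. of_real y * snd h - of_real (y\<^sup>2 * fst h) :: complex)) (at (S0, \<beta>0))"
          by (auto intro!: derivative_eq_intros)
        have "((\<lambda>p. exp (of_real y * snd p - of_real (y\<^sup>2 * fst p))) has_derivative
            (\<lambda>h. exp (of_real y * \<beta>0 - of_real (y\<^sup>2 * S0)) * (of_real y * snd h - of_real (y\<^sup>2 * fst h)))) (at (S0, \<beta>0))"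
          using has_derivative_compose[OF q DERIV_exp[unfolded has_field_derivative_def]] by simp
        then show ?thesis
          unfolding I_def f'_def
          by (auto intro!: derivative_eq_intros simp: fun_eq_iff algebra_simps power2_eq_square)
      qed
    qed (auto simp: f_def dist_norm norm_minus_commute)
    show "norm (f' y h) \<le> w y * norm h" for y h
    proof -
      have "norm (f' y h) \<le> norm (snd h) * norm (I (Suc m) (S0, \<beta>0) y) + norm (fst h) * norm (I (m + 2) (S0, \<beta>0) y)"
        unfolding f'_def by (rule order_trans[OF norm_triangle_ineq4]) (simp add: norm_mult)
      also have "\<dots> \<le> norm h * (fact (Suc m) * exp (- \<eta> * y\<^sup>2 + (B + 1) * \<bar>y\<bar>)) +
            norm h * (fact (m + 2) * exp (- \<eta> * y\<^sup>2 + (B + 1) * \<bar>y\<bar>))"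
        using norm_fst_snd_le(2)[of h] norm_fst_snd_le(1)[of h]
        by (intro add_mono mult_mono Ile) (auto simp: norm_mult)
      finally show ?thesis unfolding w_def by (simp add: algebra_simps)
    qed
    show "norm (f p y - f (S0, \<beta>0) y) \<le> w y * norm (p - (S0, \<beta>0))"
      if "norm (p - (S0, \<beta>0)) < \<eta>" for p y
    proof -
      have R: "Re (of_real y * snd q - of_real (y\<^sup>2 * fst q)) \<le> - \<eta> * y\<^sup>2 + B * \<bar>y\<bar>"
        if q: "norm (q - (S0, \<beta>0)) < \<eta>" for q
      proof -
        have "y * Re (snd q) \<le> \<bar>y\<bar> * \<bar>Re (snd q)\<bar>" by (metis abs_ge_self abs_mult)
        also have "\<dots> \<le> \<bar>y\<bar> * B"
          using abs_Re_le_cmod[of "snd q"] near(2)[OF q] by (intro mult_left_mono) auto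
        finally have "y * Re (snd q) \<le> B * \<bar>y\<bar>" by (simp add: mult.commute)
        moreover have "y\<^sup>2 * \<eta> \<le> y\<^sup>2 * fst q" using near(1)[OF q] by (intro mult_left_mono) auto
        ultimately show ?thesis by (simp add: mult.commute)
      qed
      let ?E = "exp (- \<eta> * y\<^sup>2 + B * \<bar>y\<bar>)"
      have "norm (exp (of_real y * snd p - of_real (y\<^sup>2 * fst p)) - exp (of_real y * \<beta>0 - of_real (y\<^sup>2 * S0)))
        \<le> ?E * norm ((of_real y * snd p - of_real (y\<^sup>2 * fst p)) - (of_real y * \<beta>0 - of_real (y\<^sup>2 * S0)))"
        using R[OF that] R[of "(S0, \<beta>0)"] by (intro norm_exp_diff_le) auto
      also have "norm ((of_real y * snd p - of_real (y\<^sup>2 * fst p)) - (of_real y * \<beta>0 - of_real (y\<^sup>2 * S0)))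
         = norm (of_real y * (snd p - \<beta>0) - of_real (y\<^sup>2) * of_real (fst p - S0))"
        by (simp add: algebra_simps)
      also have "\<dots> \<le> \<bar>y\<bar> * norm (snd p - \<beta>0) + y\<^sup>2 * norm (fst p - S0)"
        by (rule order_trans[OF norm_triangle_ineq4]) (simp add: norm_mult norm_power flip: of_real_diff)
      also have "\<dots> \<le> \<bar>y\<bar> * norm (p - (S0, \<beta>0)) + y\<^sup>2 * norm (p - (S0, \<beta>0))"
        using norm_fst_snd_le(2)[of "p - (S0, \<beta>0)"] norm_fst_snd_le(1)[of "p - (S0, \<beta>0)"]
        by (intro add_mono mult_left_mono) auto
      finally have *: "norm (exp (of_real y * snd p - of_real (y\<^sup>2 * fst p)) - exp (of_real y * \<beta>0 - of_real (y\<^sup>2 * S0)))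
        \<le> ?E * (\<bar>y\<bar> * norm (p - (S0, \<beta>0)) + y\<^sup>2 * norm (p - (S0, \<beta>0)))"
        by (simp add: mult_left_mono)
      have "f p y - f (S0, \<beta>0) y = g y * of_real y ^ m *
         (exp (of_real y * snd p - of_real (y\<^sup>2 * fst p)) - exp (of_real y * \<beta>0 - of_real (y\<^sup>2 * S0)))"
        using that unfolding f_def I_def by (simp add: algebra_simps)
      also have "norm \<dots> \<le> 1 * \<bar>y\<bar> ^ m * (?E * (\<bar>y\<bar> * norm (p - (S0, \<beta>0)) + y\<^sup>2 * norm (p - (S0, \<beta>0))))"
        unfolding norm_mult norm_power norm_of_real using * g(2)[of y] by (intro mult_mono) auto
      also have "\<dots> = (\<bar>y\<bar> ^ Suc m + \<bar>y\<bar> ^ (m + 2)) * ?E * norm (p - (S0, \<beta>0))"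
        by (simp add: algebra_simps power_add power2_eq_square abs_mult[symmetric])
      also have "\<dots> \<le> (fact (Suc m) * exp \<bar>y\<bar> + fact (m + 2) * exp \<bar>y\<bar>) * ?E * norm (p - (S0, \<beta>0))"
        by (intro mult_right_mono add_mono abs_power_le_exp) auto
      also have "\<dots> = (fact (m + 2) + fact (Suc m)) * (exp \<bar>y\<bar> * ?E) * norm (p - (S0, \<beta>0))"
        by (simp only: distrib_right mult.assoc add.commute)
      also have "exp \<bar>y\<bar> * ?E = exp (- \<eta> * y\<^sup>2 + (B + 1) * \<bar>y\<bar>)"
        by (simp add: exp_add[symmetric] algebra_simps)
      finally show ?thesis unfolding w_def .
    qed
  qed auto
  moreover have "(\<integral>y. f' y h \<partial>lborel) =
      snd h * gauss_moment g (Suc m) S0 \<beta>0 - of_real (fst h) * gauss_moment g (m + 2) S0 \<beta>0" for h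
  proof -
    have "integrable lborel (I k (S0, \<beta>0))" for k
      unfolding I_def using integrable_gauss_moment[OF g S0] by (simp only: fst_conv snd_conv)
    then have "(\<integral>y. f' y h \<partial>lborel) = snd h * (\<integral>y. I (Suc m) (S0, \<beta>0) y \<partial>lborel)
        - of_real (fst h) * (\<integral>y. I (m + 2) (S0, \<beta>0) y \<partial>lborel)"
      unfolding f'_def by simp
    then show ?thesis unfolding I_def gauss_moment_def fst_conv snd_conv .
  qed
  ultimately have "((\<lambda>p. \<integral>y. f p y \<partial>lborel) has_derivative
     (\<lambda>h. snd h * gauss_moment g (Suc m) S0 \<beta>0 - of_real (fst h) * gauss_moment g (m + 2) S0 \<beta>0))
     (at (S0, \<beta>0))" by simp
  then show ?thesis
    by (rule has_derivative_transform_within_open[of _ _ _ _ "ball (S0, \<beta>0) \<eta>"])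
       (auto simp: f_def I_def gauss_moment_def dist_norm norm_minus_commute)
qed

section \<open>The Ornstein--Uhlenbeck semigroup\<close>

text \<open>The integral of exp (b r) over r from 0 to s. It occurs with b in the mean of the
  process and with 2 b in its variance.\<close>

definition expint :: "real \<Rightarrow> real \<Rightarrow> real" where
  "expint b s = (if b = 0 then s else (exp (b * s) - 1) / b)"

lemma expint_0 [simp]: "expint b 0 = 0"
  by (simp add: expint_def)

lemma DERIV_expint: "(expint b has_real_derivative exp (b * s)) (at s within A)"
proof (cases "b = 0")
  case True
  then show ?thesis unfolding expint_def by simp
next
  case False
  have "((\<lambda>s. (exp (b * s) - 1) / b) has_real_derivative exp (b * s)) (at s within A)"
    using False by (auto intro!: derivative_eq_intros)
  then show ?thesis using False unfolding expint_def by simp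
qed

lemma continuous_on_expint: "continuous_on A (expint b)"
  by (rule DERIV_continuous_on[OF DERIV_expint])

lemma expint_pos: "s > 0 \<Longrightarrow> expint b s > 0"
  by (cases "b > 0") (auto simp: expint_def zero_less_divide_iff mult_less_0_iff)

text \<open>Cauchy's formula on the unit circle turns the k-th derivative at 0 into an integral of
  \<open>U s\<close> itself, so the Leibniz rule needs only joint continuity of the time derivative
  and no statement on mixed derivatives.\<close>

lemma has_vector_derivative_deriv_pow_at_0:
  fixes U Us :: "real \<Rightarrow> complex \<Rightarrow> complex"
  assumes I: "open I" "convex I" "s0 \<in> I"
    and hol: "\<And>s. s \<in> I \<Longrightarrow> U s holomorphic_on UNIV" "\<And>s. s \<in> I \<Longrightarrow> Us s holomorphic_on UNIV"
    and der: "\<And>s z. s \<in> I \<Longrightarrow> ((\<lambda>s. U s z) has_vector_derivative Us s z) (at s)"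
    and cont: "continuous_on (I \<times> UNIV) (\<lambda>p. Us (fst p) (snd p))"
  shows "((\<lambda>s. (deriv ^^ k) (U s) 0) has_vector_derivative (deriv ^^ k) (Us s0) 0) (at s0)"
proof -
  define w where "w = circlepath 0 1"
  \<comment> \<open>\<open>d\<close> is w' / w^(k+1), the Cauchy kernel pulled back to [0,1], and
    \<open>C\<close> is the inverse of the constant in Cauchy's formula.\<close>
  define d where "d = (\<lambda>\<theta>::real. 2 * pi * \<i> * exp (2 * of_real pi * \<i> * of_real \<theta>) / w \<theta> ^ Suc k)"
  define C where "C = (fact k / (2 * pi * \<i>) :: complex)"
  have wn: "w \<theta> \<noteq> 0" for \<theta> by (simp add: w_def circlepath)
  have contw: "continuous_on A w" for A
    unfolding w_def circlepath by (intro continuous_intros)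
  have contd: "continuous_on A d" for A
    unfolding d_def by (intro continuous_intros contw) (use wn in auto)
  have cauchy: "((\<lambda>\<theta>. h (w \<theta>) * d \<theta>) has_integral ((2 * pi * \<i>) / fact k * (deriv ^^ k) h 0)) {0..1}"
    if "h holomorphic_on UNIV" for h
  proof -
    have hc: "continuous_on (cball 0 1) h" "h holomorphic_on ball 0 1"
      using that holomorphic_on_imp_continuous_on holomorphic_on_subset continuous_on_subset by blast+
    have "((\<lambda>u. h u / (u - 0) ^ Suc k) has_contour_integral
        ((2 * pi * \<i>) / fact k * (deriv ^^ k) h 0)) (circlepath 0 1)"
      by (rule Cauchy_has_contour_integral_higher_derivative_circlepath) (use hc in auto)
    then have "((\<lambda>x. h (w x) / (w x) ^ Suc k * vector_derivative w (at x within {0..1})) has_integral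
        ((2 * pi * \<i>) / fact k * (deriv ^^ k) h 0)) {0..1}"
      unfolding has_contour_integral_def w_def by simp
    moreover have "h (w x) / (w x) ^ Suc k * vector_derivative w (at x within {0..1}) = h (w x) * d x"
      if "x \<in> {0..1}" for x
      using that unfolding w_def d_def by (simp add: vector_derivative_circlepath01)
    ultimately show ?thesis using has_integral_eq by (metis (no_types, lifting))
  qed
  have eq: "(deriv ^^ k) h 0 = C * integral (cbox 0 1) (\<lambda>\<theta>. h (w \<theta>) * d \<theta>)"
    if "h holomorphic_on UNIV" for h
    using integral_unique[OF cauchy[OF that]] by (simp add: C_def)
  have "((\<lambda>s. integral (cbox 0 1) (\<lambda>\<theta>. U s (w \<theta>) * d \<theta>)) has_vector_derivative
      integral (cbox 0 1) (\<lambda>\<theta>. Us s0 (w \<theta>) * d \<theta>)) (at s0 within I)"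
  proof (rule leibniz_rule_vector_derivative)
    show "((\<lambda>s. U s (w \<theta>) * d \<theta>) has_vector_derivative Us s (w \<theta>) * d \<theta>) (at s within I)"
      if "s \<in> I" for s \<theta>
      using has_vector_derivative_at_within[OF der[OF that]] by (auto intro!: derivative_eq_intros)
    show "(\<lambda>\<theta>. U s (w \<theta>) * d \<theta>) integrable_on cbox 0 1" if "s \<in> I" for s
      using has_integral_integrable[OF cauchy[OF hol(1)[OF that]]] by simp
    have "continuous_on (I \<times> cbox 0 1) (\<lambda>x. (\<lambda>p. Us (fst p) (snd p)) (fst x, w (snd x)))"
      by (rule continuous_on_compose2[OF cont])
         (auto intro!: continuous_intros continuous_on_compose2[OF contw])
    moreover have "continuous_on (I \<times> cbox 0 1) (\<lambda>x. d (snd x))"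
      by (auto intro!: continuous_intros continuous_on_compose2[OF contd])
    ultimately show "continuous_on (I \<times> cbox 0 1) (\<lambda>(s, \<theta>). Us s (w \<theta>) * d \<theta>)"
      unfolding case_prod_beta by (auto intro!: continuous_intros)
  qed (use I in auto)
  then have "((\<lambda>s. C * integral (cbox 0 1) (\<lambda>\<theta>. U s (w \<theta>) * d \<theta>)) has_vector_derivative
      C * integral (cbox 0 1) (\<lambda>\<theta>. Us s0 (w \<theta>) * d \<theta>)) (at s0)"
    using I by (subst (asm) at_within_open) (auto intro!: derivative_eq_intros)
  then have "((\<lambda>s. (deriv ^^ k) (U s) 0) has_vector_derivative
      C * integral (cbox 0 1) (\<lambda>\<theta>. Us s0 (w \<theta>) * d \<theta>)) (at s0)"
    by (rule has_vector_derivative_transform_within_open[OF _ I(1,3)]) (simp add: eq hol)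
  then show ?thesis by (simp add: eq hol I)
qed

section \<open>The transition kernel with a complex starting point\<close>

locale ou_semigroup =
  fixes a b c :: real and g :: "real \<Rightarrow> complex"
  assumes c_ne: "c \<noteq> 0"
    and g_meas: "g \<in> borel_measurable borel"
    and g_le: "\<And>y. norm (g y) \<le> 1"
begin

text \<open>Started from a real z, the equation dX = (a + b X) dt + c dW has at time s a normal law
  with this variance and with mean \<open>mean s z\<close>. \<open>prec\<close> is half the inverse
  variance, the coefficient of y^2 in the exponent; \<open>mean\<close> is continued to complex
  z.\<close>

definition var :: "real \<Rightarrow> real" where "var s = c\<^sup>2 * expint (2 * b) s"
definition prec :: "real \<Rightarrow> real" where "prec s = 1 / (2 * var s)"
definition mean :: "real \<Rightarrow> complex \<Rightarrow> complex" where
  "mean s z = of_real (exp (b * s)) * z + of_real (a * expint b s)"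

text \<open>Completing the square in the Gaussian transition density gives the value of the
  semigroup as \<^term>\<open>U 0\<close>; the higher \<^term>\<open>U m\<close> appear as its derivatives.\<close>
definition U :: "nat \<Rightarrow> real \<Rightarrow> complex \<Rightarrow> complex" where
  "U m s z = of_real (sqrt (prec s / pi)) * exp (- of_real (prec s) * (mean s z)\<^sup>2) *
     gauss_moment g m (prec s) (2 * of_real (prec s) * mean s z)"

lemma var_pos: "s > 0 \<Longrightarrow> var s > 0"
  using c_ne by (simp add: var_def expint_pos)

lemma prec_pos: "s > 0 \<Longrightarrow> prec s > 0"
  using var_pos by (simp add: prec_def)

text \<open>Chain rule with var' = c^2 exp (2 b s), rewritten in terms of \<open>prec\<close>, so
  that the backward equation reduces to a polynomial identity in \<open>prec\<close>,
  \<open>exp (b * s)\<close> and \<open>mean\<close>.\<close>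

definition prec' :: "real \<Rightarrow> real" where "prec' s = - 2 * c\<^sup>2 * exp (2 * b * s) * (prec s)\<^sup>2"

lemma DERIV_prec:
  assumes "s > 0"
  shows "(prec has_real_derivative prec' s) (at s)"
proof -
  have "var s \<noteq> 0" using var_pos[OF assms] by simp
  then show ?thesis
    unfolding prec_def[abs_def] prec'_def var_def
    by (auto intro!: derivative_eq_intros DERIV_expint simp: power2_eq_square field_simps)
qed

lemma continuous_on_prec: "continuous_on {0<..} prec"
  by (rule continuous_at_imp_continuous_on) (use DERIV_prec DERIV_isCont in auto)

lemma DERIV_mean_z: "(mean s has_field_derivative of_real (exp (b * s))) (at z)"
  unfolding mean_def by (auto intro!: derivative_eq_intros)

lemma vector_derivative_mean_s:
  "((\<lambda>s. mean s z) has_vector_derivative of_real (exp (b * s)) * (of_real a + of_real b * z)) (at s)"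
proof -
  have "((\<lambda>s. exp (b * s)) has_real_derivative b * exp (b * s)) (at s)"
    by (auto intro!: derivative_eq_intros)
  moreover have "((\<lambda>s. a * expint b s) has_real_derivative a * exp (b * s)) (at s)"
    by (auto intro!: derivative_eq_intros DERIV_expint)
  ultimately have "((\<lambda>s. of_real (exp (b * s)) * z + of_real (a * expint b s)) has_vector_derivative
      (of_real (b * exp (b * s)) * z + of_real (a * exp (b * s)))) (at s)"
    by (intro derivative_intros has_vector_derivative_mult_left has_vector_derivative_of_real)
  then show ?thesis unfolding mean_def by (simp add: algebra_simps)
qed

lemma DERIV_gauss_moment:
  assumes "S > 0"
  shows "(gauss_moment g m S has_field_derivative gauss_moment g (Suc m) S \<beta>) (at \<beta>)"
proof -
  have "((\<lambda>\<beta>. (S, \<beta>)) has_derivative (\<lambda>h. (0, h))) (at \<beta>)" by (auto intro!: derivative_eq_intros)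
  from has_derivative_compose[OF this has_derivative_gauss_moment[OF g_meas g_le assms]]
  have "(gauss_moment g m S has_derivative (\<lambda>x. x * gauss_moment g (Suc m) S \<beta>)) (at \<beta>)" by simp
  then show ?thesis unfolding has_field_derivative_def by (rule has_derivative_eq_rhs) (simp add: mult.commute fun_eq_iff)
qed

lemma vector_derivative_gauss_moment:
  assumes S: "(S has_real_derivative S') (at s)" "S s > 0" and B: "(B has_vector_derivative B') (at s)"
  shows "((\<lambda>s. gauss_moment g m (S s) (B s)) has_vector_derivative
     B' * gauss_moment g (Suc m) (S s) (B s) - of_real S' * gauss_moment g (m + 2) (S s) (B s)) (at s)"
proof -
  have "((\<lambda>s. (S s, B s)) has_derivative (\<lambda>h. (S' * h, h *\<^sub>R B'))) (at s)"
    using S(1) B unfolding has_field_derivative_def has_vector_derivative_def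
    by (auto intro!: derivative_eq_intros)
  from has_derivative_compose[OF this has_derivative_gauss_moment[OF g_meas g_le S(2)]]
  show ?thesis unfolding has_vector_derivative_def
    by (simp add: scaleR_conv_of_real algebra_simps)
qed

lemma continuous_on_gauss_moment:
  "continuous_on ({0<..} \<times> UNIV) (\<lambda>p. gauss_moment g m (fst p) (snd p))"
  by (intro continuous_at_imp_continuous_on ballI)
     (use has_derivative_continuous[OF has_derivative_gauss_moment[OF g_meas g_le]] in auto)

text \<open>Up to complexification, \<open>U m s z\<close> integrates g(y) y^m against the normal
  density with mean \<open>mean s z\<close>. Differentiating that density in its mean multiplies it
  by 2 prec (y - mean), and the mean moves with z at rate exp (b s).\<close>

lemma DERIV_U_z:
  assumes "s > 0"
  shows "(U m s has_field_derivative
     2 * of_real (prec s * exp (b * s)) * (U (Suc m) s z - mean s z * U m s z)) (at z)"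
proof -
  have G: "((\<lambda>z. gauss_moment g m (prec s) (2 * of_real (prec s) * mean s z)) has_field_derivative
     gauss_moment g (Suc m) (prec s) (2 * of_real (prec s) * mean s z) *
     (2 * of_real (prec s) * of_real (exp (b * s)))) (at z)"
    by (rule DERIV_chain2[OF DERIV_gauss_moment[OF prec_pos[OF assms]]])
       (auto intro!: derivative_eq_intros DERIV_mean_z)
  show ?thesis
    unfolding U_def[abs_def]
    by (rule derivative_eq_intros G DERIV_mean_z refl)+
       (simp add: algebra_simps power2_eq_square)
qed

text \<open>The logarithm of the density is (1/2) log (prec/pi) - prec (y - mean)^2. Its time
  derivative is prec'/(2 prec) - prec' (y - mean)^2 + 2 prec (y - mean) mean'; the coefficients of
  1, y and y^2 are those of \<open>U m\<close>, \<open>U (Suc m)\<close> and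
  \<open>U (m + 2)\<close>.\<close>

lemma vector_derivative_U_s:
  assumes s: "s > 0"
  shows "((\<lambda>s. U m s z) has_vector_derivative
     (of_real (prec' s / (2 * prec s)) - of_real (prec' s) * (mean s z)\<^sup>2
        - 2 * of_real (prec s) * mean s z * (of_real (exp (b * s)) * (of_real a + of_real b * z))) * U m s z
     - of_real (prec' s) * U (m + 2) s z
     + 2 * (of_real (prec' s) * mean s z
        + of_real (prec s) * (of_real (exp (b * s)) * (of_real a + of_real b * z))) * U (Suc m) s z) (at s)"
proof -
  let ?m' = "of_real (exp (b * s)) * (of_real a + of_real b * z)"
  note P = prec_pos[OF s]
  have p: "((\<lambda>s. complex_of_real (prec s)) has_vector_derivative of_real (prec' s)) (at s)"
    by (rule has_vector_derivative_of_real[OF DERIV_prec[OF s]])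
  have "((\<lambda>s. sqrt (prec s / pi)) has_real_derivative sqrt (prec s / pi) * (prec' s / (2 * prec s))) (at s)"
    using P by (auto intro!: derivative_eq_intros DERIV_prec s simp: field_simps real_sqrt_divide)
  from has_vector_derivative_of_real[OF this]
  have q: "((\<lambda>s. complex_of_real (sqrt (prec s / pi))) has_vector_derivative
      of_real (sqrt (prec s / pi) * (prec' s / (2 * prec s)))) (at s)" .
  note m = vector_derivative_mean_s[of z s]
  have pm: "((\<lambda>s. 2 * of_real (prec s) * mean s z) has_vector_derivative
      2 * (of_real (prec' s) * mean s z + of_real (prec s) * ?m')) (at s)"
    by (rule has_vector_derivative_eq_rhs[OF has_vector_derivative_mult[OF has_vector_derivative_mult_right[OF p] m]])
       (simp add: algebra_simps)
  have pmm: "((\<lambda>s. - of_real (prec s) * (mean s z)\<^sup>2) has_vector_derivative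
      - (of_real (prec' s) * (mean s z)\<^sup>2 + 2 * of_real (prec s) * mean s z * ?m')) (at s)"
    unfolding power2_eq_square
    by (rule has_vector_derivative_eq_rhs[OF has_vector_derivative_mult[OF has_vector_derivative_minus[OF p] has_vector_derivative_mult[OF m m]]])
       (simp add: algebra_simps)
  have e: "((\<lambda>s. exp (- of_real (prec s) * (mean s z)\<^sup>2)) has_vector_derivative
      - (of_real (prec' s) * (mean s z)\<^sup>2 + 2 * of_real (prec s) * mean s z * ?m') *
      exp (- of_real (prec s) * (mean s z)\<^sup>2)) (at s)"
    using field_vector_diff_chain_at[OF pmm DERIV_exp] by (simp add: o_def)
  note G = vector_derivative_gauss_moment[OF DERIV_prec[OF s] P pm, of m]
  show ?thesis
    unfolding U_def
    by (rule has_vector_derivative_eq_rhs, rule has_vector_derivative_mult[OF has_vector_derivative_mult[OF q e] G])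
       (simp add: algebra_simps)
qed

lemma continuous_on_U: "continuous_on ({0<..} \<times> UNIV) (\<lambda>p. U m (fst p) (snd p))"
proof -
  have p': "continuous_on ({0<..} \<times> UNIV) (\<lambda>x. prec (fst x))"
    by (rule continuous_on_compose2[OF continuous_on_prec]) (auto intro!: continuous_intros)
  have m: "continuous_on ({0<..} \<times> UNIV) (\<lambda>x. mean (fst x) (snd x))"
    unfolding mean_def by (auto intro!: continuous_intros continuous_on_compose2[OF continuous_on_expint])
  have G: "continuous_on ({0<..} \<times> UNIV) (\<lambda>x. gauss_moment g m (prec (fst x)) (2 * of_real (prec (fst x)) * mean (fst x) (snd x)))"
  proof -
    let ?q = "\<lambda>x. (prec (fst x), 2 * of_real (prec (fst x)) * mean (fst x) (snd x))"
    have "continuous_on ({0<..} \<times> UNIV) ?q"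
      by (intro continuous_intros p' m)
    moreover have "?q ` ({0<..} \<times> UNIV) \<subseteq> {0<..} \<times> UNIV" using prec_pos by auto
    ultimately have "continuous_on ({0<..} \<times> UNIV) (\<lambda>x. gauss_moment g m (fst (?q x)) (snd (?q x)))"
      by (rule continuous_on_compose2[OF continuous_on_gauss_moment])
    then show ?thesis by simp
  qed
  show ?thesis
    unfolding U_def by (intro continuous_intros p' m G) auto
qed

lemma holomorphic_U: "s > 0 \<Longrightarrow> U m s holomorphic_on A"
  by (rule holomorphic_on_subset[of _ UNIV])
     (use DERIV_U_z in \<open>auto simp: holomorphic_on_open\<close>)

lemma deriv_U:
  "s > 0 \<Longrightarrow> deriv (U m s) z = 2 * of_real (prec s * exp (b * s)) * (U (Suc m) s z - mean s z * U m s z)"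
  by (rule DERIV_imp_deriv[OF DERIV_U_z])

lemma deriv_deriv_U:
  assumes "s > 0"
  shows "deriv (deriv (U m s)) z = 2 * of_real (prec s * exp (b * s)) *
     (2 * of_real (prec s * exp (b * s)) * (U (m + 2) s z - mean s z * U (Suc m) s z) -
      (of_real (exp (b * s)) * U m s z
        + mean s z * (2 * of_real (prec s * exp (b * s)) * (U (Suc m) s z - mean s z * U m s z))))"
  unfolding deriv_U[OF assms, abs_def]
  by (rule DERIV_imp_deriv, (rule derivative_eq_intros DERIV_U_z[OF assms] DERIV_mean_z refl)+)
     (simp add: algebra_simps)

text \<open>Since exp (b s) (a + b z) is the time derivative of the mean, the mean' terms of
  \<open>vector_derivative_U_s\<close> are exactly the drift term. The remaining ones form the
  second-order term because prec' = -2 c^2 exp (2 b s) prec^2, which the facts \<open>q\<close> and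
  \<open>p'\<close> insert.\<close>

lemma vector_derivative_U_0:
  assumes s: "s > 0"
  shows "((\<lambda>s. U 0 s z) has_vector_derivative
     (of_real a + of_real b * z) * deriv (U 0 s) z + of_real (c\<^sup>2 / 2) * deriv (deriv (U 0 s)) z) (at s)"
proof -
  have e2: "exp (2 * b * s) = exp (b * s) * exp (b * s)" by (simp add: exp_add[symmetric])
  have q: "of_real (prec' s / (2 * prec s)) = - of_real (c\<^sup>2 * prec s) * complex_of_real (exp (b * s)) ^ 2"
    using prec_pos[OF s] unfolding prec'_def e2 by (simp add: power2_eq_square field_simps)
  have p': "of_real (prec' s) = - 2 * of_real (c\<^sup>2) * complex_of_real (exp (b * s)) ^ 2 * of_real (prec s) ^ 2"
    unfolding prec'_def e2 by (simp add: power2_eq_square)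
  show ?thesis
    by (rule has_vector_derivative_eq_rhs[OF vector_derivative_U_s[OF s]])
       (simp add: deriv_deriv_U[OF s] deriv_U[OF s] q p' algebra_simps power2_eq_square numeral_2_eq_2)
qed

lemma fps_expansion_U_ode:
  assumes s: "s > 0"
  defines "F \<equiv> \<lambda>s. fps_expansion (U 0 s) 0"
  shows "((\<lambda>s. fps_nth (F s) k) has_vector_derivative
    fps_nth ((fps_const (of_real a) + fps_const (of_real b) * fps_X) * fps_deriv (F s)
      + fps_const (of_real (c\<^sup>2 / 2)) * fps_deriv (fps_deriv (F s))) k) (at s)"
proof -
  define Us where "Us = (\<lambda>s z. (of_real a + of_real b * z) * deriv (U 0 s) z + of_real (c\<^sup>2 / 2) * deriv (deriv (U 0 s)) z)"
  have hU: "U 0 s has_fps_expansion F s" if "s > 0" for s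
    unfolding F_def using holomorphic_U[OF that] by (intro has_fps_expansion_fps_expansion[of UNIV]) auto
  have hUs: "Us s has_fps_expansion (fps_const (of_real a) + fps_const (of_real b) * fps_X) * fps_deriv (F s)
      + fps_const (of_real (c\<^sup>2 / 2)) * fps_deriv (fps_deriv (F s))" if "s > 0" for s
    unfolding Us_def by (intro fps_expansion_intros hU that)
  have "((\<lambda>s. (deriv ^^ k) (U 0 s) 0) has_vector_derivative (deriv ^^ k) (Us s) 0) (at s)"
  proof (rule has_vector_derivative_deriv_pow_at_0[of "{0<..}"])
    show "U 0 s holomorphic_on UNIV" if "s \<in> {0<..}" for s using holomorphic_U that by auto
    show "Us s holomorphic_on UNIV" if "s \<in> {0<..}" for s
      unfolding Us_def using that by (intro holomorphic_intros holomorphic_deriv holomorphic_U) auto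
    show "((\<lambda>s. U 0 s z) has_vector_derivative Us s z) (at s)" if "s \<in> {0<..}" for s z
      unfolding Us_def using that by (intro vector_derivative_U_0) auto
    \<comment> \<open>Joint continuity is verified on the closed formulas from
      \<open>deriv_U\<close> and \<open>deriv_deriv_U\<close>, where only \<open>U\<close>,
      \<open>mean\<close>, \<open>prec\<close> and exponentials occur.\<close>
    have "continuous_on ({0<..} \<times> UNIV) (\<lambda>(s, z). (of_real a + of_real b * z) *
       (2 * of_real (prec s * exp (b * s)) * (U (Suc 0) s z - mean s z * U 0 s z))
       + of_real (c\<^sup>2 / 2) * (2 * of_real (prec s * exp (b * s)) *
     (2 * of_real (prec s * exp (b * s)) * (U (0 + 2) s z - mean s z * U (Suc 0) s z) -
      (of_real (exp (b * s)) * U 0 s z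
        + mean s z * (2 * of_real (prec s * exp (b * s)) * (U (Suc 0) s z - mean s z * U 0 s z))))))"
      unfolding mean_def case_prod_beta
      by (intro continuous_intros continuous_on_U continuous_on_compose2[OF continuous_on_expint] continuous_on_compose2[OF continuous_on_prec]) auto
    then show "continuous_on ({0<..} \<times> UNIV) (\<lambda>p. Us (fst p) (snd p))"
      by (rule continuous_on_eq) (auto simp: Us_def deriv_U deriv_deriv_U)
  qed (use s in auto)
  then have "((\<lambda>s. (deriv ^^ k) (U 0 s) 0 / fact k) has_vector_derivative (deriv ^^ k) (Us s) 0 / fact k) (at s)"
    unfolding divide_inverse by (auto intro!: derivative_eq_intros)
  then show ?thesis
    by (rule has_vector_derivative_eq_rhs[OF has_vector_derivative_transform_within_open[of _ _ _ "{0<..}"]])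
       (use s fps_nth_fps_expansion[OF hU] fps_nth_fps_expansion[OF hUs] in auto)
qed

end

section \<open>Taylor coefficients of logarithms\<close>

text \<open>The identity is carried along the whole open real trace of S, since knowing it at one
  point would not allow a further differentiation. Differentiability is recorded as well, because
  \<open>vector_derivative\<close> has an unspecified value where no derivative exists.\<close>

lemma xderiv_of_holomorphic:
  assumes hol: "H holomorphic_on S" and S: "open S"
    and eq: "\<And>x. of_real x \<in> S \<Longrightarrow> h x = H (of_real x)" and x: "of_real x \<in> S"
  shows "xderiv k h x = (deriv ^^ k) H (of_real x)" "xderiv k h differentiable (at x)"
proof -
  let ?R = "of_real -` S :: real set"
  have R: "open ?R" by (intro open_vimage S continuous_intros)
  have vd: "(xderiv k h has_vector_derivative (deriv ^^ Suc k) H (of_real x)) (at x)"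
    if "\<And>x. of_real x \<in> S \<Longrightarrow> xderiv k h x = (deriv ^^ k) H (of_real x)" "of_real x \<in> S" for k x
  proof -
    have "(deriv ^^ k) H field_differentiable at (of_real x)"
      using holomorphic_higher_deriv[OF hol S, of k] that(2) S
      by (metis holomorphic_on_imp_differentiable_at)
    then have "((deriv ^^ k) H has_field_derivative (deriv ^^ Suc k) H (of_real x)) (at (of_real x))"
      by (simp add: field_differentiable_derivI)
    then have "((\<lambda>x. (deriv ^^ k) H (of_real x)) has_vector_derivative (deriv ^^ Suc k) H (of_real x)) (at x)"
      by (rule has_vector_derivative_real_field)
    then show ?thesis
      by (rule has_vector_derivative_transform_within_open[OF _ R]) (use that in auto)
  qed
  have *: "xderiv k h x = (deriv ^^ k) H (of_real x)" if "of_real x \<in> S" for x k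
    using that
  proof (induction k arbitrary: x)
    case 0
    then show ?case using eq by (simp add: xderiv_def)
  next
    case (Suc k)
    then have "vector_derivative (xderiv k h) (at x) = (deriv ^^ Suc k) H (of_real x)"
      by (intro vector_derivative_at vd)
    then show ?case by (simp add: xderiv_def)
  qed
  show "xderiv k h x = (deriv ^^ k) H (of_real x)" using * x .
  show "xderiv k h differentiable (at x)"
    using vd[OF * x] differentiableI_vector by blast
qed

lemma has_vector_derivative_fps_mult:
  fixes A B :: "real \<Rightarrow> complex fps"
  assumes "\<And>k. ((\<lambda>s. fps_nth (A s) k) has_vector_derivative fps_nth A' k) (at s)"
    and "\<And>k. ((\<lambda>s. fps_nth (B s) k) has_vector_derivative fps_nth B' k) (at s)"
  shows "((\<lambda>s. fps_nth (A s * B s) k) has_vector_derivative fps_nth (A s * B' + A' * B s) k) (at s)"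
  unfolding fps_mult_nth fps_add_nth sum.distrib[symmetric]
  by (intro has_vector_derivative_sum has_vector_derivative_mult assms)

text \<open>The Hopf--Cole transformation for formal power series. Differentiability of the coefficients of
  \<open>\<phi>\<close> comes from solving \<open>F' = \<phi>' F\<close> recursively; comparing the time derivatives of both sides
  then cancels \<open>F\<close>.\<close>
lemma fps_log_ode:
  fixes F \<phi> :: "real \<Rightarrow> complex fps" and P :: "complex fps"
  assumes I: "open I" "s \<in> I"
    and F0: "\<And>s. s \<in> I \<Longrightarrow> fps_nth (F s) 0 \<noteq> 0"
    and F: "\<And>s k. s \<in> I \<Longrightarrow> ((\<lambda>s. fps_nth (F s) k) has_vector_derivative
       fps_nth (P * fps_deriv (F s) + fps_const C * fps_deriv (fps_deriv (F s))) k) (at s)"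
    and log: "\<And>s. s \<in> I \<Longrightarrow> fps_deriv (F s) = fps_deriv (\<phi> s) * F s"
    and \<phi>0: "\<And>s. s \<in> I \<Longrightarrow> ((\<lambda>s. fps_nth (\<phi> s) 0) has_vector_derivative
       fps_nth (P * fps_deriv (F s) + fps_const C * fps_deriv (fps_deriv (F s))) 0 / fps_nth (F s) 0) (at s)"
  shows "((\<lambda>s. fps_nth (\<phi> s) k) has_vector_derivative
     fps_nth (P * fps_deriv (\<phi> s) + fps_const C * (fps_deriv (fps_deriv (\<phi> s)) + (fps_deriv (\<phi> s))\<^sup>2)) k) (at s)"
proof -
  have Fd: "(\<lambda>s. fps_nth (F s) k) differentiable (at s)" if "s \<in> I" for s k
    using F[OF that] differentiableI_vector by blast
  have \<phi>d: "(\<lambda>s. fps_nth (\<phi> s) k) differentiable (at s)" if "s \<in> I" for s k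
    using that
  proof (induction k arbitrary: s rule: less_induct)
    case (less k)
    show ?case
    proof (cases k)
      case 0
      then show ?thesis using \<phi>0[OF less.prems] differentiableI_vector by blast
    next
      case (Suc m)
      \<comment> \<open>Coefficient m = k - 1 of F' = phi' F, solved for its top unknown. Only
        coefficients of phi of index below k remain on the right, and F_0 is nonzero.\<close>
      have rec: "fps_nth (\<phi> s) k = (of_nat k * fps_nth (F s) k -
          (\<Sum>l<m. of_nat (Suc l) * fps_nth (\<phi> s) (Suc l) * fps_nth (F s) (m - l))) / (of_nat k * fps_nth (F s) 0)"
        if "s \<in> I" for s
      proof -
        have "of_nat k * fps_nth (F s) k = fps_nth (fps_deriv (F s)) m" by (simp add: Suc)
        also have "\<dots> = (\<Sum>l\<le>m. of_nat (Suc l) * fps_nth (\<phi> s) (Suc l) * fps_nth (F s) (m - l))"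
          unfolding log[OF that] fps_mult_nth by (simp add: atMost_atLeast0)
        also have "\<dots> = (\<Sum>l<m. of_nat (Suc l) * fps_nth (\<phi> s) (Suc l) * fps_nth (F s) (m - l))
            + of_nat k * fps_nth (\<phi> s) k * fps_nth (F s) 0"
          by (simp add: lessThan_Suc_atMost[symmetric] Suc)
        finally show ?thesis using F0[OF that] Suc by (simp add: field_simps del: of_nat_Suc)
      qed
      have "(\<lambda>s. (of_nat k * fps_nth (F s) k -
          (\<Sum>l<m. of_nat (Suc l) * fps_nth (\<phi> s) (Suc l) * fps_nth (F s) (m - l))) / (of_nat k * fps_nth (F s) 0))
          differentiable (at s)"
        using less Suc F0 Fd
        by (intro differentiable_divide differentiable_diff differentiable_mult differentiable_sum
            differentiable_const) (auto simp del: of_nat_Suc)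
      then obtain D where "((\<lambda>s. (of_nat k * fps_nth (F s) k -
          (\<Sum>l<m. of_nat (Suc l) * fps_nth (\<phi> s) (Suc l) * fps_nth (F s) (m - l))) / (of_nat k * fps_nth (F s) 0))
          has_derivative D) (at s)" unfolding differentiable_def by blast
      then have "((\<lambda>s. fps_nth (\<phi> s) k) has_derivative D) (at s)"
        by (rule has_derivative_transform_within_open[OF _ I(1) less.prems]) (simp add: rec)
      then show ?thesis unfolding differentiable_def by blast
    qed
  qed
  define \<psi> where "\<psi> = Abs_fps (\<lambda>k. vector_derivative (\<lambda>s. fps_nth (\<phi> s) k) (at s))"
  have \<psi>: "((\<lambda>s. fps_nth (\<phi> s) k) has_vector_derivative fps_nth \<psi> k) (at s)" for k
    unfolding \<psi>_def using \<phi>d[OF I(2)] by (simp add: vector_derivative_works[symmetric])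
  define R where "R = P * fps_deriv (\<phi> s) + fps_const C * (fps_deriv (fps_deriv (\<phi> s)) + (fps_deriv (\<phi> s))\<^sup>2)"
  \<comment> \<open>With F' = phi' F also F'' = (phi'' + phi'^2) F, so the linear right-hand side is
    \<open>R * F s\<close> with \<open>R\<close> the Riccati right-hand side.\<close>
  have DF: "P * fps_deriv (F s) + fps_const C * fps_deriv (fps_deriv (F s)) = R * F s"
    unfolding R_def log[OF I(2)] by (simp add: log[OF I(2)] algebra_simps power2_eq_square)
  have F': "((\<lambda>s. fps_nth (F s) k) has_vector_derivative fps_nth (R * F s) k) (at s)" for k
    using F[OF I(2), of k] unfolding DF .
  have 1: "((\<lambda>s. fps_nth (fps_deriv (F s)) k) has_vector_derivative fps_nth (fps_deriv (R * F s)) k) (at s)" for k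
    unfolding fps_deriv_nth by (intro has_vector_derivative_mult_right F')
  have "((\<lambda>s. fps_nth (fps_deriv (\<phi> s) * F s) k) has_vector_derivative
      fps_nth (fps_deriv (\<phi> s) * (R * F s) + fps_deriv \<psi> * F s) k) (at s)" for k
    by (rule has_vector_derivative_fps_mult[OF _ F'])
       (unfold fps_deriv_nth, intro has_vector_derivative_mult_right \<psi>)
  then have 2: "((\<lambda>s. fps_nth (fps_deriv (F s)) k) has_vector_derivative
      fps_nth (fps_deriv (\<phi> s) * (R * F s) + fps_deriv \<psi> * F s) k) (at s)" for k
    by (rule has_vector_derivative_transform_within_open[OF _ I]) (simp add: log)
  \<comment> \<open>\<open>1\<close> and \<open>2\<close> differentiate the same coefficients in
    time in two ways. Expanding (R F)' and replacing F' by phi' F leaves R' F = psi' F, and formal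
    power series over a field have no zero divisors.\<close>
  have "fps_deriv (R * F s) = fps_deriv (\<phi> s) * (R * F s) + fps_deriv \<psi> * F s"
    by (rule fps_ext) (rule vector_derivative_unique_at[OF 1 2])
  then have "(fps_deriv R - fps_deriv \<psi>) * F s = 0"
    by (simp add: log[OF I(2)] algebra_simps)
  moreover have "F s \<noteq> 0" using F0[OF I(2)] by auto
  ultimately have "fps_deriv R = fps_deriv \<psi>" by simp
  \<comment> \<open>Differentiation in x has lost the constant coefficient, which is what
    \<open>\<phi>0\<close> is assumed for.\<close>
  moreover have "fps_nth R 0 = fps_nth \<psi> 0"
    using vector_derivative_unique_at[OF \<psi>[of 0] \<phi>0[OF I(2)]] F0[OF I(2)] unfolding DF by simp
  ultimately have "R = \<psi>" by (simp add: fps_deriv_eq_iff)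
  then show ?thesis using \<psi>[of k] unfolding R_def by simp
qed

section \<open>The Riccati system for the principal logarithm of the semigroup\<close>

context ou_semigroup
begin

lemma U_quotient_pos:
  assumes s0: "s0 > 0" and nz: "U 0 s0 0 \<noteq> 0"
  obtains d where "d > 0" "d \<le> s0"
    "\<And>s z. \<bar>s - s0\<bar> < d \<Longrightarrow> cmod z < d \<Longrightarrow> Re (U 0 s z / U 0 s0 0) > 0"
proof -
  have "isCont (\<lambda>p. U 0 (fst p) (snd p) / U 0 s0 0) (s0, 0)"
    using continuous_on_U[of 0] s0 nz
    by (intro continuous_divide) (auto simp: continuous_on_eq_continuous_at open_Times)
  then obtain d where d: "d > 0"
    "\<And>p. dist p (s0, 0) < d \<Longrightarrow> dist (U 0 (fst p) (snd p) / U 0 s0 0) 1 < 1"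
    unfolding continuous_at_eps_delta using nz by (metis divide_self fst_conv snd_conv zero_less_one)
  show ?thesis
  proof (rule that[of "min (d / 2) s0"])
    fix s and z :: complex assume s: "\<bar>s - s0\<bar> < min (d / 2) s0" and z: "norm z < min (d / 2) s0"
    have "dist (s, z) (s0, 0) \<le> \<bar>s - s0\<bar> + norm z"
      unfolding dist_norm using norm_Pair_le[of "s - s0" z] by simp
    then have "dist (U 0 s z / U 0 s0 0) 1 < 1" using d(2)[of "(s, z)"] s z by simp
    then have "\<bar>Re (U 0 s z / U 0 s0 0 - 1)\<bar> < 1"
      unfolding dist_norm using abs_Re_le_cmod order_le_less_trans by blast
    then show "Re (U 0 s z / U 0 s0 0) > 0" by (simp only: minus_complex.sel one_complex.sel abs_less_iff) linarith
  qed (use d s0 in auto)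
qed

text \<open>Dividing by the constant \<open>U 0 s0 0\<close> leaves the logarithmic derivative
  unchanged and puts all quotients into the right half-plane, where \<open>Ln\<close> is
  holomorphic.\<close>

lemma log_U_ode:
  fixes k :: nat
  assumes d: "d > 0" "d \<le> s0" and nz: "U 0 s0 0 \<noteq> 0"
    and pos: "\<And>s z. \<bar>s - s0\<bar> < d \<Longrightarrow> norm z < d \<Longrightarrow> Re (U 0 s z / U 0 s0 0) > 0"
    and s: "\<bar>s - s0\<bar> < d"
  defines "\<phi> \<equiv> \<lambda>k s. (deriv ^^ k) (\<lambda>z. Ln (U 0 s z / U 0 s0 0)) 0 / fact k"
  defines "\<phi>t \<equiv> \<lambda>k. of_nat (k + 1) * \<phi> (k + 1) s"
  shows "(\<phi> k has_vector_derivative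
                  (complex_of_real (b * real k) * \<phi> k s
                 + complex_of_real (a * real (k + 1)) * \<phi> (k + 1) s
                 + complex_of_real (c\<^sup>2 * real (k + 2) * real (k + 1) / 2) * \<phi> (k + 2) s
                 + complex_of_real (c\<^sup>2 / 2) * conv \<phi>t \<phi>t k)) (at s)"
proof -
  define I where "I = {s0 - d<..<s0 + d}"
  define K where "K = (\<lambda>s z. Ln (U 0 s z / U 0 s0 0))"
  define F where "F = (\<lambda>s. fps_expansion (U 0 s) 0)"
  define \<Phi> where "\<Phi> = (\<lambda>s. fps_expansion (K s) 0)"
  define P where "P = (fps_const (of_real a) + fps_const (of_real b) * fps_X :: complex fps)"
  have I: "s > 0" "\<bar>s - s0\<bar> < d" if "s \<in> I" for s using that d unfolding I_def by auto
  have npos: "U 0 s z / U 0 s0 0 \<notin> \<real>\<^sub>\<le>\<^sub>0" "U 0 s z \<noteq> 0" if "s \<in> I" "norm z < d" for s z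
    using pos[OF I(2)[OF that(1)] that(2)] by (auto simp: complex_nonpos_Reals_iff)
  have dK: "(K s has_field_derivative deriv (U 0 s) z / U 0 s z) (at z)"
    if "s \<in> I" "norm z < d" for s z
  proof -
    have "(U 0 s has_field_derivative deriv (U 0 s) z) (at z)"
      using DERIV_U_z[OF I(1)[OF that(1)]] DERIV_deriv_iff_has_field_derivative by blast
    then show ?thesis
      unfolding K_def using npos[OF that] nz
      by (auto intro!: derivative_eq_intros simp: field_simps)
  qed
  have hK: "K s holomorphic_on ball 0 d" if "s \<in> I" for s
    unfolding holomorphic_on_open[OF open_ball] using dK[OF that] by (metis mem_ball_0)
  have exK: "K s has_fps_expansion \<Phi> s" if "s \<in> I" for s
    unfolding \<Phi>_def using hK[OF that] d by (intro has_fps_expansion_fps_expansion[of "ball 0 d"]) auto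
  have exU: "U 0 s has_fps_expansion F s" if "s \<in> I" for s
    unfolding F_def using holomorphic_U[OF I(1)[OF that]] by (intro has_fps_expansion_fps_expansion[of UNIV]) auto
  have F0: "fps_nth (F s) 0 = U 0 s 0" if "s \<in> I" for s
    using fps_nth_fps_expansion[OF exU[OF that], of 0] by simp
  have \<Phi>n: "fps_nth (\<Phi> s) k = \<phi> k s" if "s \<in> I" for s k
    using fps_nth_fps_expansion[OF exK[OF that], of k] by (simp add: \<phi>_def K_def)
  have sI: "s \<in> I" using s unfolding I_def by auto
  have F': "((\<lambda>s. fps_nth (F s) k) has_vector_derivative
       fps_nth (P * fps_deriv (F s) + fps_const (of_real (c\<^sup>2 / 2)) * fps_deriv (fps_deriv (F s))) k) (at s)"
    if "s \<in> I" for s k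
    unfolding F_def P_def by (rule fps_expansion_U_ode[OF I(1)[OF that]])
  have "((\<lambda>s. fps_nth (\<Phi> s) k) has_vector_derivative
     fps_nth (P * fps_deriv (\<Phi> s) + fps_const (of_real (c\<^sup>2 / 2)) *
       (fps_deriv (fps_deriv (\<Phi> s)) + (fps_deriv (\<Phi> s))\<^sup>2)) k) (at s)"
  proof (rule fps_log_ode[OF _ sI _ F'])
    show "open I" by (simp add: I_def)
    show "fps_nth (F s) 0 \<noteq> 0" if "s \<in> I" for s using F0[OF that] npos[OF that, of 0] d by simp
    show "fps_deriv (F s) = fps_deriv (\<Phi> s) * F s" if "s \<in> I" for s
    proof (rule fps_expansion_unique_complex)
      show "deriv (U 0 s) has_fps_expansion fps_deriv (F s)" by (intro fps_expansion_intros exU that)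
      have ex: "(\<lambda>z. deriv (K s) z * U 0 s z) has_fps_expansion fps_deriv (\<Phi> s) * F s"
        by (intro fps_expansion_intros exU exK that)
      have "eventually (\<lambda>z. deriv (K s) z * U 0 s z = deriv (U 0 s) z) (nhds 0)"
        unfolding eventually_nhds
        by (rule exI[of _ "ball 0 d"]) (use d DERIV_imp_deriv[OF dK[OF that]] npos[OF that] in auto)
      then show "deriv (U 0 s) has_fps_expansion fps_deriv (\<Phi> s) * F s"
        using iffD1[OF has_fps_expansion_cong[OF _ refl] ex] by blast
    qed
    fix s assume sI: "s \<in> I"
    define D where "D = fps_nth (P * fps_deriv (F s) + fps_const (of_real (c\<^sup>2 / 2)) * fps_deriv (fps_deriv (F s))) 0"
    have "((\<lambda>s. fps_nth (F s) 0 / U 0 s0 0) has_vector_derivative D / U 0 s0 0) (at s)"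
      unfolding D_def by (rule has_vector_derivative_divide[OF F'[OF sI]])
    from field_vector_diff_chain_at[OF this has_field_derivative_Ln] npos[OF sI, of 0] d nz
    have "((\<lambda>s. Ln (fps_nth (F s) 0 / U 0 s0 0)) has_vector_derivative D / fps_nth (F s) 0) (at s)"
      by (simp add: o_def F0[OF sI])
    then show "((\<lambda>s. fps_nth (\<Phi> s) 0) has_vector_derivative
       fps_nth (P * fps_deriv (F s) + fps_const (of_real (c\<^sup>2 / 2)) * fps_deriv (fps_deriv (F s))) 0 / fps_nth (F s) 0) (at s)"
      unfolding D_def[symmetric] by (rule has_vector_derivative_transform_within_open[of _ _ _ I]) (use sI in \<open>auto simp: I_def \<Phi>n \<phi>_def F0\<close>)
  qed
  then have "(\<phi> k has_vector_derivative
     fps_nth (P * fps_deriv (\<Phi> s) + fps_const (of_real (c\<^sup>2 / 2)) *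
       (fps_deriv (fps_deriv (\<Phi> s)) + (fps_deriv (\<Phi> s))\<^sup>2)) k) (at s)"
    by (rule has_vector_derivative_transform_within_open[of _ _ _ I]) (use sI in \<open>auto simp: I_def \<Phi>n\<close>)
  moreover have "fps_nth (P * fps_deriv (\<Phi> s)) k =
      complex_of_real (b * real k) * \<phi> k s + complex_of_real (a * real (k + 1)) * \<phi> (k + 1) s"
    unfolding P_def by (cases k) (simp_all add: \<Phi>n[OF sI] algebra_simps)
  moreover have "fps_nth ((fps_deriv (\<Phi> s))\<^sup>2) k = conv \<phi>t \<phi>t k"
    by (simp add: power2_eq_square fps_mult_nth conv_def \<phi>t_def \<Phi>n[OF sI] atMost_atLeast0)
  ultimately show ?thesis
    by (elim has_vector_derivative_eq_rhs) (simp add: \<Phi>n[OF sI] field_simps)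
qed

end

section \<open>Paths of the linear equation\<close>

text \<open>Replacing c dW by dX - (a + b X) dr makes the error the integral of b E(r) (X v - X r) +
  (E(r) - E(u)) (a + b X r), where E(r) = exp (b (s - r)); both terms are small by continuity,
  whatever the variation of W.\<close>

lemma linear_sde_increment_bound:
  fixes X W :: "real \<Rightarrow> real"
  assumes uv: "t0 \<le> u" "u \<le> v" "v \<le> s"
    and contX: "continuous_on {t0..s} X"
    and sde: "\<And>r. r \<in> {t0..s} \<Longrightarrow> X r = x + integral {t0..r} (\<lambda>r. a + b * X r) + c * (W r - W t0)"
    and K1: "\<And>r. r \<in> {t0..s} \<Longrightarrow> \<bar>exp (b * (s - r))\<bar> \<le> K1"
    and K2: "\<And>r. r \<in> {t0..s} \<Longrightarrow> \<bar>a + b * X r\<bar> \<le> K2"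
    and eX: "\<And>r. r \<in> {u..v} \<Longrightarrow> \<bar>X v - X r\<bar> \<le> e"
    and eE: "\<And>r. r \<in> {u..v} \<Longrightarrow> \<bar>exp (b * (s - r)) - exp (b * (s - u))\<bar> \<le> e"
  shows "\<bar>c * exp (b * (s - u)) * (W v - W u) - ((exp (b * (s - v)) * X v - exp (b * (s - u)) * X u)
      - a * (expint b (s - u) - expint b (s - v)))\<bar> \<le> e * (\<bar>b\<bar> * K1 + K2) * (v - u)"
proof -
  let ?E = "\<lambda>r. exp (b * (s - r))"
  have i1: "((\<lambda>r. b * ?E r) has_integral (- ?E v - - ?E u)) {u..v}"
    by (rule fundamental_theorem_of_calculus[OF uv(2)])
       (auto intro!: derivative_eq_intros simp: has_real_derivative_iff_has_vector_derivative[symmetric])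
  have i2: "((\<lambda>r. a * ?E r) has_integral (- a * expint b (s - v) - - a * expint b (s - u))) {u..v}"
    by (rule fundamental_theorem_of_calculus[OF uv(2)])
       (auto intro!: derivative_eq_intros DERIV_chain2[OF DERIV_expint] simp: has_real_derivative_iff_has_vector_derivative[symmetric])
  have int: "(\<lambda>r. a + b * X r) integrable_on {t0..v}"
    by (rule integrable_continuous_interval)
       (use uv in \<open>auto intro!: continuous_intros continuous_on_subset[OF contX]\<close>)
  have "integral {t0..u} (\<lambda>r. a + b * X r) + integral {u..v} (\<lambda>r. a + b * X r) = integral {t0..v} (\<lambda>r. a + b * X r)"
    using uv int by (intro Henstock_Kurzweil_Integration.integral_combine) auto
  then have "integral {u..v} (\<lambda>r. a + b * X r) = X v - X u - c * (W v - W u)"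
    using sde[of u] sde[of v] uv by (simp add: algebra_simps)
  moreover have "(\<lambda>r. a + b * X r) integrable_on {u..v}"
    by (rule integrable_subinterval_real[OF int]) (use uv in auto)
  ultimately have i3: "((\<lambda>r. a + b * X r) has_integral (X v - X u - c * (W v - W u))) {u..v}"
    using integrable_integral by metis
  have "((\<lambda>r. b * ?E r * X v - ?E u * (a + b * X r) + a * ?E r) has_integral
     ((- ?E v - - ?E u) * X v - ?E u * (X v - X u - c * (W v - W u)) + (- a * expint b (s - v) - - a * expint b (s - u)))) {u..v}"
    by (intro has_integral_add has_integral_diff has_integral_mult_left has_integral_mult_right i1 i2 i3)
  then have hi: "((\<lambda>r. b * ?E r * (X v - X r) + (?E r - ?E u) * (a + b * X r)) has_integral
     (c * exp (b * (s - u)) * (W v - W u) - ((exp (b * (s - v)) * X v - exp (b * (s - u)) * X u)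
      - a * (expint b (s - u) - expint b (s - v))))) {u..v}"
    by (simp add: algebra_simps)
  have e0: "e \<ge> 0" using eX[of u] uv by (auto intro: order_trans[OF abs_ge_zero])
  have K0: "K1 \<ge> 0" "K2 \<ge> 0" using order_trans[OF abs_ge_zero K1[of t0]] order_trans[OF abs_ge_zero K2[of t0]] uv by auto
  have "norm (b * ?E r * (X v - X r) + (?E r - ?E u) * (a + b * X r)) \<le> e * (\<bar>b\<bar> * K1 + K2)"
    if r: "r \<in> {u..v}" for r
  proof -
    have r': "r \<in> {t0..s}" using r uv by auto
    have "\<bar>b * ?E r * (X v - X r)\<bar> \<le> \<bar>b\<bar> * K1 * e"
      unfolding abs_mult using K1[OF r'] eX[OF r] K0 by (intro mult_mono) auto
    moreover have "\<bar>(?E r - ?E u) * (a + b * X r)\<bar> \<le> e * K2"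
      unfolding abs_mult using K2[OF r'] eE[OF r] K0 e0 by (intro mult_mono) auto
    ultimately show ?thesis unfolding real_norm_def
      using abs_triangle_ineq[of "b * ?E r * (X v - X r)" "(?E r - ?E u) * (a + b * X r)"]
      by (simp add: algebra_simps)
  qed
  with has_integral_bound_real[OF _ finite.emptyI hi] e0 K0 uv show ?thesis by simp
qed

text \<open>Discrete variation of constants: summation by parts against \<open>exp (b (s - r))\<close>.\<close>
lemma linear_sde_riemann_sums:
  fixes X W :: "real \<Rightarrow> real"
  assumes ts: "t0 \<le> s"
    and contX: "continuous_on {t0..s} X"
    and sde: "\<And>r. r \<in> {t0..s} \<Longrightarrow> X r = x + integral {t0..r} (\<lambda>r. a + b * X r) + c * (W r - W t0)"
  shows "(\<lambda>N. \<Sum>k<N. c * exp (b * (s - (t0 + real k * ((s - t0) / real N)))) *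
           (W (t0 + real (Suc k) * ((s - t0) / real N)) - W (t0 + real k * ((s - t0) / real N))))
     \<longlonglongrightarrow> X s - exp (b * (s - t0)) * x - a * expint b (s - t0)"
proof (rule LIMSEQ_I)
  fix \<epsilon> :: real assume \<epsilon>: "\<epsilon> > 0"
  let ?E = "\<lambda>r. exp (b * (s - r))"
  have contE: "continuous_on {t0..s} ?E" by (intro continuous_intros)
  obtain K1 where K1: "K1 > 0" "\<And>r. r \<in> {t0..s} \<Longrightarrow> \<bar>?E r\<bar> \<le> K1"
    using compact_imp_bounded[OF compact_continuous_image[OF contE compact_Icc]]
    unfolding bounded_pos by auto
  have contaX: "continuous_on {t0..s} (\<lambda>r. a + b * X r)" by (intro continuous_intros contX)
  obtain K2 where K2: "K2 > 0" "\<And>r. r \<in> {t0..s} \<Longrightarrow> \<bar>a + b * X r\<bar> \<le> K2"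
    using compact_imp_bounded[OF compact_continuous_image[OF contaX compact_Icc]]
    unfolding bounded_pos by auto
  define K where "K = (\<bar>b\<bar> * K1 + K2) * (s - t0)"
  \<comment> \<open>The errors add up to e K; the +1 avoids division by 0 when s = t0.\<close>
  define e where "e = \<epsilon> / (K + 1)"
  have K: "K \<ge> 0" unfolding K_def using K1 K2 ts by auto
  have e: "e > 0" "e * K < \<epsilon>" using \<epsilon> K unfolding e_def by (auto simp: field_simps)
  have "uniformly_continuous_on {t0..s} X" "uniformly_continuous_on {t0..s} ?E"
    using contX contE by (auto intro: compact_uniformly_continuous)
  then obtain d1 d2 where d: "d1 > 0" "d2 > 0"
    and d1: "\<And>r r'. r \<in> {t0..s} \<Longrightarrow> r' \<in> {t0..s} \<Longrightarrow> \<bar>r - r'\<bar> < d1 \<Longrightarrow> \<bar>X r - X r'\<bar> < e"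
    and d2: "\<And>r r'. r \<in> {t0..s} \<Longrightarrow> r' \<in> {t0..s} \<Longrightarrow> \<bar>r - r'\<bar> < d2 \<Longrightarrow> \<bar>?E r - ?E r'\<bar> < e"
    unfolding uniformly_continuous_on_def dist_real_def using e(1)
    by (metis abs_minus_commute)
  obtain N0 :: nat where N0: "(s - t0) / min d1 d2 < real N0" using reals_Archimedean2 by blast
  show "\<exists>N0. \<forall>N\<ge>N0. norm ((\<Sum>k<N. c * exp (b * (s - (t0 + real k * ((s - t0) / real N)))) *
           (W (t0 + real (Suc k) * ((s - t0) / real N)) - W (t0 + real k * ((s - t0) / real N))))
      - (X s - exp (b * (s - t0)) * x - a * expint b (s - t0))) < \<epsilon>"
  \<comment> \<open>From \<open>N0\<close> on the mesh is below both moduli of continuity, and N >=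
    1 is needed for the last grid point to be s.\<close>
  proof (intro exI[of _ "max N0 1"] allI impI)
    fix N assume N: "N \<ge> max N0 1"
    define \<delta> where "\<delta> = (s - t0) / real N"
    define r where "r = (\<lambda>k. t0 + real k * \<delta>)"
    have \<delta>0: "\<delta> \<ge> 0" using ts unfolding \<delta>_def by simp
    have "(s - t0) / min d1 d2 < real N" using N0 N by linarith
    moreover have "min d1 d2 > 0" "real N > 0" using d N by auto
    ultimately have "\<delta> < min d1 d2"
      unfolding \<delta>_def by (simp only: pos_divide_less_eq mult.commute)
    then have \<delta>: "\<delta> < d1" "\<delta> < d2" by auto
    have rN: "r N = s" using N unfolding r_def \<delta>_def by simp
    have r0: "r 0 = t0" by (simp add: r_def)
    have rk: "t0 \<le> r k" "r k \<le> r (Suc k)" for k using \<delta>0 by (auto simp: r_def algebra_simps)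
    have rs: "r k \<le> s" if "k \<le> N" for k
      using that \<delta>0 rN unfolding r_def by (metis add_left_mono mult_right_mono of_nat_le_iff)
    have Xt0: "X t0 = x" using sde[of t0] ts by simp
    let ?T = "\<lambda>k. c * ?E (r k) * (W (r (Suc k)) - W (r k))"
    \<comment> \<open>\<open>?G\<close> collects the exact part of the increments. Its values at t0
      and s give the limit by telescoping, with \<open>expint b 0 = 0\<close> at the right
      end.\<close>
    let ?G = "\<lambda>k. ?E (r k) * X (r k) + a * expint b (s - r k)"
    have bd: "\<bar>?T k - (?G (Suc k) - ?G k)\<bar> \<le> e * (\<bar>b\<bar> * K1 + K2) * \<delta>" if k: "k < N" for k
    proof -
      have ks: "r (Suc k) \<le> s" using k by (intro rs) auto
      have diff: "r (Suc k) - r k = \<delta>" by (simp add: r_def algebra_simps)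
      have near: "\<bar>X (r (Suc k)) - X \<rho>\<bar> \<le> e" "\<bar>?E \<rho> - ?E (r k)\<bar> \<le> e" if \<rho>: "\<rho> \<in> {r k..r (Suc k)}" for \<rho>
      proof -
        have "\<rho> \<in> {t0..s}" "r k \<in> {t0..s}" "r (Suc k) \<in> {t0..s}"
          using \<rho> rk(1)[of k] rk(2)[of k] ks by auto
        moreover have "\<bar>r (Suc k) - \<rho>\<bar> < d1" "\<bar>\<rho> - r k\<bar> < d2" using \<rho> diff \<delta> by auto
        ultimately show "\<bar>X (r (Suc k)) - X \<rho>\<bar> \<le> e" "\<bar>?E \<rho> - ?E (r k)\<bar> \<le> e"
          using d1 d2 less_imp_le by blast+
      qed
      have "\<bar>c * ?E (r k) * (W (r (Suc k)) - W (r k)) - ((?E (r (Suc k)) * X (r (Suc k)) - ?E (r k) * X (r k))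
         - a * (expint b (s - r k) - expint b (s - r (Suc k))))\<bar> \<le> e * (\<bar>b\<bar> * K1 + K2) * (r (Suc k) - r k)"
        by (rule linear_sde_increment_bound[OF rk(1) rk(2) ks contX sde K1(2) K2(2) near]) auto
      then show ?thesis unfolding diff by (simp add: algebra_simps)
    qed
    have "(\<Sum>k<N. ?G (Suc k) - ?G k) = X s - ?E t0 * x - a * expint b (s - t0)"
      unfolding sum_lessThan_telescope[of ?G] r0 rN Xt0 by simp
    then have "\<bar>(\<Sum>k<N. ?T k) - (X s - ?E t0 * x - a * expint b (s - t0))\<bar> = \<bar>\<Sum>k<N. ?T k - (?G (Suc k) - ?G k)\<bar>"
      by (simp add: sum_subtractf)
    also have "\<dots> \<le> (\<Sum>k<N. e * (\<bar>b\<bar> * K1 + K2) * \<delta>)"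
      using bd by (intro order_trans[OF sum_abs] sum_mono) auto
    also have "\<dots> = e * K" using N unfolding K_def \<delta>_def by simp
    also have "\<dots> < \<epsilon>" by (rule e)
    finally show "norm ((\<Sum>k<N. c * exp (b * (s - (t0 + real k * ((s - t0) / real N)))) *
           (W (t0 + real (Suc k) * ((s - t0) / real N)) - W (t0 + real k * ((s - t0) / real N))))
      - (X s - exp (b * (s - t0)) * x - a * expint b (s - t0))) < \<epsilon>"
      unfolding r_def \<delta>_def real_norm_def .
  qed
qed

text \<open>The preceding result for the driving path W r = r with a = 0, c = 1, x = 0: the solution
  of X' = b X + 1 vanishing at t0 is \<open>expint b (r - t0)\<close>. With 2 b in place of b this
  gives the limiting variance in \<open>ou_markov\<close>.\<close>

lemma expint_riemann_sums:
  assumes ts: "t0 \<le> s"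
  shows "(\<lambda>N. \<Sum>k<N. exp (b * (s - (t0 + real k * ((s - t0) / real N)))) * ((s - t0) / real N))
     \<longlonglongrightarrow> expint b (s - t0)"
proof -
  have "(\<lambda>N. \<Sum>k<N. 1 * exp (b * (s - (t0 + real k * ((s - t0) / real N)))) *
           ((t0 + real (Suc k) * ((s - t0) / real N)) - (t0 + real k * ((s - t0) / real N))))
     \<longlonglongrightarrow> expint b (s - t0) - exp (b * (s - t0)) * 0 - 0 * expint b (s - t0)"
  proof (rule linear_sde_riemann_sums[OF ts])
    show "continuous_on {t0..s} (\<lambda>r. expint b (r - t0))"
      by (intro continuous_on_compose2[OF continuous_on_expint[of UNIV]] continuous_intros) auto
    fix r assume r: "r \<in> {t0..s}"
    have eb: "b * expint b u = exp (b * u) - 1" for u by (auto simp: expint_def)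
    have "((\<lambda>r. 0 + b * expint b (r - t0)) has_integral
        ((expint b (r - t0) - r) - (expint b (t0 - t0) - t0))) {t0..r}"
      by (rule fundamental_theorem_of_calculus)
         (use r in \<open>auto intro!: derivative_eq_intros DERIV_chain2[OF DERIV_expint]
            simp: has_real_derivative_iff_has_vector_derivative[symmetric] eb\<close>)
    from integral_unique[OF this]
    show "expint b (r - t0) = 0 + integral {t0..r} (\<lambda>r. 0 + b * expint b (r - t0)) + 1 * (r - t0)"
      by simp
  qed
  moreover have "(t0 + real (Suc k) * d) - (t0 + real k * d) = d" for k d by (simp add: algebra_simps)
  ultimately show ?thesis by (simp only: mult_1_left mult_zero_left mult_zero_right diff_0_right)
qed

section \<open>The Markov property\<close>

abbreviation std_normal :: "real measure" where
  "std_normal \<equiv> density lborel std_normal_density"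

lemma prob_space_std_normal: "prob_space std_normal"
  by (rule prob_space_normal_density) simp

text \<open>Fubini on the joint law. \<open>X\<close> is abstract and only its function
  \<open>\<zeta>\<close> is normal, because independence will be known for whole blocks of
  increments.\<close>

lemma (in prob_space) indep_std_normal_expectation:
  fixes H :: "real \<Rightarrow> 'c \<Rightarrow> complex"
  assumes ind: "indep_var S X P B" and \<zeta>: "\<zeta> \<in> borel_measurable S"
    and Z: "distributed M lborel (\<lambda>\<omega>. \<zeta> (X \<omega>)) std_normal_density"
    and H: "(\<lambda>(y, \<beta>). H y \<beta>) \<in> borel_measurable (borel \<Otimes>\<^sub>M P)"
    and H1: "\<And>y \<beta>. norm (H y \<beta>) \<le> 1"
  shows "(\<integral>\<omega>. H (\<zeta> (X \<omega>)) (B \<omega>) \<partial>M) = (\<integral>z. (\<integral>\<omega>. H z (B \<omega>) \<partial>M) \<partial>std_normal)"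
proof -
  have rv [measurable]: "X \<in> measurable M S" "B \<in> measurable M P"
    and prod: "distr M S X \<Otimes>\<^sub>M distr M P B = distr M (S \<Otimes>\<^sub>M P) (\<lambda>x. (X x, B x))"
    using ind unfolding indep_var_distribution_eq by auto
  note [measurable] = \<zeta> H
  have dZ: "distr M borel (\<lambda>\<omega>. \<zeta> (X \<omega>)) = std_normal"
    using distributed_distr_eq_density[OF Z] by (simp cong: distr_cong)
  interpret X: prob_space "distr M S X" by (rule prob_space_distr[OF rv(1)])
  interpret B: prob_space "distr M P B" by (rule prob_space_distr[OF rv(2)])
  interpret pair_prob_space "distr M S X" "distr M P B" ..
  define K where "K = (\<lambda>z. \<integral>\<beta>. H z \<beta> \<partial>distr M P B)"
  have K_eq: "K z = (\<integral>\<omega>. H z (B \<omega>) \<partial>M)" for z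
  proof -
    have "H z \<in> borel_measurable P" using measurable_Pair2[OF H, of z] by simp
    then show ?thesis unfolding K_def by (subst integral_distr) auto
  qed
  have K [measurable]: "K \<in> borel_measurable borel"
    unfolding K_def by (intro B.borel_measurable_lebesgue_integral) (use H in \<open>simp cong: measurable_cong_sets\<close>)
  have mH: "(\<lambda>(x, \<beta>). H (\<zeta> x) \<beta>) \<in> borel_measurable (S \<Otimes>\<^sub>M P)"
    unfolding case_prod_beta using measurable_compose[OF _ H, of "\<lambda>p. (\<zeta> (fst p), snd p)"] by simp
  have meas: "(\<lambda>(x, \<beta>). H (\<zeta> x) \<beta>) \<in> borel_measurable (distr M S X \<Otimes>\<^sub>M distr M P B)"
    using mH by (simp cong: measurable_cong_sets)
  have "(\<integral>\<omega>. H (\<zeta> (X \<omega>)) (B \<omega>) \<partial>M) = (\<integral>p. (\<lambda>(x, \<beta>). H (\<zeta> x) \<beta>) p \<partial>distr M (S \<Otimes>\<^sub>M P) (\<lambda>x. (X x, B x)))"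
    using mH by (subst integral_distr) auto
  also have "\<dots> = (\<integral>p. (\<lambda>(x, \<beta>). H (\<zeta> x) \<beta>) p \<partial>(distr M S X \<Otimes>\<^sub>M distr M P B))"
    unfolding prod[symmetric] ..
  also have "\<dots> = (\<integral>x. K (\<zeta> x) \<partial>distr M S X)"
    unfolding K_def by (subst integral_fst'[symmetric])
       (use meas H1 in \<open>auto intro!: integrable_const_bound[where B = 1]\<close>)
  also have "\<dots> = (\<integral>\<omega>. K (\<zeta> (X \<omega>)) \<partial>M)" by (subst integral_distr) auto
  also have "\<dots> = (\<integral>z. K z \<partial>distr M borel (\<lambda>\<omega>. \<zeta> (X \<omega>)))" by (subst integral_distr) auto
  finally show ?thesis unfolding dZ K_eq .
qed

text \<open>\<open>A\<close> discretises the noise on [t, t1] and \<open>B i\<close> that on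
  [t1, t1 + i h]; they use increments over disjoint intervals. After t1 the mesh is h/N, so that
  every t1 + i h is a grid point and all \<open>B i\<close> share one grid. \<open>A\<close> is
  exactly normal for each N, so the split can be made before the limit.\<close>

lemma brownian_increments_split:
  fixes W :: "real \<Rightarrow> 'a \<Rightarrow> real" and m N :: nat and b :: real
  assumes BM: "brownian_motion M W" and t: "0 \<le> t" "t < t1" "h > 0" and N: "N \<ge> 1" and c: "c \<noteq> 0"
  defines "\<delta> \<equiv> (t1 - t) / real N"
  defines "v \<equiv> (\<Sum>k<N. (c * exp (b * (t1 - (t + real k * \<delta>))))\<^sup>2 * \<delta>)"
  defines "A \<equiv> \<lambda>\<omega>. \<Sum>k<N. c * exp (b * (t1 - (t + real k * \<delta>))) * (W (t + real (Suc k) * \<delta>) \<omega> - W (t + real k * \<delta>) \<omega>)"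
  defines "B \<equiv> \<lambda>i \<omega>. \<Sum>k<i * N. c * exp (b * (real i * h - real k * (h / real N))) *
     (W (t1 + real (Suc k) * (h / real N)) \<omega> - W (t1 + real k * (h / real N)) \<omega>)"
  assumes H: "(\<lambda>(y, \<beta>). H y \<beta>) \<in> borel_measurable (borel \<Otimes>\<^sub>M PiM {..m} (\<lambda>_. borel))"
    and H1: "\<And>y \<beta>. norm (H y \<beta> :: complex) \<le> 1"
  shows "(\<integral>\<omega>. H (A \<omega>) (\<lambda>i\<in>{..m}. B i \<omega>) \<partial>M) =
     (\<integral>z. (\<integral>\<omega>. H (sqrt v * z) (\<lambda>i\<in>{..m}. B i \<omega>) \<partial>M) \<partial>std_normal)"
proof -
  interpret prob_space M using BM unfolding brownian_motion_def by simp
  \<comment> \<open>Both meshes are joined to one strictly increasing sequence, the form in which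
    \<open>brownian_motion\<close> states independence.\<close>
  define ts where "ts = (\<lambda>k. if k \<le> N then t + real k * \<delta> else t1 + real (k - N) * (h / real N))"
  define D where "D = (\<lambda>k \<omega>. W (ts (Suc k)) \<omega> - W (ts k) \<omega>)"
  define L where "L = (m + 1) * N"
  define e where "e = (\<lambda>k. c * exp (b * (t1 - (t + real k * \<delta>))))"
  define e' where "e' = (\<lambda>i k. c * exp (b * (real i * h - real k * (h / real N))))"
  have \<delta>: "\<delta> > 0" using t N unfolding \<delta>_def by simp
  have hN: "h / real N > 0" using t N by simp
  have tN: "t + real N * \<delta> = t1" using N unfolding \<delta>_def by simp
  have ts_tail: "ts (N + k) = t1 + real k * (h / real N)" for k
    unfolding ts_def using tN by (cases "k = 0") auto
  have ts_mono: "ts k < ts (Suc k)" for k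
  proof (cases "k < N")
    case True
    then show ?thesis using \<delta> by (simp add: ts_def algebra_simps)
  next
    case False
    then obtain l where k: "k = N + l" using le_Suc_ex not_less by blast
    show ?thesis
      unfolding k add_Suc_right[symmetric] ts_tail of_nat_Suc distrib_right using hN by linarith
  qed
  have ts0: "ts 0 = t" by (simp add: ts_def)
  have ts_nonneg: "ts k \<ge> 0" for k
    using t \<delta> hN unfolding ts_def by auto
  have ind: "indep_vars (\<lambda>_. borel) D {..<L}"
    using BM t ts0 ts_mono unfolding brownian_motion_def D_def by auto
  have dist: "distributed M lborel (D k) (normal_density 0 (sqrt (ts (Suc k) - ts k)))" for k
    using BM ts_nonneg[of k] ts_mono[of k] unfolding brownian_motion_def D_def by blast
  have NL: "{..<N} \<subseteq> {..<L}" "{N..<L} \<subseteq> {..<L}" unfolding L_def by auto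
  have DA: "D k = (\<lambda>\<omega>. W (t + real (Suc k) * \<delta>) \<omega> - W (t + real k * \<delta>) \<omega>)"
      "ts (Suc k) - ts k = \<delta>" if "k < N" for k
    using that by (auto simp: D_def ts_def algebra_simps)
  have DB: "D (N + k) = (\<lambda>\<omega>. W (t1 + real (Suc k) * (h / real N)) \<omega> - W (t1 + real k * (h / real N)) \<omega>)" for k
    unfolding D_def ts_tail add_Suc_right[symmetric] ..
  have A_eq: "A \<omega> = (\<Sum>k<N. e k * D k \<omega>)" for \<omega>
    unfolding A_def e_def by (intro sum.cong) (auto simp: DA)
  have B_eq: "B i \<omega> = (\<Sum>k<i * N. e' i k * D (N + k) \<omega>)" for i \<omega>
    unfolding B_def e'_def DB ..
  have v_eq: "v = (\<Sum>k<N. (e k)\<^sup>2 * \<delta>)" unfolding v_def e_def ..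
  have ek: "e k \<noteq> 0" for k using c by (simp add: e_def)
  have v: "v > 0" unfolding v_eq using N \<delta> ek by (intro sum_pos) (auto simp: lessThan_empty_iff)
  have "distributed M lborel (\<lambda>\<omega>. \<Sum>k<N. e k * D k \<omega>)
      (normal_density (\<Sum>k<N. 0) (sqrt (\<Sum>k<N. (\<bar>e k\<bar> * sqrt \<delta>)\<^sup>2)))"
  proof (rule sum_indep_normal)
    have "indep_vars (\<lambda>_. borel) D {..<N}" by (rule indep_vars_subset[OF ind NL(1)])
    then show "indep_vars (\<lambda>i. borel) (\<lambda>k \<omega>. e k * D k \<omega>) {..<N}"
      using indep_vars_compose2[of "\<lambda>_. borel" D "{..<N}" "\<lambda>k x. e k * x" "\<lambda>_. borel"] by simp
    fix k assume k: "k \<in> {..<N}"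
    show "0 < \<bar>e k\<bar> * sqrt \<delta>" using ek \<delta> by simp
    have "distributed M lborel (D k) (normal_density 0 (sqrt \<delta>))"
      using dist[of k] DA(2)[of k] k by simp
    from normal_density_affine[OF this _ ek[of k], of 0] \<delta>
    show "distributed M lborel (\<lambda>\<omega>. e k * D k \<omega>) (normal_density 0 (\<bar>e k\<bar> * sqrt \<delta>))" by simp
  qed (use N in \<open>auto simp: lessThan_empty_iff\<close>)
  moreover have "(\<Sum>k<N. (\<bar>e k\<bar> * sqrt \<delta>)\<^sup>2) = v"
    unfolding v_eq using \<delta> by (simp add: power_mult_distrib)
  ultimately have "distributed M lborel A (normal_density 0 (sqrt v))" by (simp add: A_eq[abs_def])
  then have Z: "distributed M lborel (\<lambda>\<omega>. A \<omega> / sqrt v) std_normal_density"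
    using normal_standard_normal_convert[of "sqrt v" A 0] v by simp
  have ir: "indep_var (PiM {..<N} (\<lambda>_. borel)) (\<lambda>\<omega>. restrict (\<lambda>i. D i \<omega>) {..<N})
      (PiM {N..<L} (\<lambda>_. borel)) (\<lambda>\<omega>. restrict (\<lambda>i. D i \<omega>) {N..<L})"
    by (rule indep_var_restrict[OF ind _ NL]) auto
  have idx: "N + k \<in> {N..<L}" if "i \<in> {..m}" "k < i * N" for i k
  proof -
    have "N + k < N + i * N" using that by simp
    also have "\<dots> = (1 + i) * N" by (simp add: algebra_simps)
    also have "\<dots> \<le> L" unfolding L_def using that by (intro mult_right_mono) auto
    finally show ?thesis by simp
  qed
  define \<zeta> where "\<zeta> = (\<lambda>x. (\<Sum>k<N. e k * x k) / sqrt v)"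
  define \<eta> where "\<eta> = (\<lambda>x. \<lambda>i\<in>{..m}. \<Sum>k<i * N. e' i k * x (N + k))"
  have \<zeta>: "\<zeta> \<in> borel_measurable (PiM {..<N} (\<lambda>_. borel))"
    unfolding \<zeta>_def by measurable
  have \<eta>: "\<eta> \<in> measurable (PiM {N..<L} (\<lambda>_. borel)) (PiM {..m} (\<lambda>_. borel))"
    unfolding \<eta>_def using idx by (intro measurable_restrict borel_measurable_sum borel_measurable_times
        borel_measurable_const measurable_component_singleton) auto
  have \<zeta>A: "\<zeta> (restrict (\<lambda>i. D i \<omega>) {..<N}) = A \<omega> / sqrt v" for \<omega>
    by (simp add: \<zeta>_def A_eq)
  have \<eta>B: "\<eta> (restrict (\<lambda>i. D i \<omega>) {N..<L}) = (\<lambda>i\<in>{..m}. B i \<omega>)" for \<omega>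
    unfolding \<eta>_def
  proof (rule restrict_ext)
    fix i assume i: "i \<in> {..m}"
    show "(\<Sum>k<i * N. e' i k * (\<lambda>i\<in>{N..<L}. D i \<omega>) (N + k)) = B i \<omega>"
      unfolding B_eq by (intro sum.cong refl) (use idx[OF i] in auto)
  qed
  have "(\<integral>\<omega>. H (sqrt v * \<zeta> (restrict (\<lambda>i. D i \<omega>) {..<N})) (\<eta> (restrict (\<lambda>i. D i \<omega>) {N..<L})) \<partial>M) =
     (\<integral>z. (\<integral>\<omega>. H (sqrt v * z) (\<eta> (restrict (\<lambda>i. D i \<omega>) {N..<L})) \<partial>M) \<partial>std_normal)"
  proof (rule indep_std_normal_expectation[OF ir \<zeta>, where H = "\<lambda>z x. H (sqrt v * z) (\<eta> x)"])
    show "distributed M lborel (\<lambda>\<omega>. \<zeta> (restrict (\<lambda>i. D i \<omega>) {..<N})) std_normal_density"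
      unfolding \<zeta>A by (rule Z)
    note [measurable] = \<eta>
    show "(\<lambda>(y, \<beta>). H (sqrt v * y) (\<eta> \<beta>)) \<in> borel_measurable (borel \<Otimes>\<^sub>M PiM {N..<L} (\<lambda>_. borel))"
      unfolding case_prod_beta
      using measurable_compose[OF _ H, of "\<lambda>p. (sqrt v * fst p, \<eta> (snd p))" "borel \<Otimes>\<^sub>M PiM {N..<L} (\<lambda>_. borel)"] by simp
  qed (rule H1)
  then show ?thesis unfolding \<zeta>A \<eta>B using v by simp
qed

text \<open>\<open>X\<close> and all \<open>Y y\<close> are driven by the same W. After t1 every
  solution is an affine function of its value at t1 plus a noise term that does not depend on the
  start; the functional thus becomes \<open>G\<close> of the state at t1 and the noise. For the
  discretisations these two are independent, and \<open>G\<close> is continuous and bounded by 1, so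
  the Fubini identity survives the limit.\<close>

lemma ou_markov:
  fixes W X :: "real \<Rightarrow> 'a \<Rightarrow> real" and Y :: "real \<Rightarrow> real \<Rightarrow> 'a \<Rightarrow> real"
    and hh :: "nat \<Rightarrow> real \<Rightarrow> complex" and m :: nat
  assumes BM: "brownian_motion M W" and t: "0 \<le> t" "t < t1" "h > 0" and c: "c \<noteq> 0"
    and X: "\<And>\<omega>. \<omega> \<in> space M \<Longrightarrow> continuous_on {t..t1 + real m * h} (\<lambda>s. X s \<omega>) \<and>
       (\<forall>s\<in>{t..t1 + real m * h}. X s \<omega> = x + integral {t..s} (\<lambda>r. a + b * X r \<omega>) + c * (W s \<omega> - W t \<omega>))"
    and Y: "\<And>y \<omega>. \<omega> \<in> space M \<Longrightarrow> continuous_on {t1..t1 + real m * h} (\<lambda>s. Y y s \<omega>) \<and>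
       (\<forall>s\<in>{t1..t1 + real m * h}. Y y s \<omega> = y + integral {t1..s} (\<lambda>r. a + b * Y y r \<omega>) + c * (W s \<omega> - W t1 \<omega>))"
    and hh: "\<And>i. i \<le> m \<Longrightarrow> continuous_on UNIV (hh i)" "\<And>i y. i \<le> m \<Longrightarrow> Re (hh i y) \<le> 0"
  defines "\<Phi> \<equiv> \<lambda>y. \<integral>\<omega>. exp (\<Sum>i\<le>m. hh i (Y y (t1 + real i * h) \<omega>)) \<partial>M"
  shows "(\<integral>\<omega>. exp (\<Sum>i\<le>m. hh i (X (t1 + real i * h) \<omega>)) \<partial>M) =
      (\<integral>z. \<Phi> (exp (b * (t1 - t)) * x + a * expint b (t1 - t) + sqrt (c\<^sup>2 * expint (2 * b) (t1 - t)) * z) \<partial>std_normal)"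
    and "\<Phi> \<in> borel_measurable borel" and "norm (\<Phi> y) \<le> 1"
proof -
  interpret prob_space M using BM unfolding brownian_motion_def by simp
  interpret N: prob_space std_normal by (rule prob_space_std_normal)
  have W [measurable]: "W r \<in> borel_measurable M" for r using BM unfolding brownian_motion_def by simp
  define \<delta> where "\<delta> = (\<lambda>N. (t1 - t) / real N)"
  define v where "v = (\<lambda>N. \<Sum>k<N. (c * exp (b * (t1 - (t + real k * \<delta> N))))\<^sup>2 * \<delta> N)"
  define A where "A = (\<lambda>N \<omega>. \<Sum>k<N. c * exp (b * (t1 - (t + real k * \<delta> N))) *
     (W (t + real (Suc k) * \<delta> N) \<omega> - W (t + real k * \<delta> N) \<omega>))"
  define B where "B = (\<lambda>N i \<omega>. \<Sum>k<i * N. c * exp (b * (real i * h - real k * (h / real N))) *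
     (W (t1 + real (Suc k) * (h / real N)) \<omega> - W (t1 + real k * (h / real N)) \<omega>))"
  \<comment> \<open>The noise after t1, obtained from the solution started at 0 by removing its
    deterministic part.\<close>
  define \<beta> where "\<beta> = (\<lambda>i \<omega>. Y 0 (t1 + real i * h) \<omega> - a * expint b (real i * h))"
  define y0 where "y0 = exp (b * (t1 - t)) * x + a * expint b (t1 - t)"
  define v0 where "v0 = c\<^sup>2 * expint (2 * b) (t1 - t)"
  define G where "G = (\<lambda>y \<beta>. exp (\<Sum>i\<le>m. hh i (exp (b * (real i * h)) * y + a * expint b (real i * h) + \<beta> i)))"
  define H where "H = (\<lambda>w. G (y0 + w))"
  have le_m: "t1 + real i * h \<le> t1 + real m * h" if "i \<le> m" for i
    using that t by (simp add: mult_right_mono)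
  \<comment> \<open>\<open>Z\<close> is any path solving the equation after t1. The sums
    \<open>B\<close> do not involve \<open>Z\<close>, so applying this to \<open>Y 0\<close>,
    \<open>Y y\<close> and the restarted \<open>X\<close> gives \<open>Y_eq\<close> and
    \<open>X_eq\<close> by uniqueness of limits.\<close>
  have lim_B: "(\<lambda>N. B N i \<omega>) \<longlonglongrightarrow> Z (t1 + real i * h) - exp (b * (real i * h)) * z - a * expint b (real i * h)"
    if i: "i \<le> m" and Z: "continuous_on {t1..t1 + real m * h} Z"
      "\<And>s. s \<in> {t1..t1 + real m * h} \<Longrightarrow> Z s = z + integral {t1..s} (\<lambda>r. a + b * Z r) + c * (W s \<omega> - W t1 \<omega>)"
    for i \<omega> Z z
  proof (cases "i = 0")
    case True
    then show ?thesis using Z(2)[of t1] t by (simp add: B_def)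
  next
    case False
    have L: "(\<lambda>N. \<Sum>k<N. c * exp (b * ((t1 + real i * h) - (t1 + real k * (((t1 + real i * h) - t1) / real N)))) *
           (W (t1 + real (Suc k) * (((t1 + real i * h) - t1) / real N)) \<omega> - W (t1 + real k * (((t1 + real i * h) - t1) / real N)) \<omega>))
     \<longlonglongrightarrow> Z (t1 + real i * h) - exp (b * ((t1 + real i * h) - t1)) * z - a * expint b ((t1 + real i * h) - t1)"
      by (rule linear_sde_riemann_sums)
         (use order_trans[OF _ le_m[OF i]] t in \<open>auto intro!: Z(2) continuous_on_subset[OF Z(1)]\<close>)
    \<comment> \<open>\<open>B N i\<close> has i N steps of length h/N and so is the term of index i
      N of the Riemann sums on [t1, t1 + i h]; for i = 0 that index would be constant, hence the
      case distinction.\<close>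
    have sm: "strict_mono (\<lambda>N. i * N)" using False by (intro strict_monoI) simp
    from LIMSEQ_subseq_LIMSEQ[OF L sm]
    have "(\<lambda>N. \<Sum>k<i * N. c * exp (b * ((t1 + real i * h) - (t1 + real k * (((t1 + real i * h) - t1) / real (i * N))))) *
           (W (t1 + real (Suc k) * (((t1 + real i * h) - t1) / real (i * N))) \<omega> - W (t1 + real k * (((t1 + real i * h) - t1) / real (i * N))) \<omega>))
     \<longlonglongrightarrow> Z (t1 + real i * h) - exp (b * ((t1 + real i * h) - t1)) * z - a * expint b ((t1 + real i * h) - t1)"
      unfolding o_def .
    moreover have "((t1 + real i * h) - t1) / real (i * N) = h / real N" for N using False by simp
    moreover have "(t1 + real i * h) - (t1 + u) = real i * h - u" for u by simp
    ultimately show ?thesis unfolding B_def by (simp only: add_diff_cancel_left')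
  qed
  have lim_\<beta>: "(\<lambda>N. B N i \<omega>) \<longlonglongrightarrow> \<beta> i \<omega>" if "i \<le> m" "\<omega> \<in> space M" for i \<omega>
    using lim_B[OF that(1), of "\<lambda>s. Y 0 s \<omega>" 0 \<omega>] Y[OF that(2), of 0] by (simp add: \<beta>_def)
  have Y_eq: "Y y (t1 + real i * h) \<omega> = exp (b * (real i * h)) * y + a * expint b (real i * h) + \<beta> i \<omega>"
    if "i \<le> m" "\<omega> \<in> space M" for i \<omega> y
    using LIMSEQ_unique[OF lim_\<beta>[OF that] lim_B[OF that(1), of "\<lambda>s. Y y s \<omega>" y \<omega>]] Y[OF that(2), of y] by simp
  have X_eq: "X (t1 + real i * h) \<omega> = exp (b * (real i * h)) * X t1 \<omega> + a * expint b (real i * h) + \<beta> i \<omega>"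
    if "i \<le> m" "\<omega> \<in> space M" for i \<omega>
  proof -
    have cX: "continuous_on {t..t1 + real m * h} (\<lambda>s. X s \<omega>)" using X[OF that(2)] by simp
    have t1: "t1 \<in> {t..t1 + real m * h}" using t by simp
    have rest: "X s \<omega> = X t1 \<omega> + integral {t1..s} (\<lambda>r. a + b * X r \<omega>) + c * (W s \<omega> - W t1 \<omega>)"
      if s: "s \<in> {t1..t1 + real m * h}" for s
    proof -
      have "(\<lambda>r. a + b * X r \<omega>) integrable_on {t..s}"
        by (rule integrable_continuous_interval)
           (use s in \<open>auto intro!: continuous_intros continuous_on_subset[OF cX]\<close>)
      then have "integral {t..t1} (\<lambda>r. a + b * X r \<omega>) + integral {t1..s} (\<lambda>r. a + b * X r \<omega>) = integral {t..s} (\<lambda>r. a + b * X r \<omega>)"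
        using s t by (intro Henstock_Kurzweil_Integration.integral_combine) auto
      moreover have "s \<in> {t..t1 + real m * h}" using s t by auto
      ultimately show ?thesis using X[OF \<open>\<omega> \<in> space M\<close>] t1 by (smt (verit, ccfv_SIG) right_diff_distrib)
    qed
    have cX1: "continuous_on {t1..t1 + real m * h} (\<lambda>s. X s \<omega>)"
      using t by (auto intro!: continuous_on_subset[OF cX])
    have "\<beta> i \<omega> = X (t1 + real i * h) \<omega> - exp (b * (real i * h)) * X t1 \<omega> - a * expint b (real i * h)"
      by (rule LIMSEQ_unique[OF lim_\<beta>[OF that] lim_B[OF that(1) cX1 rest]])
    then show ?thesis by simp
  qed
  have lim_A: "(\<lambda>N. A N \<omega>) \<longlonglongrightarrow> X t1 \<omega> - y0" if "\<omega> \<in> space M" for \<omega>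
  proof -
    have sub: "{t..t1} \<subseteq> {t..t1 + real m * h}" using t by auto
    have "(\<lambda>N. A N \<omega>) \<longlonglongrightarrow> X t1 \<omega> - exp (b * (t1 - t)) * x - a * expint b (t1 - t)"
      unfolding A_def \<delta>_def
      by (rule linear_sde_riemann_sums[OF less_imp_le[OF t(2)]])
         (use X[OF that] sub continuous_on_subset in blast)+
    then show ?thesis by (simp add: y0_def algebra_simps)
  qed
  have lim_v: "v \<longlonglongrightarrow> v0"
  proof -
    have "(\<lambda>N. c\<^sup>2 * (\<Sum>k<N. exp (2 * b * (t1 - (t + real k * ((t1 - t) / real N)))) * ((t1 - t) / real N))) \<longlonglongrightarrow> v0"
      unfolding v0_def using t by (intro tendsto_mult tendsto_const expint_riemann_sums) simp
    moreover have "(c * exp (b * u))\<^sup>2 = c\<^sup>2 * exp (2 * b * u)" for u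
      by (simp add: power_mult_distrib power2_eq_square exp_add[symmetric])
    ultimately show ?thesis unfolding v_def \<delta>_def by (simp add: sum_distrib_left mult.assoc)
  qed
  have G_lim: "(\<lambda>N. G (y N) (b' N)) \<longlonglongrightarrow> G y' b''"
    if "y \<longlonglongrightarrow> y'" "\<And>i. i \<le> m \<Longrightarrow> (\<lambda>N. b' N i) \<longlonglongrightarrow> b'' i" for y b' y' b''
  proof -
    have "(\<lambda>N. hh i (exp (b * (real i * h)) * y N + a * expint b (real i * h) + b' N i)) \<longlonglongrightarrow>
        hh i (exp (b * (real i * h)) * y' + a * expint b (real i * h) + b'' i)" if "i \<le> m" for i
      by (rule isCont_tendsto_compose[of _ "hh i"])
         (use hh(1)[OF that] \<open>i \<le> m\<close> in \<open>auto intro!: tendsto_intros \<open>y \<longlonglongrightarrow> y'\<close> \<open>\<And>i. i \<le> m \<Longrightarrow> (\<lambda>N. b' N i) \<longlonglongrightarrow> b'' i\<close> simp: continuous_on_eq_continuous_at\<close>)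
    then show ?thesis unfolding G_def by (intro tendsto_exp tendsto_sum) auto
  qed
  have G1: "norm (G y b') \<le> 1" for y b'
    unfolding G_def by (auto intro!: sum_nonpos hh(2))
  \<comment> \<open>Product measures require extensional functions, and \<open>G\<close> looks only
    at indices up to m.\<close>
  have G_restrict: "G y (\<lambda>i\<in>{..m}. b' i) = G y b'" for y b'
    unfolding G_def by (intro arg_cong[where f = exp] sum.cong) auto
  have hm: "hh i \<in> borel_measurable borel" if "i \<le> m" for i
    by (rule borel_measurable_continuous_onI[OF hh(1)[OF that]])
  have G_meas: "(\<lambda>p. G (fst p) (snd p)) \<in> borel_measurable (borel \<Otimes>\<^sub>M PiM {..m} (\<lambda>_. borel))"
    unfolding G_def
  proof (rule measurable_compose[OF _ borel_measurable_exp], rule borel_measurable_sum)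
    fix i assume i: "i \<in> {..m}"
    then have [measurable]: "hh i \<in> borel_measurable borel" using hm by simp
    have [measurable]: "(\<lambda>p. snd p i) \<in> borel_measurable (borel \<Otimes>\<^sub>M PiM {..m} (\<lambda>_. borel))"
      using measurable_compose[OF measurable_snd measurable_component_singleton[OF i]] by blast
    show "(\<lambda>p. hh i (exp (b * (real i * h)) * fst p + a * expint b (real i * h) + snd p i))
        \<in> borel_measurable (borel \<Otimes>\<^sub>M PiM {..m} (\<lambda>_. borel))" by measurable
  qed
  have H_meas: "(\<lambda>(w, b'). H w b') \<in> borel_measurable (borel \<Otimes>\<^sub>M PiM {..m} (\<lambda>_. borel))"
    unfolding H_def case_prod_beta
    using measurable_compose[OF _ G_meas, of "\<lambda>p. (y0 + fst p, snd p)" "borel \<Otimes>\<^sub>M PiM {..m} (\<lambda>_. borel)"] by simp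
  have A_meas [measurable]: "A N \<in> borel_measurable M" for N unfolding A_def by measurable
  have B_meas [measurable]: "B N i \<in> borel_measurable M" for N i unfolding B_def by measurable
  \<comment> \<open>Measurability of the solution is obtained from the sums of Brownian increments
    that converge to it.\<close>
  have X_meas [measurable]: "X t1 \<in> borel_measurable M"
  proof -
    have "(\<lambda>\<omega>. X t1 \<omega> - y0) \<in> borel_measurable M" by (rule borel_measurable_LIMSEQ_real[OF lim_A A_meas])
    then have "(\<lambda>\<omega>. (X t1 \<omega> - y0) + y0) \<in> borel_measurable M" by measurable
    then show ?thesis by simp
  qed
  have \<beta>_meas: "\<beta> i \<in> borel_measurable M" if "i \<le> m" for i
    by (rule borel_measurable_LIMSEQ_real[OF lim_\<beta>[OF that] B_meas])
  have GM: "(\<lambda>p. G (f p) (\<lambda>i. b' i p)) \<in> borel_measurable K"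
    if "f \<in> borel_measurable K" "\<And>i. i \<le> m \<Longrightarrow> b' i \<in> borel_measurable K" for K :: "'z measure" and f b'
  proof -
    have "(\<lambda>p. (f p, \<lambda>i\<in>{..m}. b' i p)) \<in> measurable K (borel \<Otimes>\<^sub>M PiM {..m} (\<lambda>_. borel))"
      using that by (intro measurable_Pair measurable_restrict) auto
    from measurable_compose[OF this G_meas] show ?thesis by (simp add: G_restrict)
  qed
  have \<Phi>_eq: "\<Phi> y = (\<integral>\<omega>. G y (\<lambda>i. \<beta> i \<omega>) \<partial>M)" for y
    unfolding \<Phi>_def G_def
    by (intro Bochner_Integration.integral_cong refl arg_cong[where f = exp] sum.cong) (auto simp: Y_eq)
  show \<Phi>_meas: "\<Phi> \<in> borel_measurable borel"
    unfolding \<Phi>_eq[abs_def]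
  proof (rule borel_measurable_lebesgue_integral)
    have "(\<lambda>p. G (fst p) (\<lambda>i. \<beta> i (snd p))) \<in> borel_measurable (borel \<Otimes>\<^sub>M M)"
      by (rule GM) (use measurable_compose[OF measurable_snd \<beta>_meas] in auto)
    then show "(\<lambda>(y, \<omega>). G y (\<lambda>i. \<beta> i \<omega>)) \<in> borel_measurable (borel \<Otimes>\<^sub>M M)" by (simp add: case_prod_beta)
  qed
  \<comment> \<open>For a non-integrable F the integral is 0 by convention, so the bound holds in
    that case too.\<close>
  have int1: "norm (\<integral>\<omega>. F \<omega> \<partial>M) \<le> 1" if "\<And>\<omega>. norm (F \<omega>) \<le> 1" for F :: "'a \<Rightarrow> complex"
  proof (cases "integrable M F")
    case True
    have "norm (\<integral>\<omega>. F \<omega> \<partial>M) \<le> (\<integral>\<omega>. norm (F \<omega>) \<partial>M)" by (rule integral_norm_bound)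
    also have "\<dots> \<le> (\<integral>\<omega>. 1 \<partial>M)" using True that by (intro integral_mono) auto
    finally show ?thesis by (simp add: prob_space)
  qed (simp add: not_integrable_integral_eq)
  show "norm (\<Phi> y) \<le> 1" unfolding \<Phi>_eq using G1 by (intro int1)
  define J where "J = (\<lambda>N z. \<integral>\<omega>. G (y0 + sqrt (v N) * z) (\<lambda>i. B N i \<omega>) \<partial>M)"
  have J_meas: "J N \<in> borel_measurable borel" for N
    unfolding J_def
  proof (rule borel_measurable_lebesgue_integral)
    have "(\<lambda>p. G (y0 + sqrt (v N) * fst p) (\<lambda>i. B N i (snd p))) \<in> borel_measurable (borel \<Otimes>\<^sub>M M)"
      by (rule GM) (use measurable_compose[OF measurable_snd B_meas] in auto)
    then show "(\<lambda>(z, \<omega>). G (y0 + sqrt (v N) * z) (\<lambda>i. B N i \<omega>)) \<in> borel_measurable (borel \<Otimes>\<^sub>M M)" by (simp add: case_prod_beta)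
  qed
  have split: "(\<integral>\<omega>. G (y0 + A (Suc N) \<omega>) (\<lambda>i. B (Suc N) i \<omega>) \<partial>M) = (\<integral>z. J (Suc N) z \<partial>std_normal)" for N
    using brownian_increments_split[OF BM t _ c H_meas, of "Suc N" b] G1
    unfolding H_def G_restrict J_def A_def B_def v_def \<delta>_def by simp
  have "(\<lambda>N. \<integral>\<omega>. G (y0 + A (Suc N) \<omega>) (\<lambda>i. B (Suc N) i \<omega>) \<partial>M) \<longlonglongrightarrow> (\<integral>\<omega>. G (X t1 \<omega>) (\<lambda>i. \<beta> i \<omega>) \<partial>M)"
  proof (rule integral_dominated_convergence[where w = "\<lambda>_. 1"])
    show "AE \<omega> in M. (\<lambda>N. G (y0 + A (Suc N) \<omega>) (\<lambda>i. B (Suc N) i \<omega>)) \<longlonglongrightarrow> G (X t1 \<omega>) (\<lambda>i. \<beta> i \<omega>)"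
    proof (intro AE_I2 G_lim)
      fix \<omega> assume w: "\<omega> \<in> space M"
      have "(\<lambda>N. y0 + A N \<omega>) \<longlonglongrightarrow> y0 + (X t1 \<omega> - y0)" by (intro tendsto_intros lim_A[OF w])
      then show "(\<lambda>N. y0 + A (Suc N) \<omega>) \<longlonglongrightarrow> X t1 \<omega>" using LIMSEQ_Suc by fastforce
      show "(\<lambda>N. B (Suc N) i \<omega>) \<longlonglongrightarrow> \<beta> i \<omega>" if "i \<le> m" for i using LIMSEQ_Suc[OF lim_\<beta>[OF that w]] .
    qed
  qed (use G1 \<beta>_meas in \<open>auto intro!: GM\<close>)
  moreover have "(\<lambda>N. \<integral>z. J (Suc N) z \<partial>std_normal) \<longlonglongrightarrow> (\<integral>z. \<Phi> (y0 + sqrt v0 * z) \<partial>std_normal)"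
  proof (rule integral_dominated_convergence[where w = "\<lambda>_. 1"])
    show "AE z in std_normal. (\<lambda>N. J (Suc N) z) \<longlonglongrightarrow> \<Phi> (y0 + sqrt v0 * z)"
    proof (rule AE_I2)
      fix z
      show "(\<lambda>N. J (Suc N) z) \<longlonglongrightarrow> \<Phi> (y0 + sqrt v0 * z)"
        unfolding J_def \<Phi>_eq
      proof (rule integral_dominated_convergence[where w = "\<lambda>_. 1"])
        show "AE \<omega> in M. (\<lambda>N. G (y0 + sqrt (v (Suc N)) * z) (\<lambda>i. B (Suc N) i \<omega>)) \<longlonglongrightarrow> G (y0 + sqrt v0 * z) (\<lambda>i. \<beta> i \<omega>)"
          by (intro AE_I2 G_lim tendsto_intros LIMSEQ_Suc[OF lim_v] LIMSEQ_Suc[OF lim_\<beta>])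
      qed (use G1 \<beta>_meas in \<open>auto intro!: GM\<close>)
    qed
    show "(\<lambda>z. \<Phi> (y0 + sqrt v0 * z)) \<in> borel_measurable std_normal"
      using measurable_compose[OF _ \<Phi>_meas, of "\<lambda>z. y0 + sqrt v0 * z" lborel] by simp
    show "J (Suc N) \<in> borel_measurable std_normal" for N using J_meas by simp
    show "AE z in std_normal. norm (J (Suc N) z) \<le> 1" for N
      unfolding J_def using G1 by (intro AE_I2 int1)
  qed auto
  ultimately have "(\<integral>\<omega>. G (X t1 \<omega>) (\<lambda>i. \<beta> i \<omega>) \<partial>M) = (\<integral>z. \<Phi> (y0 + sqrt v0 * z) \<partial>std_normal)"
    unfolding split by (rule LIMSEQ_unique)
  moreover have "(\<integral>\<omega>. exp (\<Sum>i\<le>m. hh i (X (t1 + real i * h) \<omega>)) \<partial>M) = (\<integral>\<omega>. G (X t1 \<omega>) (\<lambda>i. \<beta> i \<omega>) \<partial>M)"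
    unfolding G_def
    by (intro Bochner_Integration.integral_cong refl arg_cong[where f = exp] sum.cong) (auto simp: X_eq)
  ultimately show "(\<integral>\<omega>. exp (\<Sum>i\<le>m. hh i (X (t1 + real i * h) \<omega>)) \<partial>M) =
      (\<integral>z. \<Phi> (exp (b * (t1 - t)) * x + a * expint b (t1 - t) + sqrt (c\<^sup>2 * expint (2 * b) (t1 - t)) * z) \<partial>std_normal)"
    unfolding y0_def v0_def by simp
qed

section \<open>Branches of the logarithm\<close>

text \<open>Two logarithms of the same number differ by a multiple of 2 pi i, so E has a discrete
  range with gaps of at least 2 pi, and a continuous map of this kind on a connected set is
  constant.\<close>

lemma continuous_exp_const_imp_constant:
  fixes E :: "'a::topological_space \<Rightarrow> complex"
  assumes "connected D" "continuous_on D E" "\<And>p. p \<in> D \<Longrightarrow> exp (E p) = K" "p \<in> D" "q \<in> D"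
  shows "E p = E q"
proof -
  have "E constant_on D"
  proof (rule continuous_discrete_range_constant[OF assms(1,2)])
    fix x assume x: "x \<in> D"
    have "2 * pi \<le> norm (E y - E x)" if "y \<in> D" "E y \<noteq> E x" for y
    proof (rule ccontr)
      assume "\<not> 2 * pi \<le> norm (E y - E x)"
      then have "\<bar>Im (E y) - Im (E x)\<bar> < 2 * pi" using abs_Im_le_cmod[of "E y - E x"] by simp
      moreover have "exp (E y) = exp (E x)" by (simp only: assms(3)[OF x] assms(3)[OF that(1)])
      ultimately have "E y = E x" by (rule exp_complex_eqI)
      then show False using that by simp
    qed
    then show "\<exists>e>0. \<forall>y. y \<in> D \<and> E y \<noteq> E x \<longrightarrow> e \<le> norm (E y - E x)"
      by (intro exI[of _ "2 * pi"]) (auto simp: pi_gt_zero)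
  qed
  then show ?thesis using assms(4,5) unfolding constant_on_def by auto
qed

section \<open>Identification with the semigroup and choice of the branch\<close>

context ou_semigroup
begin

lemma std_normal_integral_eq_U:
  assumes s: "s > 0"
  shows "(\<integral>z. g (exp (b * s) * x + a * expint b s + sqrt (c\<^sup>2 * expint (2 * b) s) * z) \<partial>std_normal) = U 0 s (of_real x)"
proof -
  define \<mu> where "\<mu> = exp (b * s) * x + a * expint b s"
  define \<sigma> where "\<sigma> = sqrt (var s)"
  have \<sigma>: "\<sigma> > 0" "\<sigma>\<^sup>2 = var s" using var_pos[OF s] by (simp_all add: \<sigma>_def)
  have m: "mean s (of_real x) = of_real \<mu>" by (simp add: mean_def \<mu>_def)
  have nd: "normal_density \<mu> \<sigma> y = sqrt (prec s / pi) * exp (- prec s * \<mu>\<^sup>2) * exp (y * (2 * prec s * \<mu>) - y\<^sup>2 * prec s)" for y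
  proof -
    have "1 / sqrt (2 * pi * \<sigma>\<^sup>2) = sqrt (prec s / pi)"
      unfolding \<sigma>(2) prec_def by (simp add: real_sqrt_divide real_sqrt_mult field_simps)
    moreover have "- (y - \<mu>)\<^sup>2 / (2 * \<sigma>\<^sup>2) = - prec s * \<mu>\<^sup>2 + (y * (2 * prec s * \<mu>) - y\<^sup>2 * prec s)"
      unfolding \<sigma>(2) prec_def using var_pos[OF s] by (simp add: field_simps power2_eq_square)
    ultimately show ?thesis unfolding normal_density_def by (simp only: exp_add mult.assoc)
  qed
  have gm: "(\<lambda>z. g (\<mu> + \<sigma> * z)) \<in> borel_measurable lborel"
    using measurable_compose[OF _ g_meas, of "\<lambda>z. \<mu> + \<sigma> * z" lborel] by simp
  have "(\<integral>z. g (\<mu> + \<sigma> * z) \<partial>std_normal) = (\<integral>z. std_normal_density z *\<^sub>R g (\<mu> + \<sigma> * z) \<partial>lborel)"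
    using gm by (subst integral_density) auto
  also have "\<dots> = (\<integral>z. \<sigma> *\<^sub>R (normal_density \<mu> \<sigma> (\<mu> + \<sigma> * z) *\<^sub>R g (\<mu> + \<sigma> * z)) \<partial>lborel)"
  proof -
    have "\<sigma> * normal_density \<mu> \<sigma> (\<mu> + \<sigma> * z) = std_normal_density z" for z
      using \<sigma>(1) by (simp add: normal_density_def real_sqrt_mult power_mult_distrib)
    then show ?thesis by simp
  qed
  also have "\<dots> = (\<integral>y. normal_density \<mu> \<sigma> y *\<^sub>R g y \<partial>lborel)"
    using lborel_integral_real_affine[of \<sigma> "\<lambda>y. normal_density \<mu> \<sigma> y *\<^sub>R g y" \<mu>] \<sigma>(1)
    by (simp only: integral_scaleR_right) simp
  also have "\<dots> = (\<integral>y. (of_real (sqrt (prec s / pi)) * exp (- of_real (prec s) * (of_real \<mu>)\<^sup>2)) *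
      (g y * of_real y ^ 0 * exp (of_real y * (2 * of_real (prec s) * of_real \<mu>) - of_real (y\<^sup>2 * prec s))) \<partial>lborel)"
    by (intro Bochner_Integration.integral_cong refl)
       (simp add: nd scaleR_conv_of_real flip: exp_of_real)
  also have "\<dots> = U 0 s (of_real x)"
    unfolding U_def gauss_moment_def m by (rule integral_mult_right_zero)
  finally show ?thesis unfolding \<mu>_def \<sigma>_def var_def .
qed

text \<open>Here s is the time left to the right end of the interval, so s = h is its left end,
  where only limits for fixed x are known. The difference of \<open>\<Lambda>\<close> and
  \<open>Ln\<close> of the quotient is constant on a rectangle in the open strip, and these limits
  carry the constant to s = h.\<close>

lemma log_branch:
  fixes \<Lambda> :: "real \<Rightarrow> real \<Rightarrow> complex"
  assumes h: "h > 0"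
    and cont: "continuous_on ({0<..<h} \<times> UNIV) (\<lambda>p. \<Lambda> (fst p) (snd p))"
    and exp: "\<And>s x. 0 < s \<Longrightarrow> s < h \<Longrightarrow> exp (\<Lambda> s x) = U 0 s (of_real x)"
    and lim: "\<And>x. ((\<lambda>s. \<Lambda> s x) \<longlongrightarrow> \<Lambda> h x) (at_left h)"
    and s0: "0 < s0" "s0 \<le> h"
  obtains d where "d > 0" "d \<le> s0" "U 0 s0 0 \<noteq> 0"
    "\<And>s z. \<bar>s - s0\<bar> < d \<Longrightarrow> cmod z < d \<Longrightarrow> Re (U 0 s z / U 0 s0 0) > 0"
    "\<And>s x. \<bar>s - s0\<bar> < d \<Longrightarrow> s \<le> h \<Longrightarrow> \<bar>x\<bar> < d \<Longrightarrow> \<Lambda> s x = \<Lambda> s0 0 + Ln (U 0 s (of_real x) / U 0 s0 0)"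
proof -
  have contU: "continuous_on {0<..} (\<lambda>s. U 0 s z)" for z
  proof -
    have "continuous_on {0<..} (\<lambda>s. (\<lambda>p. U 0 (fst p) (snd p)) (s, z))"
      by (rule continuous_on_compose2[OF continuous_on_U]) (auto intro!: continuous_intros)
    then show ?thesis by simp
  qed
  have limU: "((\<lambda>s. U 0 s z) \<longlongrightarrow> U 0 h z) (at_left h)" for z
  proof -
    have "isCont (\<lambda>s. U 0 s z) h" using contU[of z] h by (simp add: continuous_on_eq_continuous_at)
    then show ?thesis unfolding isCont_def by (rule filterlim_mono) (auto simp: at_within_le_at)
  qed
  have ev: "eventually (\<lambda>s. 0 < s \<and> s < h) (at_left h)"
    using eventually_at_left_real[OF h] by simp
  have exp_h: "exp (\<Lambda> h x) = U 0 h (of_real x)" for x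
  proof (rule tendsto_unique[OF trivial_limit_at_left_real])
    show "((\<lambda>s. exp (\<Lambda> s x)) \<longlongrightarrow> exp (\<Lambda> h x)) (at_left h)" by (intro tendsto_intros lim)
    have "eventually (\<lambda>s. U 0 s (of_real x) = exp (\<Lambda> s x)) (at_left h)"
      using ev by eventually_elim (simp add: exp)
    with limU[of "of_real x"] show "((\<lambda>s. exp (\<Lambda> s x)) \<longlongrightarrow> U 0 h (of_real x)) (at_left h)"
      by (rule Lim_transform_eventually)
  qed
  have exp': "exp (\<Lambda> s x) = U 0 s (of_real x)" if "0 < s" "s \<le> h" for s x
    using exp exp_h that by (cases "s = h") auto
  have nz: "U 0 s0 0 \<noteq> 0" using exp'[OF s0, of 0] by (metis exp_not_eq_zero of_real_0)
  obtain d where d: "d > 0" "d \<le> s0"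
    "\<And>s z. \<bar>s - s0\<bar> < d \<Longrightarrow> cmod z < d \<Longrightarrow> Re (U 0 s z / U 0 s0 0) > 0"
    using U_quotient_pos[OF s0(1) nz] by blast
  have npos: "U 0 s z / U 0 s0 0 \<notin> \<real>\<^sub>\<le>\<^sub>0" "U 0 s z \<noteq> 0" if "\<bar>s - s0\<bar> < d" "cmod z < d" for s z
    using d(3)[OF that] by (auto simp: complex_nonpos_Reals_iff)
  \<comment> \<open>Cutting at h keeps \<open>D\<close> inside the open strip where
    \<open>\<Lambda>\<close> is jointly continuous; a rectangle is convex, hence connected.\<close>
  define D where "D = {s0 - d<..<min (s0 + d) h} \<times> {-d<..<d}"
  define E where "E = (\<lambda>p. \<Lambda> (fst p) (snd p) - Ln (U 0 (fst p) (of_real (snd p)) / U 0 s0 0))"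
  have D: "\<bar>fst p - s0\<bar> < d" "fst p > 0" "fst p < h" "cmod (of_real (snd p)) < d" if "p \<in> D" for p
    using that d(2) unfolding D_def by (auto simp: mem_Times_iff)
  have conD: "connected D" unfolding D_def by (intro convex_connected convex_Times) auto
  have contE: "continuous_on D E"
  proof -
    have "continuous_on D (\<lambda>p. \<Lambda> (fst p) (snd p))"
      by (rule continuous_on_subset[OF cont]) (use D in \<open>auto simp: mem_Times_iff\<close>)
    moreover have "continuous_on D (\<lambda>p. (\<lambda>q. U 0 (fst q) (snd q)) (fst p, of_real (snd p)))"
      by (rule continuous_on_compose2[OF continuous_on_U])
         (use D in \<open>auto intro!: continuous_intros\<close>)
    ultimately show ?thesis
      unfolding E_def using npos D nz by (intro continuous_intros) auto
  qed
  have expE: "exp (E p) = U 0 s0 0" if "p \<in> D" for p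
    using npos[OF D(1)[OF that] D(4)[OF that]] exp[OF D(2)[OF that] D(3)[OF that], of "snd p"] nz
    unfolding E_def by (simp add: exp_diff exp_Ln)
  have constE: "E p = E q" if "p \<in> D" "q \<in> D" for p q
    by (rule continuous_exp_const_imp_constant[OF conD contE expE that])
  have limLn: "((\<lambda>s. Ln (U 0 s (of_real x) / U 0 s0 0)) \<longlongrightarrow> Ln (U 0 h (of_real x) / U 0 s0 0)) (at_left h)"
    if "\<bar>h - s0\<bar> < d" "\<bar>x\<bar> < d" for x
    by (intro tendsto_Ln tendsto_divide limU tendsto_const nz npos) (use that in auto)
  have evD: "eventually (\<lambda>s. (s, x) \<in> D) (at_left h)" if "\<bar>h - s0\<bar> < d" "\<bar>x\<bar> < d" for x
  proof -
    have "s0 - d < h" using that by auto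
    from eventually_at_left_real[OF this] show ?thesis
      by eventually_elim (use that in \<open>auto simp: D_def\<close>)
  qed
  have E_h: "E p = \<Lambda> h x - Ln (U 0 h (of_real x) / U 0 s0 0)"
    if "p \<in> D" "\<bar>h - s0\<bar> < d" "\<bar>x\<bar> < d" for p x
  proof (rule tendsto_unique[OF trivial_limit_at_left_real])
    show "((\<lambda>s. \<Lambda> s x - Ln (U 0 s (of_real x) / U 0 s0 0)) \<longlongrightarrow> \<Lambda> h x - Ln (U 0 h (of_real x) / U 0 s0 0)) (at_left h)"
      by (intro tendsto_diff lim limLn that)
    have "eventually (\<lambda>s. E p = \<Lambda> s x - Ln (U 0 s (of_real x) / U 0 s0 0)) (at_left h)"
      using evD[OF that(2,3)]
    proof eventually_elim
      case (elim s)
      have "E p = E (s, x)" by (rule constE[OF that(1) elim])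
      also have "\<dots> = \<Lambda> s x - Ln (U 0 s (of_real x) / U 0 s0 0)" by (simp add: E_def)
      finally show ?case .
    qed
    then show "((\<lambda>s. \<Lambda> s x - Ln (U 0 s (of_real x) / U 0 s0 0)) \<longlongrightarrow> E p) (at_left h)"
      by (rule Lim_transform_eventually[OF tendsto_const])
  qed
  \<comment> \<open>For s0 = h the point (s0, 0) is not in \<open>D\<close>, so the constant is
    found from the limit; otherwise it is read off at (s0, 0). In both cases the quotient there is 1
    and Ln 1 = 0.\<close>
  have E_eq: "E p = \<Lambda> s0 0" if "p \<in> D" for p
  proof (cases "s0 = h")
    case True
    then show ?thesis using E_h[OF that, of 0] d nz by simp
  next
    case False
    then have "(s0, 0) \<in> D" using s0 d(1) by (auto simp: D_def)
    from constE[OF that this] show ?thesis using nz by (simp add: E_def)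
  qed
  have D_ne: "\<exists>p. p \<in> D"
    using d s0 by (intro exI[of _ "(s0 - d / 2, 0)"]) (auto simp: D_def)
  show ?thesis
  proof (rule that[OF d(1,2) nz d(3)])
    fix s x assume s: "\<bar>s - s0\<bar> < d" "s \<le> h" "\<bar>x\<bar> < d"
    show "\<Lambda> s x = \<Lambda> s0 0 + Ln (U 0 s (of_real x) / U 0 s0 0)"
    proof (cases "s = h")
      case True
      obtain p where "p \<in> D" using D_ne by blast
      from E_h[OF this, of x] E_eq[OF this] s True show ?thesis by simp
    next
      case False
      then have "(s, x) \<in> D" using s by (auto simp: D_def)
      from E_eq[OF this] show ?thesis by (simp add: E_def algebra_simps)
    qed
  qed
qed

end

text \<open>Coefficient k of (a + b x) phi' + (c^2/2) (phi'' + phi'^2), the generator after the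
  substitution F = exp phi. Entry 0 of the argument occurs only for k = 0, with the factor b k =
  0.\<close>

definition riccati :: "real \<Rightarrow> real \<Rightarrow> real \<Rightarrow> (nat \<Rightarrow> complex) \<Rightarrow> nat \<Rightarrow> complex" where
  "riccati a b c \<Phi> k = complex_of_real (b * real k) * \<Phi> k
     + complex_of_real (a * real (k + 1)) * \<Phi> (k + 1)
     + complex_of_real (c\<^sup>2 * real (k + 2) * real (k + 1) / 2) * \<Phi> (k + 2)
     + complex_of_real (c\<^sup>2 / 2) *
         conv (\<lambda>k. of_nat (k + 1) * \<Phi> (k + 1)) (\<lambda>k. of_nat (k + 1) * \<Phi> (k + 1)) k"

text \<open>A holomorphic extension gives meaning to all orders of \<open>xderiv\<close> at 0 at
  once, and lets sums and multiples be differentiated by the complex rules.\<close>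

definition analytic_at_0 :: "(real \<Rightarrow> complex) \<Rightarrow> bool" where
  "analytic_at_0 h \<longleftrightarrow> (\<exists>S H. open S \<and> 0 \<in> S \<and> H holomorphic_on S \<and> (\<forall>x. of_real x \<in> S \<longrightarrow> h x = H (of_real x)))"

lemma analytic_at_0_differentiable: "analytic_at_0 h \<Longrightarrow> xderiv k h differentiable (at 0)"
  unfolding analytic_at_0_def using xderiv_of_holomorphic(2)[of _ _ h 0 k] by auto

lemma analytic_at_0_add:
  assumes "analytic_at_0 h1" "analytic_at_0 h2"
  shows "analytic_at_0 (\<lambda>x. h1 x + h2 x)" "xderiv k (\<lambda>x. h1 x + h2 x) 0 = xderiv k h1 0 + xderiv k h2 0"
proof -
  obtain S1 H1 where 1: "open S1" "0 \<in> S1" "H1 holomorphic_on S1" "\<And>x. of_real x \<in> S1 \<Longrightarrow> h1 x = H1 (of_real x)"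
    using assms(1) unfolding analytic_at_0_def by blast
  obtain S2 H2 where 2: "open S2" "0 \<in> S2" "H2 holomorphic_on S2" "\<And>x. of_real x \<in> S2 \<Longrightarrow> h2 x = H2 (of_real x)"
    using assms(2) unfolding analytic_at_0_def by blast
  let ?S = "S1 \<inter> S2"
  have S: "open ?S" "0 \<in> ?S" "H1 holomorphic_on ?S" "H2 holomorphic_on ?S"
    using 1 2 by (auto intro: holomorphic_on_subset)
  then have hol: "(\<lambda>z. H1 z + H2 z) holomorphic_on ?S" by (intro holomorphic_intros)
  have eq: "h1 x + h2 x = H1 (of_real x) + H2 (of_real x)" if "of_real x \<in> ?S" for x
    using 1(4) 2(4) that by simp
  show "analytic_at_0 (\<lambda>x. h1 x + h2 x)"
    unfolding analytic_at_0_def using S hol eq by blast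
  have "xderiv k (\<lambda>x. h1 x + h2 x) 0 = (deriv ^^ k) (\<lambda>z. H1 z + H2 z) 0"
    using xderiv_of_holomorphic(1)[OF hol S(1) eq, of 0 k] S(2) by simp
  also have "\<dots> = (deriv ^^ k) H1 0 + (deriv ^^ k) H2 0"
    by (rule higher_deriv_add[OF S(3,4,1,2)])
  also have "\<dots> = xderiv k h1 0 + xderiv k h2 0"
    using xderiv_of_holomorphic(1)[OF 1(3,1,4), of 0 k] xderiv_of_holomorphic(1)[OF 2(3,1,4), of 0 k] 1(2) 2(2) by simp
  finally show "xderiv k (\<lambda>x. h1 x + h2 x) 0 = xderiv k h1 0 + xderiv k h2 0" .
qed

lemma analytic_at_0_cmult:
  assumes "analytic_at_0 h"
  shows "analytic_at_0 (\<lambda>x. C * h x)" "xderiv k (\<lambda>x. C * h x) 0 = C * xderiv k h 0"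
proof -
  obtain S H where 1: "open S" "0 \<in> S" "H holomorphic_on S" "\<And>x. of_real x \<in> S \<Longrightarrow> h x = H (of_real x)"
    using assms unfolding analytic_at_0_def by blast
  have hol: "(\<lambda>z. C * H z) holomorphic_on S" by (intro holomorphic_intros 1)
  have eq: "C * h x = C * H (of_real x)" if "of_real x \<in> S" for x using 1(4)[OF that] by simp
  show "analytic_at_0 (\<lambda>x. C * h x)" unfolding analytic_at_0_def using 1 hol eq by blast
  show "xderiv k (\<lambda>x. C * h x) 0 = C * xderiv k h 0"
    using xderiv_of_holomorphic(1)[OF hol 1(1) eq, of 0 k] xderiv_of_holomorphic(1)[OF 1(3,1,4), of 0 k]
      higher_deriv_cmult[OF 1(3,2,1), of k C] 1(2) by simp
qed

context ou_semigroup
begin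

text \<open>Near every s0, s0 = h included, \<open>\<Lambda>\<close> is a constant plus the
  principal logarithm. The constant changes with s0 but enters coefficient 0 only, to which
  \<open>riccati\<close> is blind.\<close>

lemma log_branch_coeffs:
  fixes \<Lambda> :: "real \<Rightarrow> real \<Rightarrow> complex"
  assumes h: "h > 0"
    and cont: "continuous_on ({0<..<h} \<times> UNIV) (\<lambda>p. \<Lambda> (fst p) (snd p))"
    and exp: "\<And>s x. 0 < s \<Longrightarrow> s < h \<Longrightarrow> exp (\<Lambda> s x) = U 0 s (of_real x)"
    and lim: "\<And>x. ((\<lambda>s. \<Lambda> s x) \<longlongrightarrow> \<Lambda> h x) (at_left h)"
  defines "\<Phi> \<equiv> \<lambda>s k. xderiv k (\<Lambda> s) 0 / of_nat (fact k)"
  shows "0 < s \<Longrightarrow> s \<le> h \<Longrightarrow> analytic_at_0 (\<Lambda> s)"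
    and "0 < s \<Longrightarrow> s < h \<Longrightarrow> ((\<lambda>s. \<Phi> s k) has_vector_derivative riccati a b c (\<Phi> s) k) (at s)"
    and "((\<lambda>s. \<Phi> s k) \<longlongrightarrow> \<Phi> h k) (at_left h)"
proof -
  \<comment> \<open>For s0 = h the functions \<open>\<psi>\<close> are differentiable on both sides
    of h, although the comparison with \<open>\<Phi>\<close> stops at h; their continuity then
    yields the left limit.\<close>
  have local: "\<exists>d>0. \<exists>\<psi> C. analytic_at_0 (\<Lambda> s0) \<and>
      (\<forall>s. \<bar>s - s0\<bar> < d \<longrightarrow> s \<le> h \<longrightarrow> (\<forall>k. \<Phi> s k = \<psi> k s + (if k = 0 then C else 0))) \<and>
      (\<forall>k. (\<psi> k has_vector_derivative riccati a b c (\<lambda>k. \<psi> k s0) k) (at s0))"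
    if s0: "0 < s0" "s0 \<le> h" for s0
  proof -
    obtain d where d: "d > 0" "d \<le> s0" and nz: "U 0 s0 0 \<noteq> 0"
      and pos: "\<And>s z. \<bar>s - s0\<bar> < d \<Longrightarrow> cmod z < d \<Longrightarrow> Re (U 0 s z / U 0 s0 0) > 0"
      and \<Lambda>: "\<And>s x. \<bar>s - s0\<bar> < d \<Longrightarrow> s \<le> h \<Longrightarrow> \<bar>x\<bar> < d \<Longrightarrow> \<Lambda> s x = \<Lambda> s0 0 + Ln (U 0 s (of_real x) / U 0 s0 0)"
      using log_branch[OF h cont exp lim s0] by blast
    define \<psi> where "\<psi> = (\<lambda>k s. (deriv ^^ k) (\<lambda>z. Ln (U 0 s z / U 0 s0 0)) 0 / fact k)"
    have hol: "(\<lambda>z. Ln (U 0 s z / U 0 s0 0)) holomorphic_on ball 0 d" if "\<bar>s - s0\<bar> < d" for s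
      using pos[OF that] nz that d
      by (intro holomorphic_on_Ln' holomorphic_intros holomorphic_U) (force simp: complex_nonpos_Reals_iff)+
    have eq: "\<Lambda> s x = \<Lambda> s0 0 + Ln (U 0 s (of_real x) / U 0 s0 0)"
      if "\<bar>s - s0\<bar> < d" "s \<le> h" "of_real x \<in> ball (0::complex) d" for s x
      using \<Lambda>[OF that(1,2)] that(3) by simp
    have hol': "(\<lambda>z. \<Lambda> s0 0 + Ln (U 0 s z / U 0 s0 0)) holomorphic_on ball 0 d" if "\<bar>s - s0\<bar> < d" for s
      by (intro holomorphic_intros hol that)
    have "analytic_at_0 (\<Lambda> s0)"
      unfolding analytic_at_0_def
    proof (intro exI conjI allI impI)
      show "(\<lambda>z. \<Lambda> s0 0 + Ln (U 0 s0 z / U 0 s0 0)) holomorphic_on ball 0 d" using d by (intro hol') simp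
      show "\<Lambda> s0 x = \<Lambda> s0 0 + Ln (U 0 s0 (of_real x) / U 0 s0 0)" if "of_real x \<in> ball (0::complex) d" for x
        using d s0 that by (intro eq) simp_all
    qed (use d in auto)
    moreover have "\<Phi> s k = \<psi> k s + (if k = 0 then \<Lambda> s0 0 else 0)" if "\<bar>s - s0\<bar> < d" "s \<le> h" for s k
    proof -
      have "xderiv k (\<Lambda> s) 0 = (deriv ^^ k) (\<lambda>z. \<Lambda> s0 0 + Ln (U 0 s z / U 0 s0 0)) 0"
        using xderiv_of_holomorphic(1)[OF hol'[OF that(1)] open_ball eq[OF that], of 0 k] d by simp
      also have "\<dots> = (deriv ^^ k) (\<lambda>z. \<Lambda> s0 0) 0 + (deriv ^^ k) (\<lambda>z. Ln (U 0 s z / U 0 s0 0)) 0"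
        by (rule higher_deriv_add[OF _ hol[OF that(1)]]) (use d in auto)
      also have "(deriv ^^ k) (\<lambda>z. \<Lambda> s0 0) 0 = (if k = 0 then \<Lambda> s0 0 else 0)" by simp
      finally show ?thesis by (simp add: \<Phi>_def \<psi>_def add_divide_distrib)
    qed
    moreover have "(\<psi> k has_vector_derivative riccati a b c (\<lambda>k. \<psi> k s0) k) (at s0)" for k
      using log_U_ode[OF d nz pos, of s0 k] d(1) unfolding riccati_def \<psi>_def by simp
    ultimately show ?thesis using d(1) by blast
  qed
  show "analytic_at_0 (\<Lambda> s)" if "0 < s" "s \<le> h" using local[OF that] by blast
  show "((\<lambda>s. \<Phi> s k) has_vector_derivative riccati a b c (\<Phi> s) k) (at s)" if s: "0 < s" "s < h"
  proof -
    obtain d \<psi> C where d: "d > 0"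
      and \<Phi>: "\<And>s' k. \<bar>s' - s\<bar> < d \<Longrightarrow> s' \<le> h \<Longrightarrow> \<Phi> s' k = \<psi> k s' + (if k = 0 then C else 0)"
      and \<psi>: "\<And>k. (\<psi> k has_vector_derivative riccati a b c (\<lambda>k. \<psi> k s) k) (at s)"
      using local[OF s(1) less_imp_le[OF s(2)]] by blast
    have \<Phi>s: "\<Phi> s k = \<psi> k s + (if k = 0 then C else 0)" for k using \<Phi>[of s k] d s by simp
    have ric: "riccati a b c (\<Phi> s) k = riccati a b c (\<lambda>k. \<psi> k s) k"
      unfolding riccati_def \<Phi>s by simp
    have "((\<lambda>s. \<psi> k s + (if k = 0 then C else 0)) has_vector_derivative riccati a b c (\<lambda>k. \<psi> k s) k) (at s)"
      using has_vector_derivative_add[OF \<psi> has_vector_derivative_const] by simp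
    then show ?thesis unfolding ric
      by (rule has_vector_derivative_transform_within_open[of _ _ _ "{s - d<..<min (s + d) h}"])
         (use s d \<Phi> in auto)
  qed
  show "((\<lambda>s. \<Phi> s k) \<longlongrightarrow> \<Phi> h k) (at_left h)"
  proof -
    obtain d \<psi> C where d: "d > 0"
      and \<Phi>: "\<And>s' k. \<bar>s' - h\<bar> < d \<Longrightarrow> s' \<le> h \<Longrightarrow> \<Phi> s' k = \<psi> k s' + (if k = 0 then C else 0)"
      and \<psi>: "\<And>k. (\<psi> k has_vector_derivative riccati a b c (\<lambda>k. \<psi> k h) k) (at h)"
      using local[OF h order_refl] by blast
    have "isCont (\<psi> k) h" using \<psi>[of k] has_vector_derivative_continuous by blast
    then have "(\<psi> k \<longlongrightarrow> \<psi> k h) (at_left h)"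
      unfolding isCont_def by (rule filterlim_mono) (auto simp: at_within_le_at)
    then have "((\<lambda>s. \<psi> k s + (if k = 0 then C else 0)) \<longlongrightarrow> \<Phi> h k) (at_left h)"
      using \<Phi>[of h k] d by (auto intro!: tendsto_intros)
    moreover have "eventually (\<lambda>s. \<psi> k s + (if k = 0 then C else 0) = \<Phi> s k) (at_left h)"
      using eventually_at_left_real[of "h - d" h] d by (auto elim!: eventually_mono simp: \<Phi>)
    ultimately show ?thesis by (rule Lim_transform_eventually)
  qed
qed

end

text \<open>Covers one interval between atoms: \<open>g\<close> is the expectation from the right
  end t1 on, with the term at t1 included, and time is reversed to s = t1 - t. The function
  \<open>l\<close> is the right limit at t0, which a jump separates from
  \<open>L t0\<close>.\<close>

lemma log_expectation_step:
  fixes W :: "real \<Rightarrow> 'a \<Rightarrow> real" and Xf :: "real \<Rightarrow> real \<Rightarrow> real \<Rightarrow> 'a \<Rightarrow> real"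
    and hh :: "nat \<Rightarrow> real \<Rightarrow> complex" and m :: nat and L :: "real \<Rightarrow> real \<Rightarrow> complex"
  assumes BM: "brownian_motion M W" and t0: "0 \<le> t0" "h > 0" and c: "c \<noteq> 0"
    and flow: "\<And>t x \<omega>. \<omega> \<in> space M \<Longrightarrow> t \<in> {t0<..t0 + h} \<Longrightarrow>
       continuous_on {t..t0 + h + real m * h} (\<lambda>s. Xf t x s \<omega>) \<and>
       (\<forall>s\<in>{t..t0 + h + real m * h}.
          Xf t x s \<omega> = x + integral {t..s} (\<lambda>r. a + b * Xf t x r \<omega>) + c * (W s \<omega> - W t \<omega>))"
    and hh: "\<And>i. i \<le> m \<Longrightarrow> continuous_on UNIV (hh i)" "\<And>i y. i \<le> m \<Longrightarrow> Re (hh i y) \<le> 0"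
    and L_log: "\<And>t x. t \<in> {t0<..t0 + h} \<Longrightarrow>
       exp (L t x) = (\<integral>\<omega>. exp (\<Sum>i\<le>m. hh i (Xf t x (t0 + h + real i * h) \<omega>)) \<partial>M)"
    and L_cont: "continuous_on ({t0<..t0 + h} \<times> UNIV) (\<lambda>(t, x). L t x)"
    and L_lim: "\<And>x. ((\<lambda>s. L s x) \<longlongrightarrow> l x) (at_right t0)"
  defines "\<Phi> \<equiv> \<lambda>t k. xderiv k (L t) 0 / of_nat (fact k)"
  shows "t0 < t \<Longrightarrow> t < t0 + h \<Longrightarrow> analytic_at_0 (L t)"
    and "analytic_at_0 l"
    and "t0 < t \<Longrightarrow> t < t0 + h \<Longrightarrow>
       ((\<lambda>t. \<Phi> t k) has_vector_derivative - riccati a b c (\<Phi> t) k) (at t)"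
    and "((\<lambda>t. \<Phi> t k) \<longlongrightarrow> xderiv k l 0 / of_nat (fact k)) (at_right t0)"
proof -
  define t1 where "t1 = t0 + h"
  define g where "g = (\<lambda>y. \<integral>\<omega>. exp (\<Sum>i\<le>m. hh i (Xf t1 y (t1 + real i * h) \<omega>)) \<partial>M)"
  have t01: "t0 < t1" "0 \<le> t1" using t0 by (auto simp: t1_def)
  have flow1: "continuous_on {t1..t1 + real m * h} (\<lambda>s. Xf t1 y s \<omega>) \<and>
       (\<forall>s\<in>{t1..t1 + real m * h}. Xf t1 y s \<omega> = y + integral {t1..s} (\<lambda>r. a + b * Xf t1 y r \<omega>) + c * (W s \<omega> - W t1 \<omega>))"
    if "\<omega> \<in> space M" for y \<omega>
    using flow[OF that, of t1 y] t0 unfolding t1_def by simp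
  have flowt: "continuous_on {t..t1 + real m * h} (\<lambda>s. Xf t x s \<omega>) \<and>
       (\<forall>s\<in>{t..t1 + real m * h}. Xf t x s \<omega> = x + integral {t..s} (\<lambda>r. a + b * Xf t x r \<omega>) + c * (W s \<omega> - W t \<omega>))"
    if "\<omega> \<in> space M" "t0 < t" "t < t1" for t x \<omega>
    using flow[OF that(1), of t x] that(2,3) unfolding t1_def by simp
  have mk: "exp (L t x) = (\<integral>z. g (exp (b * (t1 - t)) * x + a * expint b (t1 - t) + sqrt (c\<^sup>2 * expint (2 * b) (t1 - t)) * z) \<partial>std_normal)"
    if t: "t0 < t" "t < t1" for t x
  proof -
    have "exp (L t x) = (\<integral>\<omega>. exp (\<Sum>i\<le>m. hh i (Xf t x (t1 + real i * h) \<omega>)) \<partial>M)"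
      using L_log[of t x] t unfolding t1_def by simp
    also have "\<dots> = (\<integral>z. g (exp (b * (t1 - t)) * x + a * expint b (t1 - t) + sqrt (c\<^sup>2 * expint (2 * b) (t1 - t)) * z) \<partial>std_normal)"
      unfolding g_def
      by (rule ou_markov(1)[where X = "Xf t x" and Y = "Xf t1", OF BM _ t(2) t0(2) c flowt[OF _ t] flow1 hh])
         (use t t0 in auto)
    finally show ?thesis .
  qed
  \<comment> \<open>\<open>g\<close> concerns t1 only, but \<open>ou_markov\<close> also asks for a
    process started before t1; the midpoint is such a starting time.\<close>
  define tm where "tm = (t0 + t1) / 2"
  have tm: "t0 < tm" "tm < t1" "0 \<le> tm" using t01 t0 by (auto simp: tm_def)
  interpret ou_semigroup a b c g
  proof
    show "g \<in> borel_measurable borel" unfolding g_def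
      by (rule ou_markov(2)[where X = "Xf tm 0" and Y = "Xf t1", OF BM tm(3,2) t0(2) c flowt[OF _ tm(1,2)] flow1 hh])
    show "norm (g y) \<le> 1" for y unfolding g_def
      by (rule ou_markov(3)[where X = "Xf tm 0" and Y = "Xf t1", OF BM tm(3,2) t0(2) c flowt[OF _ tm(1,2)] flow1 hh])
  qed (rule c)
  \<comment> \<open>At s = h the value is the limit \<open>l\<close>, not \<open>L t0\<close>, which
    makes \<open>\<Lambda>\<close> left continuous there.\<close>
  define \<Lambda> where "\<Lambda> = (\<lambda>s x. if s = h then l x else L (t1 - s) x)"
  have \<Lambda>L: "\<Lambda> (t1 - t) = L t" if "t \<noteq> t0" for t using that by (auto simp: \<Lambda>_def t1_def fun_eq_iff)
  have \<Lambda>h: "\<Lambda> h = l" by (simp add: \<Lambda>_def fun_eq_iff)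
  have cont: "continuous_on ({0<..<h} \<times> UNIV) (\<lambda>p. \<Lambda> (fst p) (snd p))"
  proof -
    have "continuous_on ({0<..<h} \<times> UNIV) (\<lambda>p. (\<lambda>(t, x). L t x) (t1 - fst p, snd p))"
      by (rule continuous_on_compose2[OF L_cont]) (auto intro!: continuous_intros simp: t1_def)
    then show ?thesis by (rule continuous_on_eq) (auto simp: \<Lambda>_def)
  qed
  have exp: "exp (\<Lambda> s x) = U 0 s (of_real x)" if "0 < s" "s < h" for s x
    using mk[of "t1 - s" x] std_normal_integral_eq_U[of s x] that by (simp add: \<Lambda>_def t1_def)
  have fl: "filterlim (\<lambda>s. t1 - s) (at_right t0) (at_left h)"
  proof -
    have "((\<lambda>s. t1 - s) \<longlongrightarrow> t1 - h) (at_left h)" by (intro tendsto_intros)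
    moreover have "eventually (\<lambda>s. t1 - s \<in> {t0<..} \<and> t1 - s \<noteq> t0) (at_left h)"
      by (auto simp: eventually_at_filter t1_def)
    ultimately show ?thesis by (simp add: filterlim_at t1_def)
  qed
  have lim: "((\<lambda>s. \<Lambda> s x) \<longlongrightarrow> \<Lambda> h x) (at_left h)" for x
  proof -
    have "((\<lambda>s. L (t1 - s) x) \<longlongrightarrow> \<Lambda> h x) (at_left h)"
      unfolding \<Lambda>h by (rule filterlim_compose[OF L_lim fl])
    moreover have "eventually (\<lambda>s. L (t1 - s) x = \<Lambda> s x) (at_left h)"
      by (auto simp: eventually_at_filter \<Lambda>_def)
    ultimately show ?thesis by (rule Lim_transform_eventually)
  qed
  note * = log_branch_coeffs[OF t0(2) cont exp lim]
  show "analytic_at_0 (L t)" if "t0 < t" "t < t0 + h"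
    using *(1)[of "t1 - t"] that unfolding t1_def by (simp add: \<Lambda>L[unfolded t1_def])
  show "analytic_at_0 l" using *(1)[OF _ _ t0(2) order_refl] by (simp add: \<Lambda>h)
  show "((\<lambda>t. \<Phi> t k) has_vector_derivative - riccati a b c (\<Phi> t) k) (at t)" if t: "t0 < t" "t < t0 + h"
  proof -
    have "((\<lambda>s. xderiv k (\<Lambda> s) 0 / of_nat (fact k)) has_vector_derivative riccati a b c (\<Phi> t) k) (at (t1 - t))"
      using *(2)[of "t1 - t" k] t unfolding \<Phi>_def by (simp add: \<Lambda>L) (simp add: t1_def)
    moreover have "((\<lambda>t. t1 - t) has_vector_derivative -1) (at t)"
      by (auto intro!: derivative_eq_intros simp: has_real_derivative_iff_has_vector_derivative[symmetric])
    ultimately have "((\<lambda>s. xderiv k (\<Lambda> s) 0 / of_nat (fact k)) \<circ> (\<lambda>t. t1 - t) has_vector_derivative -1 *\<^sub>R riccati a b c (\<Phi> t) k) (at t)"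
      by (intro vector_diff_chain_at)
    then have "((\<lambda>t. xderiv k (\<Lambda> (t1 - t)) 0 / of_nat (fact k)) has_vector_derivative - riccati a b c (\<Phi> t) k) (at t)"
      by (simp add: o_def)
    then show ?thesis
      by (rule has_vector_derivative_transform_within_open[of _ _ _ "{t0<..}"])
         (use t in \<open>auto simp: \<Phi>_def \<Lambda>L\<close>)
  qed
  show "((\<lambda>t. \<Phi> t k) \<longlongrightarrow> xderiv k l 0 / of_nat (fact k)) (at_right t0)"
  proof -
    have "filterlim (\<lambda>t. t1 - t) (at_left h) (at_right t0)"
    proof -
      have "((\<lambda>t. t1 - t) \<longlongrightarrow> t1 - t0) (at_right t0)" by (intro tendsto_intros)
      moreover have "eventually (\<lambda>t. t1 - t \<in> {..<h} \<and> t1 - t \<noteq> h) (at_right t0)"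
        by (auto simp: eventually_at_filter t1_def)
      ultimately show ?thesis by (simp add: filterlim_at t1_def)
    qed
    moreover have "((\<lambda>s. xderiv k (\<Lambda> s) 0 / of_nat (fact k)) \<longlongrightarrow> xderiv k (\<Lambda> h) 0 / of_nat (fact k)) (at_left h)"
      using *(3)[of k] by blast
    ultimately
    have "((\<lambda>t. xderiv k (\<Lambda> (t1 - t)) 0 / of_nat (fact k)) \<longlongrightarrow> xderiv k l 0 / of_nat (fact k)) (at_right t0)"
      unfolding \<Lambda>h using filterlim_compose by blast
    moreover have "eventually (\<lambda>t. xderiv k (\<Lambda> (t1 - t)) 0 / of_nat (fact k) = \<Phi> t k) (at_right t0)"
      by (auto simp: eventually_at_filter \<Phi>_def \<Lambda>L)
    ultimately show ?thesis by (rule Lim_transform_eventually)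
  qed
qed

section \<open>Entire power series\<close>

definition cfps :: "(nat \<Rightarrow> real) \<Rightarrow> complex fps" where
  "cfps p = Abs_fps (\<lambda>k. complex_of_real (p k))"

lemma dfact_ge_1: "dfact k \<ge> 1"
  by (induction k rule: dfact.induct) auto

text \<open>Double factorials are at least 1, so the k-th roots of the coefficients tend to 0; for
  given z the series is compared with a geometric one of ratio 1/2, which is how \<open>e\<close> is
  chosen.\<close>

lemma negligible_dfact_imp_entire:
  assumes "negligible_dfact p"
  shows "fps_conv_radius (cfps p) = \<infinity>"
  unfolding fps_conv_radius_def
proof (rule conv_radius_inftyI'')
  fix z :: complex
  define e where "e = 1 / (2 * (norm z + 1))"
  have e: "e > 0" "e * norm z \<le> 1 / 2" unfolding e_def by (auto simp: field_simps add_pos_nonneg)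
  have "eventually (\<lambda>k. ereal (root k (\<bar>p k\<bar> * real (dfact (k - 1)))) < ereal e) sequentially"
    by (rule Limsup_lessD) (use assms e in \<open>simp add: negligible_dfact_def\<close>)
  then have "eventually (\<lambda>k. norm (fps_nth (cfps p) k * z ^ k) \<le> (1 / 2) ^ k) sequentially"
    \<comment> \<open>\<open>root 0\<close> is the zero function, so taking the k-th power undoes
      the root only for k > 0.\<close>
    using eventually_gt_at_top[of 0]
  proof eventually_elim
    case (elim k)
    have "\<bar>p k\<bar> * 1 \<le> \<bar>p k\<bar> * real (dfact (k - 1))"
      using dfact_ge_1[of "k - 1"] by (intro mult_left_mono) auto
    also have "\<dots> = root k (\<bar>p k\<bar> * real (dfact (k - 1))) ^ k" using elim by simp
    also have "\<dots> \<le> e ^ k" using elim by (intro power_mono) auto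
    finally have "\<bar>p k\<bar> \<le> e ^ k" by simp
    then have "norm (fps_nth (cfps p) k * z ^ k) \<le> e ^ k * norm z ^ k"
      by (simp add: cfps_def norm_mult norm_power mult_right_mono)
    also have "\<dots> = (e * norm z) ^ k" by (simp add: power_mult_distrib)
    also have "\<dots> \<le> (1 / 2) ^ k" using e by (intro power_mono) auto
    finally show ?case .
  qed
  then show "summable (\<lambda>k. fps_nth (cfps p) k * z ^ k)"
    by (rule summable_comparison_test_ev) (simp add: summable_geometric)
qed

lemma cfps_conv: "cfps (conv p q) = cfps p * cfps q"
  by (rule fps_ext) (simp add: cfps_def conv_def fps_mult_nth atMost_atLeast0)

lemma conv_entire:
  assumes "fps_conv_radius (cfps p) = \<infinity>"
  shows "fps_conv_radius (cfps (conv p p)) = \<infinity>"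
  using fps_conv_radius_mult[of "cfps p" "cfps p"] assms unfolding cfps_conv by simp

lemma of_real_ps:
  assumes "fps_conv_radius (cfps p) = \<infinity>"
  shows "complex_of_real (ps p x) = eval_fps (cfps p) (of_real x)"
proof -
  have s: "summable (\<lambda>k. fps_nth (cfps p) k * of_real x ^ k)"
    using assms by (intro summable_fps) auto
  have eq: "fps_nth (cfps p) k * of_real x ^ k = complex_of_real (p k * x ^ k)" for k
    by (simp add: cfps_def)
  have "summable (\<lambda>k. p k * x ^ k)"
    using s unfolding eq summable_complex_of_real .
  then show ?thesis
    unfolding ps_def eval_fps_def eq by (rule suminf_of_real)
qed

lemma analytic_at_0_ps:
  assumes "fps_conv_radius (cfps p) = \<infinity>"
  shows "analytic_at_0 (\<lambda>x. complex_of_real (ps p x))"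
    and "xderiv k (\<lambda>x. complex_of_real (ps p x)) 0 = of_nat (fact k) * complex_of_real (p k)"
proof -
  have hol: "eval_fps (cfps p) holomorphic_on UNIV"
    using assms by (intro holomorphic_on_eval_fps) auto
  note eq = of_real_ps[OF assms]
  show "analytic_at_0 (\<lambda>x. complex_of_real (ps p x))"
    unfolding analytic_at_0_def using hol eq by (intro exI[of _ UNIV] exI[of _ "eval_fps (cfps p)"]) auto
  have "xderiv k (\<lambda>x. complex_of_real (ps p x)) 0 = (deriv ^^ k) (eval_fps (cfps p)) 0"
    using xderiv_of_holomorphic(1)[OF hol open_UNIV eq, of 0 k] by simp
  moreover have "fps_nth (cfps p) k = (deriv ^^ k) (eval_fps (cfps p)) 0 / fact k"
    by (rule fps_nth_fps_expansion[OF eval_fps_has_fps_expansion]) (use assms in auto)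
  ultimately show "xderiv k (\<lambda>x. complex_of_real (ps p x)) 0 = of_nat (fact k) * complex_of_real (p k)"
    by (simp add: cfps_def)
qed

lemma continuous_on_of_real_ps:
  assumes "fps_conv_radius (cfps p) = \<infinity>"
  shows "continuous_on A (\<lambda>x. complex_of_real (ps p x))"
  unfolding of_real_ps[OF assms]
  by (intro continuous_on_compose2[OF continuous_on_eval_fps] continuous_intros) (use assms in auto)

text \<open>The coefficients of p are real, so on the real line this is the square of
  \<open>ps p\<close>. Together with Re u1 <= 0 it gives every term of the exponent a nonpositive
  real part.\<close>

lemma ps_conv_self_nonneg:
  assumes "fps_conv_radius (cfps p) = \<infinity>"
  shows "ps (conv p p) x \<ge> 0"
proof -
  have "complex_of_real (ps (conv p p) x) = complex_of_real ((ps p x)\<^sup>2)"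
    unfolding of_real_ps[OF conv_entire[OF assms]] cfps_conv
    using assms by (subst eval_fps_mult) (auto simp: of_real_ps[OF assms] power2_eq_square)
  then have "ps (conv p p) x = (ps p x)\<^sup>2" by (simp only: of_real_eq_iff)
  then show ?thesis by simp
qed

section \<open>The cumulant system\<close>

text \<open>The conditional expectation given X_t = x is modelled by the solution
  \<open>Xf t x\<close> started from x at time t and driven by the same W. The differentiability
  clause ensures that the iterated \<open>vector_derivative\<close> in \<open>xderiv\<close> is a
  genuine derivative. The jump relation is stated as existence and value of the left limit.\<close>

theorem theorem7p10:
  fixes M :: "'a measure" and W :: "real \<Rightarrow> 'a \<Rightarrow> real"
    and Xf :: "real \<Rightarrow> real \<Rightarrow> real \<Rightarrow> 'a \<Rightarrow> real"
    and a b c T :: real and n :: nat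
    and u1 u2 u3 v :: "real \<Rightarrow> complex"
    and p p1 p2 p3 q :: "nat \<Rightarrow> real"
    and f L :: "real \<Rightarrow> real \<Rightarrow> complex"
  assumes BM: "brownian_motion M W"
    and c_ne: "c \<noteq> 0" and T_pos: "T > 0"
    and flow: "\<And>t x \<omega>. \<omega> \<in> space M \<Longrightarrow> t \<in> {0..T} \<Longrightarrow>
        continuous_on {t..T} (\<lambda>s. Xf t x s \<omega>) \<and>
        (\<forall>s\<in>{t..T}. Xf t x s \<omega> = x + integral {t..s} (\<lambda>r. a + b * Xf t x r \<omega>) + c * (W s \<omega> - W t \<omega>))"
    and cont_u: "continuous_on {0..T} u1" "continuous_on {0..T} u2" "continuous_on {0..T} u3"
      "continuous_on {0..T} v"
    and re_u: "\<And>t. t \<in> {0..T} \<Longrightarrow> Re (u1 t) \<le> 0"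
      "\<And>t. t \<in> {0..T} \<Longrightarrow> Re (u2 t) = 0"
      "\<And>t. t \<in> {0..T} \<Longrightarrow> Re (u3 t) = 0"
      "\<And>t. t \<in> {0..T} \<Longrightarrow> Re (v t) = 0"
    and p1_sq: "p1 = conv p p"
    and negl: "negligible_dfact p" "negligible_dfact p2" "negligible_dfact p3" "negligible_dfact q"
    and n_pos: "n \<ge> 1"
    and f_def: "f = (\<lambda>t x. \<integral>\<omega>. exp (
          (\<Sum>j\<in>{j. j < n \<and> t \<le> real j * T / real n}.
              complex_of_real (T / real n) *
              (u1 (real j * T / real n) * complex_of_real (ps p1 (Xf t x (real j * T / real n) \<omega>))
             + u2 (real j * T / real n) * complex_of_real (ps p2 (Xf t x (real j * T / real n) \<omega>))
             + u3 (real j * T / real n) * complex_of_real (ps p3 (Xf t x (real j * T / real n) \<omega>))))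
          + v T * complex_of_real (ps q (Xf t x T \<omega>))) \<partial>M)"
    and nonvanish: "\<And>t x. t \<in> {0..T} \<Longrightarrow> f t x \<noteq> 0"
    and L_log: "\<And>t x. t \<in> {0..T} \<Longrightarrow> exp (L t x) = f t x"
    and L_cont: "\<And>j. j < n \<Longrightarrow>
        continuous_on ({real j * T / real n <.. real (Suc j) * T / real n} \<times> UNIV) (\<lambda>(t, x). L t x)"
    and L_jump: "\<And>j x. j < n \<Longrightarrow>
        ((\<lambda>s. L s x) \<longlongrightarrow>
           L (real j * T / real n) x - complex_of_real (T / real n) *
             (u1 (real j * T / real n) * complex_of_real (ps p1 x)
            + u2 (real j * T / real n) * complex_of_real (ps p2 x)
            + u3 (real j * T / real n) * complex_of_real (ps p3 x)))
        (at_right (real j * T / real n))"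
    and L_T: "\<And>x. L T x = v T * complex_of_real (ps q x)"
  shows "let \<phi> = (\<lambda>k t. xderiv k (L (T - t)) 0 / of_nat (fact k));
             \<phi>t = (\<lambda>t k. of_nat (k + 1) * \<phi> (k + 1) t)
         in (\<forall>k. \<forall>t\<in>{0..T}. xderiv k (L (T - t)) differentiable (at 0))
          \<and> (\<forall>k t. (\<exists>j<n. T - real (Suc j) * T / real n < t \<and> t < T - real j * T / real n) \<longrightarrow>
               (\<phi> k has_vector_derivative
                  (complex_of_real (b * real k) * \<phi> k t
                 + complex_of_real (a * real (k + 1)) * \<phi> (k + 1) t
                 + complex_of_real (c\<^sup>2 * real (k + 2) * real (k + 1) / 2) * \<phi> (k + 2) t
                 + complex_of_real (c\<^sup>2 / 2) * conv (\<phi>t t) (\<phi>t t) k)) (at t))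
          \<and> (\<forall>k j. j < n \<longrightarrow>
               (let t = T - real j * T / real n in
                 (\<phi> k \<longlongrightarrow> \<phi> k t - complex_of_real (T / real n) *
                     (u1 (T - t) * complex_of_real (p1 k) + u2 (T - t) * complex_of_real (p2 k)
                    + u3 (T - t) * complex_of_real (p3 k))) (at_left t)))
          \<and> (\<forall>k. \<phi> k 0 = v T * complex_of_real (q k))"
proof -
  define h where "h = T / real n"
  define tt where "tt = (\<lambda>j::nat. real j * T / real n)"
  have tt_fold: "real j * T / real n = tt j" for j by (simp add: tt_def)
  have h: "h > 0" using T_pos n_pos by (simp add: h_def)
  have tt_h: "tt j = real j * h" for j by (simp add: tt_def h_def)
  have tt_n: "tt n = T" using n_pos by (simp add: tt_def)
  have tt_Suc: "tt (Suc j) = tt j + h" for j by (simp add: tt_h algebra_simps)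
  have tt_add: "tt (j + i) = tt j + real i * h" for i j by (simp add: tt_h algebra_simps)
  have tt_le: "tt i \<le> tt j \<longleftrightarrow> i \<le> j" for i j using h by (simp add: tt_h)
  have tt_T: "tt j \<in> {0..T}" if "j \<le> n" for j
    using tt_le[of 0 j] tt_le[of j n] that tt_n by (simp add: tt_h)
  define pot where "pot = (\<lambda>j x. complex_of_real (T / real n) *
              (u1 (tt j) * complex_of_real (ps p1 x)
             + u2 (tt j) * complex_of_real (ps p2 x)
             + u3 (tt j) * complex_of_real (ps p3 x)))"
  have ent: "fps_conv_radius (cfps p1) = \<infinity>" "fps_conv_radius (cfps p2) = \<infinity>"
      "fps_conv_radius (cfps p3) = \<infinity>" "fps_conv_radius (cfps q) = \<infinity>"
    unfolding p1_sq by (intro conv_entire negligible_dfact_imp_entire negl)+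
  have pot_cont: "continuous_on UNIV (pot j)" for j
    unfolding pot_def by (intro continuous_intros continuous_on_of_real_ps ent)
  have pot_Re: "Re (pot j x) \<le> 0" if "j \<le> n" for j x
  proof -
    have "Re (pot j x) = h * (Re (u1 (tt j)) * ps p1 x)"
      using re_u(2,3)[OF tt_T[OF that]] by (simp add: pot_def h_def)
    also have "\<dots> \<le> 0"
      using h re_u(1)[OF tt_T[OF that]] ps_conv_self_nonneg[OF negligible_dfact_imp_entire[OF negl(1)], of x]
      unfolding p1_sq by (intro mult_nonneg_nonpos mult_nonpos_nonneg) auto
    finally show ?thesis .
  qed
  have pot_an: "analytic_at_0 (pot j)" for j
    unfolding pot_def by (intro analytic_at_0_cmult(1) analytic_at_0_add(1) analytic_at_0_ps(1) ent)
  have pot_xd: "xderiv k (pot j) 0 = of_nat (fact k) * (complex_of_real (T / real n) *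
      (u1 (tt j) * complex_of_real (p1 k) + u2 (tt j) * complex_of_real (p2 k) + u3 (tt j) * complex_of_real (p3 k)))" for j k
  proof -
    have 1: "analytic_at_0 (\<lambda>x. u1 (tt j) * complex_of_real (ps p1 x))"
      "analytic_at_0 (\<lambda>x. u2 (tt j) * complex_of_real (ps p2 x))"
      "analytic_at_0 (\<lambda>x. u3 (tt j) * complex_of_real (ps p3 x))"
      by (intro analytic_at_0_cmult(1) analytic_at_0_ps(1) ent)+
    show ?thesis
      unfolding pot_def
      by (simp only: 1 analytic_at_0_cmult(2) analytic_at_0_add ent analytic_at_0_ps)
         (simp add: algebra_simps)
  qed
  define \<Phi> where "\<Phi> = (\<lambda>t k. xderiv k (L t) 0 / of_nat (fact k))"
  define l where "l = (\<lambda>j x. L (tt j) x - pot j x)"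
  have step:
    "\<And>t. tt j < t \<Longrightarrow> t < tt (Suc j) \<Longrightarrow> analytic_at_0 (L t)"
    "analytic_at_0 (l j)"
    "\<And>t k. tt j < t \<Longrightarrow> t < tt (Suc j) \<Longrightarrow>
       ((\<lambda>t. \<Phi> t k) has_vector_derivative - riccati a b c (\<Phi> t) k) (at t)"
    "\<And>k. ((\<lambda>t. \<Phi> t k) \<longlongrightarrow> xderiv k (l j) 0 / of_nat (fact k)) (at_right (tt j))"
    if j: "j < n" for j
  proof -
    \<comment> \<open>m atoms, with indices from Suc j to n - 1, lie at or beyond the right end of
      the interval; index m of \<open>hh\<close> holds the terminal term.\<close>
    define m where "m = n - Suc j"
    define hh where "hh = (\<lambda>i. if i < m then pot (Suc j + i) else (\<lambda>x. v T * complex_of_real (ps q x)))"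
    have T_eq: "tt j + h + real m * h = T"
      using tt_add[of "Suc j" m] tt_n j by (simp add: m_def tt_Suc)
    have in_T: "t \<in> {0..T}" if "t \<in> {tt j<..tt j + h}" for t
      using that tt_T[of j] tt_T[of "Suc j"] j by (auto simp: tt_Suc)
    \<comment> \<open>The half-open interval matters: t > tt j leaves atom j out, while t <= tt (Suc
      j) keeps all later atoms, even at equality.\<close>
    have sm: "{i. i < n \<and> t \<le> real i * T / real n} = (\<lambda>i. Suc j + i) ` {..<m}" if t: "t \<in> {tt j<..tt j + h}" for t
    proof -
      have iff: "t \<le> real i * T / real n \<longleftrightarrow> Suc j \<le> i" for i
        unfolding tt_fold
      proof
        assume "t \<le> tt i"
        then have "\<not> tt i \<le> tt j" using t by simp
        then show "Suc j \<le> i" unfolding tt_le by simp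
      next
        assume "Suc j \<le> i"
        then have "tt (Suc j) \<le> tt i" unfolding tt_le .
        then show "t \<le> tt i" using t by (simp add: tt_Suc)
      qed
      have "{i. i < n \<and> t \<le> real i * T / real n} = {Suc j..<n}" unfolding iff by auto
      also have "\<dots> = (\<lambda>i. Suc j + i) ` {..<m}"
        using j unfolding m_def lessThan_atLeast0 image_add_atLeastLessThan by simp
      finally show ?thesis .
    qed
    have f_eq: "f t x = (\<integral>\<omega>. exp (\<Sum>i\<le>m. hh i (Xf t x (tt j + h + real i * h) \<omega>)) \<partial>M)"
      if t: "t \<in> {tt j<..tt j + h}" for t x
    proof -
      have "f t x = (\<integral>\<omega>. exp ((\<Sum>i<m. pot (Suc j + i) (Xf t x (tt (Suc j + i)) \<omega>)) + v T * complex_of_real (ps q (Xf t x T \<omega>))) \<partial>M)"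
        unfolding f_def sm[OF t] by (subst sum.reindex) (auto simp: pot_def tt_def o_def)
      also have "\<dots> = (\<integral>\<omega>. exp (\<Sum>i\<le>m. hh i (Xf t x (tt j + h + real i * h) \<omega>)) \<partial>M)"
      proof (intro Bochner_Integration.integral_cong refl arg_cong[where f = exp])
        fix \<omega>
        have "tt (Suc j + i) = tt j + h + real i * h" for i using tt_add[of "Suc j" i] by (simp only: tt_Suc)
        then show "(\<Sum>i<m. pot (Suc j + i) (Xf t x (tt (Suc j + i)) \<omega>)) + v T * complex_of_real (ps q (Xf t x T \<omega>))
            = (\<Sum>i\<le>m. hh i (Xf t x (tt j + h + real i * h) \<omega>))"
          unfolding lessThan_Suc_atMost[symmetric] sum.lessThan_Suc by (simp add: hh_def T_eq)
      qed
      finally show ?thesis .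
    qed
    have hh1: "continuous_on UNIV (hh i)" if "i \<le> m" for i
      unfolding hh_def by (auto intro!: continuous_intros pot_cont continuous_on_of_real_ps ent)
    have hh2: "Re (hh i y) \<le> 0" if "i \<le> m" for i y
      using re_u(4)[of T] T_pos pot_Re[of "Suc j + i" y] j that unfolding hh_def m_def by auto
    have flow': "continuous_on {t..tt j + h + real m * h} (\<lambda>s. Xf t x s \<omega>) \<and>
       (\<forall>s\<in>{t..tt j + h + real m * h}.
          Xf t x s \<omega> = x + integral {t..s} (\<lambda>r. a + b * Xf t x r \<omega>) + c * (W s \<omega> - W t \<omega>))"
      if "\<omega> \<in> space M" "t \<in> {tt j<..tt j + h}" for t x \<omega>
      unfolding T_eq by (rule flow[OF that(1) in_T[OF that(2)]])
    have log': "exp (L t x) = (\<integral>\<omega>. exp (\<Sum>i\<le>m. hh i (Xf t x (tt j + h + real i * h) \<omega>)) \<partial>M)"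
      if "t \<in> {tt j<..tt j + h}" for t x
      using L_log[OF in_T[OF that]] f_eq[OF that] by simp
    have cont': "continuous_on ({tt j<..tt j + h} \<times> UNIV) (\<lambda>(t, x). L t x)"
      using L_cont[OF j] unfolding tt_fold tt_Suc .
    have lim': "((\<lambda>s. L s x) \<longlongrightarrow> l j x) (at_right (tt j))" for x
      using L_jump[OF j, of x] unfolding l_def pot_def tt_fold .
    have t0: "0 \<le> tt j" using tt_T[of j] j by simp
    note R = log_expectation_step[where l = "l j" and L = L and hh = hh and Xf = Xf,
        OF BM t0 h c_ne flow' hh1 hh2 log' cont' lim']
    show "analytic_at_0 (L t)" if "tt j < t" "t < tt (Suc j)" for t
      by (rule R(1)) (use that in \<open>simp_all add: tt_Suc\<close>)
    show "analytic_at_0 (l j)" by (rule R(2)) simp_all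
    show "((\<lambda>t. \<Phi> t k) has_vector_derivative - riccati a b c (\<Phi> t) k) (at t)" if "tt j < t" "t < tt (Suc j)" for t k
      unfolding \<Phi>_def by (rule R(3)) (use that in \<open>simp_all add: tt_Suc\<close>)
    show "((\<lambda>t. \<Phi> t k) \<longlongrightarrow> xderiv k (l j) 0 / of_nat (fact k)) (at_right (tt j))" for k
      unfolding \<Phi>_def by (rule R(4)) simp_all
  qed
  have L_tt: "L (tt j) = (\<lambda>x. l j x + pot j x)" for j by (simp add: l_def)
  have an_tt: "analytic_at_0 (L (tt j))" if "j < n" for j
    unfolding L_tt by (intro analytic_at_0_add(1) step(2) pot_an that)
  have L_T': "L T = (\<lambda>x. v T * complex_of_real (ps q x))" using L_T by auto
  have an: "analytic_at_0 (L s)" if s: "s \<in> {0..T}" for s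
  proof (cases "s = T")
    case True
    then show ?thesis unfolding True L_T' by (intro analytic_at_0_cmult(1) analytic_at_0_ps(1) ent)
  next
    case False
    \<comment> \<open>The grid cell containing s; a grid point s = tt j is not interior to a cell
      and is handled through the jump.\<close>
    define j where "j = nat \<lfloor>s / h\<rfloor>"
    have "real j \<le> s / h" "s / h < real j + 1" using s h unfolding j_def by (auto simp: floor_correct)
    then have js: "tt j \<le> s" "s < tt (Suc j)" using h by (simp_all add: tt_h field_simps)
    have "tt j < tt n" using js s False tt_n by simp
    then have jn: "j < n" using h by (simp add: tt_h)
    show ?thesis
    proof (cases "tt j = s")
      case True
      then show ?thesis using an_tt[OF jn] by simp
    next
      case False
      then show ?thesis using step(1)[OF jn, of s] js by simp
    qed
  qed
  define \<phi> where "\<phi> = (\<lambda>k t. xderiv k (L (T - t)) 0 / of_nat (fact k))"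
  have \<phi>_eq: "\<phi> k t = \<Phi> (T - t) k" for k t by (simp add: \<phi>_def \<Phi>_def)
  have C1: "xderiv k (L (T - t)) differentiable (at 0)" if "t \<in> {0..T}" for k t
    using that by (intro analytic_at_0_differentiable an) auto
  have C2: "(\<phi> k has_vector_derivative riccati a b c (\<lambda>k. \<phi> k t) k) (at t)"
    if j: "j < n" and t: "T - tt (Suc j) < t" "t < T - tt j" for k t j
  proof -
    have "((\<lambda>t. \<Phi> t k) has_vector_derivative - riccati a b c (\<Phi> (T - t)) k) (at (T - t))"
      using t by (intro step(3)[OF j]) auto
    moreover have "((\<lambda>t. T - t) has_vector_derivative -1) (at t)"
      by (auto intro!: derivative_eq_intros simp: has_real_derivative_iff_has_vector_derivative[symmetric])
    \<comment> \<open>The sign from reversing time cancels the one in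
      \<open>step(3)\<close>.\<close>
    ultimately have "((\<lambda>t. \<Phi> t k) \<circ> (\<lambda>t. T - t) has_vector_derivative -1 *\<^sub>R - riccati a b c (\<Phi> (T - t)) k) (at t)"
      by (intro vector_diff_chain_at)
    then show ?thesis by (simp add: o_def \<phi>_eq[abs_def])
  qed
  have C3: "(\<phi> k \<longlongrightarrow> \<phi> k (T - tt j) - complex_of_real (T / real n) *
      (u1 (tt j) * complex_of_real (p1 k) + u2 (tt j) * complex_of_real (p2 k) + u3 (tt j) * complex_of_real (p3 k)))
      (at_left (T - tt j))" if j: "j < n" for k j
  proof -
    have "filterlim (\<lambda>t. T - t) (at_right (tt j)) (at_left (T - tt j))"
    proof -
      have "((\<lambda>t. T - t) \<longlongrightarrow> T - (T - tt j)) (at_left (T - tt j))" by (intro tendsto_intros)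
      moreover have "eventually (\<lambda>t. T - t \<in> {tt j<..} \<and> T - t \<noteq> tt j) (at_left (T - tt j))"
        by (auto simp: eventually_at_filter)
      ultimately show ?thesis by (simp add: filterlim_at)
    qed
    from filterlim_compose[OF step(4)[OF j] this]
    have "(\<phi> k \<longlongrightarrow> xderiv k (l j) 0 / of_nat (fact k)) (at_left (T - tt j))" by (simp add: \<phi>_eq[abs_def])
    moreover have "xderiv k (L (tt j)) 0 = xderiv k (l j) 0 + xderiv k (pot j) 0"
      unfolding L_tt by (rule analytic_at_0_add(2)[OF step(2)[OF j] pot_an])
    ultimately show ?thesis by (simp add: \<phi>_def pot_xd add_divide_distrib)
  qed
  have C4: "\<phi> k 0 = v T * complex_of_real (q k)" for k
    unfolding \<phi>_def by (simp add: L_T' analytic_at_0_cmult(2) analytic_at_0_ps ent)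
  show ?thesis
    unfolding Let_def \<phi>_def[symmetric]
    using C1 C2[unfolded riccati_def tt_def] C3[unfolded tt_def] C4
    by (intro conjI allI ballI impI) (auto simp: tt_def)
qed

end
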